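(* Let $\mathscr{D},\omega,\varphi,V,\pi_N,C_N,\Omega$ and the operators $\mathbf{T},\mathbf{R},\mathbf{P},\mathbf{Q}$ be as in the context. Let $B_j$ ($j\ge 0$) be the coefficient functions in the asymptotic expansion of the monic orthogonal polynomials, i.e. bounded holomorphic functions in a (connected) neighborhood of $\mathbb{C}\setminus\mathscr{D}$ with $B_0\equiv 1$, $B_j(\infty)=0$ for $j\ge1$, such that for every $\varkappa\in\mathbb{N}$ and $A>0$, $$\pi_N(z)=C_N\varphi'(z)\varphi(z)^N\mathrm{e}^{V(z)}\Big(\sum_{j=0}^{\varkappa}N^{-j}B_j(z)+\mathrm{O}(N^{-\varkappa-1})\Big),\qquad N\to\infty,$$ uniformly for $\mathrm{dist}_{\mathbb{C}}(z,\mathbb{C}\setminus\mathscr{D})\le AN^{-1}\log N$. Then $B_j=X_j\circ\varphi$, where $X_0\equiv 1$ and, for $j\ge1$, $X_j$ is determined by the recursive condition $$X_j\in H^2_{-,0}\cap\big(-\Xi_j+H^2\big),\qquad \Xi_j=\sum_{l=0}^{j-1}(-1)^{j-l}\,\mathbf{R}\mathbf{T}^{j-l}X_l,$$ with solution $$X_j=\mathbf{Q}\mathbf{T}\,[(\mathbf{Q}-\mathbf{I})\mathbf{T}]^{j-1}X_0,\qquad j=1,2,3,\ldots.$$ Moreover, for every $\varkappa\in\mathbb{N}$, the sum $S_N=\sum_{j=0}^{\varkappa}N^{-j}X_j$ is given by $$S_N=X_0+\tfrac1N\,\mathbf{Q}\mathbf{T}\sum_{j=0}^{\varkappa-1}N^{-j}[(\mathbf{Q}-\mathbf{I})\mathbf{T}]^{j}X_0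 .$$
   Context: $\mathscr{D}\subset\mathbb{C}$ is a bounded Jordan domain with real-analytic boundary, and $\omega\ge 0$ is a continuous weight function on $\mathscr{D}$ such that $\log\omega$ extends to a real-analytic function in a neighborhood of $\partial\mathscr{D}$ (so $\omega$ is defined and strictly positive near $\partial\mathscr{D}$). $\mathbb{N}=\{0,1,2,\ldots\}$, $\mathbb{T}$ is the unit circle, $\mathbb{D}_{\mathrm e}=\{|z|>1\}$, $\mathrm{dA}=\pi^{-1}\mathrm{d}x\,\mathrm{d}y$. $\varphi$ is the conformal mapping of $\mathbb{C}\setminus\overline{\mathscr{D}}$ onto $\mathbb{D}_{\mathrm e}$ with $\varphi(\infty)=\infty$ and $\varphi'(\infty)>0$; it extends to a univalent holomorphic function in a neighborhood of $\mathbb{C}\setminus\mathscr{D}$. $V$ is the Szegő function of $\omega$ relative to $\mathscr{D}$: the unique bounded holomorphic function on $\mathbb{C}\setminus\overline{\mathscr{D}}$ (including at $\infty$) with $2\,\mathrm{Re}\,V=-\log\omega$ on $\partial\mathscr{D}$ and $V(\infty)\in\mathbb{R}$; it extends holomorphically across $\partial\mathscr{D}$. $\pi_N$ is the monic polynomial of degree $N$ orthogonal to all polynomials of degree $\le N-1$ in $L^2(\mathscr{D},\omega\,\mathrm{dA})$, and $C_N=(\varphi'(\infty))^{-N-1}\mathrm{e}^{-V(\infty)}$. The modified weight is $\Omega=\mathrm{e}^{2\mathrm{Re}\,V\circ\varphi^{-1}}\,\omega\circ\varphi^{-1}$, which is real-analytic and positive in a neighborhood of $\mathbb{T}$ with $\Omega|_{\mathbb{T}}=1$.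 The operator $\mathbf{T}$ acts on functions $f$ that are real-analytic in a neighborhood of $\mathbb{T}$ by $$\mathbf{T}f(z)=\tfrac{1}{\Omega(z)}\,(z\partial_z+\mathbf{I})\big(f\,\Omega\big)(z),\qquad \partial_z=\tfrac12(\partial_x-\mathrm{i}\partial_y),$$ with $\mathbf{I}$ the identity. $H^2\subset L^2(\mathbb{T})$ is the Hardy space (functions with Fourier coefficients supported on $n\ge0$) and $H^2_{-,0}\subset L^2(\mathbb{T})$ is the space of functions with Fourier coefficients supported on $n\le -1$ (boundary values of holomorphic functions on $\mathbb{D}_{\mathrm e}$ vanishing at infinity). $\mathbf{P}$ is the orthogonal projection of $L^2(\mathbb{T})$ onto $H^2_{-,0}$, $\mathbf{R}$ is restriction to $\mathbb{T}$, and $\mathbf{Q}=\mathbf{P}\mathbf{R}$. For $f$ real-analytic near $\mathbb{T}$, $\mathbf{Q}f$ is regarded as a holomorphic function in a neighborhood of $\overline{\mathbb{D}}_{\mathrm e}$ (vanishing at infinity), so that $\mathbf{T}$ can be applied to it. *)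

theory Defs
  imports "HOL-Complex_Analysis.Complex_Analysis"
begin

text \<open>Functions that are only defined in an unspecified neighbourhood of a set are modelled as
  total functions and compared as germs along that set. Holomorphy in a neighbourhood of \<open>S\<close> is the
  library's \<^term>\<open>f analytic_on S\<close>.\<close>

definition near :: "complex set \<Rightarrow> (complex \<Rightarrow> bool) \<Rightarrow> bool" where
  "near S P \<longleftrightarrow> (\<exists>G. open G \<and> S \<subseteq> G \<and> (\<forall>z\<in>G. P z))"

definition real_analytic_on :: "(complex \<Rightarrow> 'a::real_normed_vector) \<Rightarrow> complex set \<Rightarrow> bool" where
  "real_analytic_on f S \<longleftrightarrow>
     (\<forall>a\<in>S. \<exists>r>0. \<exists>c :: nat \<Rightarrow> nat \<Rightarrow> 'a. \<forall>z\<in>ball a r.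
        ((\<lambda>(m, n). (Re (z - a) ^ m * Im (z - a) ^ n) *\<^sub>R c m n) has_sum f z) UNIV)"

definition closed_exterior :: "complex set" where
  "closed_exterior = {z. 1 \<le> norm z}"

definition analytic_jordan_domain :: "complex set \<Rightarrow> bool" where
  "analytic_jordan_domain D \<longleftrightarrow>
     (\<exists>h A. open A \<and> sphere 0 1 \<subseteq> A \<and> h holomorphic_on A \<and> inj_on h A \<and>
        D = inside (h ` sphere 0 1))"

text \<open>The symbol \<open>\<omega>\<close> also denotes the extension of the weight across the boundary of \<open>D\<close>.\<close>

definition admissible_weight :: "complex set \<Rightarrow> (complex \<Rightarrow> real) \<Rightarrow> bool" where
  "admissible_weight D \<omega> \<longleftrightarrow>
     continuous_on D \<omega> \<and> (\<forall>z\<in>D. 0 \<le> \<omega> z) \<and>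
     (\<exists>G. open G \<and> frontier D \<subseteq> G \<and> (\<forall>z\<in>G. 0 < \<omega> z) \<and> real_analytic_on (\<lambda>z. ln (\<omega> z)) G)"

text \<open>\<open>U\<close> is a neighbourhood of the complement of \<open>D\<close> to which the conformal mapping \<open>\<phi>\<close> extends
  univalently, and \<open>c\<close> is the value of the derivative of \<open>\<phi>\<close> at infinity.\<close>

definition exterior_conformal_map ::
    "complex set \<Rightarrow> complex set \<Rightarrow> (complex \<Rightarrow> complex) \<Rightarrow> real \<Rightarrow> bool" where
  "exterior_conformal_map D U \<phi> c \<longleftrightarrow>
     open U \<and> - D \<subseteq> U \<and> \<phi> holomorphic_on U \<and> inj_on \<phi> U \<and>
     \<phi> ` (- closure D) = {z. 1 < norm z} \<and>
     filterlim \<phi> at_infinity at_infinity \<and>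
     (deriv \<phi> \<longlongrightarrow> of_real c) at_infinity \<and> 0 < c"

text \<open>\<open>v\<close> is the value of \<open>V\<close> at infinity.\<close>

definition szego_function ::
    "complex set \<Rightarrow> (complex \<Rightarrow> real) \<Rightarrow> (complex \<Rightarrow> complex) \<Rightarrow> real \<Rightarrow> bool" where
  "szego_function D \<omega> V v \<longleftrightarrow>
     V analytic_on (- D) \<and> bounded (V ` (- closure D)) \<and>
     (\<forall>z\<in>frontier D. 2 * Re (V z) = - ln (\<omega> z)) \<and>
     (V \<longlongrightarrow> of_real v) at_infinity"

definition area_measure :: "complex measure" where
  "area_measure = scale_measure (ennreal (1 / pi)) lborel"

definition monic_orthogonal_poly ::
    "complex set \<Rightarrow> (complex \<Rightarrow> real) \<Rightarrow> nat \<Rightarrow> complex poly \<Rightarrow> bool" where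
  "monic_orthogonal_poly D \<omega> N p \<longleftrightarrow>
     degree p = N \<and> lead_coeff p = 1 \<and>
     (\<forall>q. degree q < N \<longrightarrow>
        (LINT z:D|area_measure. poly p z * cnj (poly q z) * of_real (\<omega> z)) = 0)"

definition leading_const :: "real \<Rightarrow> real \<Rightarrow> nat \<Rightarrow> real" where
  "leading_const c v N = c powi (- int N - 1) * exp (- v)"

definition modified_weight ::
    "(complex \<Rightarrow> real) \<Rightarrow> complex set \<Rightarrow> (complex \<Rightarrow> complex) \<Rightarrow> (complex \<Rightarrow> complex) \<Rightarrow> complex \<Rightarrow> real" where
  "modified_weight \<omega> U \<phi> V z =
     exp (2 * Re (V (inv_into U \<phi> z))) * \<omega> (inv_into U \<phi> z)"

text \<open>Elements of the Lebesgue and Hardy spaces of the circle are represented by functions on the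
  plane of which only the values on the circle matter; equality in these spaces is equality
  almost everywhere on the circle.\<close>

abbreviation angle_measure :: "real measure" where
  "angle_measure \<equiv> lebesgue_on {0..2 * pi}"

definition L2_circle :: "(complex \<Rightarrow> complex) set" where
  "L2_circle = {f. (\<lambda>t. f (cis t)) \<in> borel_measurable angle_measure \<and>
                   integrable angle_measure (\<lambda>t. (norm (f (cis t)))\<^sup>2)}"

definition circle_eq :: "(complex \<Rightarrow> complex) \<Rightarrow> (complex \<Rightarrow> complex) \<Rightarrow> bool" where
  "circle_eq f g \<longleftrightarrow> (AE t in angle_measure. f (cis t) = g (cis t))"

definition circle_inner :: "(complex \<Rightarrow> complex) \<Rightarrow> (complex \<Rightarrow> complex) \<Rightarrow> complex" where
  "circle_inner f g = (LINT t|angle_measure. f (cis t) * cnj (g (cis t))) / of_real (2 * pi)"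

definition fourier_coeff :: "(complex \<Rightarrow> complex) \<Rightarrow> int \<Rightarrow> complex" where
  "fourier_coeff f n = circle_inner f (\<lambda>z. z powi n)"

definition H2 :: "(complex \<Rightarrow> complex) set" where
  "H2 = {f \<in> L2_circle. \<forall>n<0. fourier_coeff f n = 0}"

definition H2_minus0 :: "(complex \<Rightarrow> complex) set" where
  "H2_minus0 = {f \<in> L2_circle. \<forall>n\<ge>0. fourier_coeff f n = 0}"

definition wirtinger_dz :: "(complex \<Rightarrow> complex) \<Rightarrow> complex \<Rightarrow> complex" where
  "wirtinger_dz f z =
     (vector_derivative (\<lambda>x. f (z + of_real x)) (at 0)
      - \<i> * vector_derivative (\<lambda>y. f (z + \<i> * of_real y)) (at 0)) / 2"

definition op_T :: "(complex \<Rightarrow> real) \<Rightarrow> (complex \<Rightarrow> complex) \<Rightarrow> complex \<Rightarrow> complex" where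
  "op_T \<Omega> f z =
     (z * wirtinger_dz (\<lambda>w. f w * of_real (\<Omega> w)) z + f z * of_real (\<Omega> z)) / of_real (\<Omega> z)"

definition op_R :: "(complex \<Rightarrow> complex) \<Rightarrow> complex \<Rightarrow> complex" where
  "op_R f z = (if z \<in> sphere 0 1 then f z else 0)"

definition op_P :: "(complex \<Rightarrow> complex) \<Rightarrow> complex \<Rightarrow> complex" where
  "op_P f = (SOME g. g \<in> H2_minus0 \<and> (\<forall>h\<in>H2_minus0. circle_inner (\<lambda>z. f z - g z) h = 0))"

text \<open>The composition of \<^const>\<open>op_P\<close> with \<^const>\<open>op_R\<close>, regarded as a holomorphic function in a
  neighbourhood of the closed exterior disk vanishing at infinity. For a function that is
  real-analytic near the circle the germ of the result along that set is unique.\<close>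

definition op_Q :: "(complex \<Rightarrow> complex) \<Rightarrow> complex \<Rightarrow> complex" where
  "op_Q f = (SOME F. F analytic_on closed_exterior \<and> (F \<longlongrightarrow> 0) at_infinity \<and>
                     circle_eq F (op_P (op_R f)))"

definition op_QIT :: "(complex \<Rightarrow> real) \<Rightarrow> (complex \<Rightarrow> complex) \<Rightarrow> complex \<Rightarrow> complex" where
  "op_QIT \<Omega> f = (\<lambda>z. op_Q (op_T \<Omega> f) z - op_T \<Omega> f z)"

definition Xi :: "(complex \<Rightarrow> real) \<Rightarrow> (nat \<Rightarrow> complex \<Rightarrow> complex) \<Rightarrow> nat \<Rightarrow> complex \<Rightarrow> complex" where
  "Xi \<Omega> X j = (\<lambda>z. \<Sum>l<j. (-1) ^ (j - l) * op_R ((op_T \<Omega> ^^ (j - l)) (X l)) z)"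

end

theory Submission
  imports Defs
begin

text \<open>
  The proof tests the orthogonality of \<open>p N\<close> against \<open>p (N - m)\<close> for fixed \<open>m \<ge> 1\<close>, which has an
  expansion of the same kind. By the maximum principle both polynomials are negligible at distance
  more than a multiple of \<open>(log N) / N\<close> from the boundary, so the inner product lives in a thin
  collar, which the conformal map turns into an annulus inside the unit circle. There the complex
  Green formula converts division by \<open>N\<close> into a trace on the circle minus the same integral with
  \<open>T\<close> applied. For \<open>Y j = X j - T X (j-1) + T T X (j-2) - ...\<close>, which satisfies
  \<open>X (j+1) = Y (j+1) + T (Y j)\<close>, the expansion telescopes, and comparing powers of \<open>N\<close> shows
  inductively that every \<open>Y j\<close> has no negative Fourier coefficients. Since \<open>X j\<close> has only negative
  ones, \<open>X (j+1) = Q T (Y j)\<close> and \<open>Y (j+1) = (Q - I) T (Y j)\<close>, which are the asserted formulas.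
\<close>

text \<open>Test functions have to be polynomials, whereas the natural ones would carry the factor
  \<phi>' \<phi>^k e^V. The polynomial \<open>p (N - m)\<close> has this factor to leading order in
  the collar; there the Jacobian of \<psi> cancels the factors \<phi>', and e^(2 Re V) completes the
  weight to \<open>\<Omega>\<close>. The quotient that is left tends to 1 on the circle, so for
  large N the pairing isolates a single Fourier coefficient.

  The collar has width (\<kappa> + 2) (ln N) / N because then (1 - \<delta>)^N is at most
  N^(-\<kappa> - 2). This precision is what the induction consumes: the term with
  \<open>Y \<kappa>\<close> carries N^(-\<kappa>), the Green formula multiplies by N, and one factor
  1/N must remain. The pointwise error N^(-\<kappa> - 1) of the expansion reaches the same order
  because integrating |z|^N over the collar gains another 1/N.

  The Green formula uses derivatives off the circle, while Q sees only a trace and must return a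
  holomorphic germ. Identities involving T are therefore proved near the circle, in a class stable
  under T whose traces continue holomorphically.\<close>

lemma near_iff: "near S P \<longleftrightarrow> (\<forall>a\<in>S. eventually P (nhds a))"
proof
  assume "near S P"
  then show "\<forall>a\<in>S. eventually P (nhds a)"
    unfolding near_def eventually_nhds by blast
next
  assume *: "\<forall>a\<in>S. eventually P (nhds a)"
  \<comment> \<open>The largest open set on which \<open>P\<close> holds serves all points at once,
    so no neighbourhoods need to be chosen.\<close>
  define G where "G = \<Union>{A. open A \<and> (\<forall>z\<in>A. P z)}"
  have "open G" "\<forall>z\<in>G. P z" unfolding G_def by auto
  moreover have "S \<subseteq> G"
    using * unfolding G_def eventually_nhds by blast
  ultimately show "near S P" unfolding near_def by blast
qed

lemma nearD: "near S P \<Longrightarrow> z \<in> S \<Longrightarrow> P z"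
  unfolding near_def by blast

lemma near_mono: "near S P \<Longrightarrow> (\<And>z. P z \<Longrightarrow> Q z) \<Longrightarrow> near S Q"
  unfolding near_def by blast

lemma near_elim2: "near S P \<Longrightarrow> near S Q \<Longrightarrow> (\<And>z. P z \<Longrightarrow> Q z \<Longrightarrow> R z) \<Longrightarrow> near S R"
  unfolding near_iff by (blast intro: eventually_elim2)

lemma dist_sgn: "z \<noteq> 0 \<Longrightarrow> dist z (sgn z) = \<bar>norm z - 1\<bar>" for z :: complex
proof -
  assume nz: "z \<noteq> 0"
  have "z = of_real (norm z) * sgn z"
    using nz by (simp add: sgn_div_norm scaleR_conv_of_real)
  then have "z - sgn z = of_real (norm z - 1) * sgn z"
    by (metis (no_types, lifting) left_diff_distrib mult_1 of_real_1 of_real_diff)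
  then have "norm (z - sgn z) = \<bar>norm z - 1\<bar> * norm (sgn z)"
    by (metis norm_mult norm_of_real)
  then show ?thesis using nz by (simp add: dist_norm norm_sgn)
qed

text \<open>Compactness of the circle turns an arbitrary neighbourhood into an annulus of uniform
  width. In this way germ statements become usable on collars that shrink with N.\<close>

lemma near_sphere_annulus:
  assumes "near (sphere 0 1) P"
  shows "\<exists>e>0. e < 1 \<and> (\<forall>z. \<bar>norm z - 1\<bar> < e \<longrightarrow> P z)"
proof -
  obtain G where G: "open G" "sphere 0 1 \<subseteq> G" "\<And>z. z \<in> G \<Longrightarrow> P z"
    using assms unfolding near_def by blast
  obtain e where e: "0 < e" "(\<Union>x\<in>sphere 0 1. ball x e) \<subseteq> G"
    using compact_subset_open_imp_ball_epsilon_subset[OF compact_sphere G(1,2)] by blast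
  \<comment> \<open>The cap 1/2 keeps the origin away, so that the radial projection
    \<open>sgn z\<close> lies on the circle.\<close>
  show ?thesis
  proof (intro exI[of _ "min e (1/2)"] conjI allI impI)
    fix z :: complex assume z: "\<bar>norm z - 1\<bar> < min e (1/2)"
    then have nz: "z \<noteq> 0" by auto
    have "sgn z \<in> sphere 0 1" using nz by (simp add: norm_sgn)
    moreover have "dist (sgn z) z < e" using dist_sgn[OF nz] z by (simp add: dist_commute)
    ultimately show "P z" using e G(3) by fastforce
  qed (use e in auto)
qed

text \<open>The closed exterior is not compact, but its boundary is: beyond the circle
  \<open>P\<close> holds on the set itself, and only the part just inside needs a uniform
  width.\<close>

lemma near_closed_exterior_iff:
  "near closed_exterior P \<longleftrightarrow> (\<exists>e>0. e < 1 \<and> (\<forall>z. norm z > 1 - e \<longrightarrow> P z))"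
proof
  assume P: "near closed_exterior P"
  then have "near (sphere 0 1) P" unfolding near_iff closed_exterior_def by simp
  then obtain e where e: "0 < e" "e < 1" "\<And>z. \<bar>norm z - 1\<bar> < e \<Longrightarrow> P z"
    using near_sphere_annulus[of P] by blast
  have "P z" if "norm z > 1 - e" for z
  proof (cases "norm z \<ge> 1")
    case True
    then show ?thesis using P unfolding near_def closed_exterior_def by blast
  next
    case False
    then show ?thesis using that e(3) by auto
  qed
  then show "\<exists>e>0. e < 1 \<and> (\<forall>z. norm z > 1 - e \<longrightarrow> P z)" using e by blast
next
  assume "\<exists>e>0. e < 1 \<and> (\<forall>z. norm z > 1 - e \<longrightarrow> P z)"
  then obtain e where e: "0 < e" "\<And>z. norm z > 1 - e \<Longrightarrow> P z" by blast
  have "open {z::complex. 1 - e < norm z}" by (intro open_Collect_less continuous_intros)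
  then show "near closed_exterior P"
    unfolding near_def closed_exterior_def using e by (intro exI[of _ "{z. 1 - e < norm z}"]) auto
qed

lemma analytic_on_imp_continuous_on: "f analytic_on S \<Longrightarrow> continuous_on S f"
  by (meson analytic_imp_holomorphic holomorphic_on_imp_continuous_on)

lemma near_closed_exterior_sphere: "near closed_exterior P \<Longrightarrow> near (sphere 0 1) P"
  unfolding near_iff closed_exterior_def by simp

lemma analytic_on_sphere_holomorphic:
  assumes "h analytic_on sphere 0 1"
  shows "\<exists>e>0. e < 1 \<and> h holomorphic_on {z. \<bar>norm z - 1\<bar> < e}"
proof -
  obtain G where G: "open G" "sphere 0 1 \<subseteq> G" "h holomorphic_on G"
    using assms by (auto simp: analytic_on_holomorphic)
  have "near (sphere 0 1) (\<lambda>z. z \<in> G)" unfolding near_def using G by blast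
  then obtain e where e: "e > 0" "e < 1" "\<And>z. \<bar>norm z - 1\<bar> < e \<Longrightarrow> z \<in> G"
    using near_sphere_annulus[of "\<lambda>z. z \<in> G"] by blast
  then show ?thesis using G(3) holomorphic_on_subset[of h G "{z. \<bar>norm z - 1\<bar> < e}"] by blast
qed

subsection \<open>The space of square integrable functions on the circle\<close>

lemma integrable_angle_continuous:
  fixes f :: "real \<Rightarrow> 'a::euclidean_space"
  assumes "continuous_on {0..2*pi} f"
  shows "integrable angle_measure f"
  using assms by (intro continuous_imp_integrable_real)

lemma continuous_on_cis_comp:
  assumes "continuous_on (sphere 0 1) f"
  shows "continuous_on S (\<lambda>t. f (cis t))"
proof (rule continuous_on_compose2[OF assms])
  show "continuous_on S cis" by (intro continuous_intros)
qed auto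

lemma continuous_in_L2_circle:
  assumes "continuous_on (sphere 0 1) f"
  shows "f \<in> L2_circle"
proof -
  have "continuous_on {0..2*pi} (\<lambda>t. f (cis t))" by (rule continuous_on_cis_comp[OF assms])
  then show ?thesis unfolding L2_circle_def
    by (auto intro!: borel_measurable_integrable integrable_angle_continuous continuous_intros)
qed

lemma L2_circle_measurable: "f \<in> L2_circle \<Longrightarrow> (\<lambda>t. f (cis t)) \<in> borel_measurable angle_measure"
  by (simp add: L2_circle_def)

lemma L2_circle_mult_integrable:
  assumes "f \<in> L2_circle" "g \<in> L2_circle"
  shows "integrable angle_measure (\<lambda>t. f (cis t) * cnj (g (cis t)))"
proof (rule Bochner_Integration.integrable_bound)
  show "integrable angle_measure (\<lambda>t. (norm (f (cis t)))\<^sup>2 + (norm (g (cis t)))\<^sup>2)"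
    using assms by (auto simp: L2_circle_def)
  show "(\<lambda>t. f (cis t) * cnj (g (cis t))) \<in> borel_measurable angle_measure"
    using measurable_compose[OF L2_circle_measurable[OF assms(2)] borel_measurable_continuous_onI[OF continuous_on_cnj[OF continuous_on_id]]]
      L2_circle_measurable[OF assms(1)] by measurable
  have "a * b \<le> a\<^sup>2 + b\<^sup>2" if "a \<ge> 0" "b \<ge> 0" for a b :: real
    using sum_squares_bound[of a b] mult_nonneg_nonneg[OF that] by linarith
  then show "AE t in angle_measure. norm (f (cis t) * cnj (g (cis t)))
      \<le> norm ((norm (f (cis t)))\<^sup>2 + (norm (g (cis t)))\<^sup>2)"
    by (auto simp: norm_mult)
qed

lemma L2_circle_integrable:
  assumes "f \<in> L2_circle"
  shows "integrable angle_measure (\<lambda>t. f (cis t))"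
  using L2_circle_mult_integrable[OF assms continuous_in_L2_circle[of "\<lambda>_. 1"]] by simp

lemma L2_circle_cmult:
  assumes "f \<in> L2_circle"
  shows "(\<lambda>z. c * f z) \<in> L2_circle"
proof -
  have "integrable angle_measure (\<lambda>t. (norm c)\<^sup>2 * (norm (f (cis t)))\<^sup>2)"
    using assms by (auto simp: L2_circle_def)
  moreover have "(\<lambda>t. c * f (cis t)) \<in> borel_measurable angle_measure"
    using L2_circle_measurable[OF assms] by measurable
  ultimately show ?thesis by (simp add: L2_circle_def norm_mult power_mult_distrib)
qed

lemma L2_circle_add:
  assumes "f \<in> L2_circle" "g \<in> L2_circle"
  shows "(\<lambda>z. f z + g z) \<in> L2_circle"
proof -
  have m: "(\<lambda>t. f (cis t) + g (cis t)) \<in> borel_measurable angle_measure"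
    using assms[THEN L2_circle_measurable] by measurable
  have "integrable angle_measure (\<lambda>t. (norm (f (cis t) + g (cis t)))\<^sup>2)"
  proof (rule Bochner_Integration.integrable_bound)
    show "integrable angle_measure (\<lambda>t. 2 * (norm (f (cis t)))\<^sup>2 + 2 * (norm (g (cis t)))\<^sup>2)"
      using assms by (auto simp: L2_circle_def)
    show "(\<lambda>t. (norm (f (cis t) + g (cis t)))\<^sup>2) \<in> borel_measurable angle_measure"
      using m by measurable
    have "(norm (a + b))\<^sup>2 \<le> 2 * (norm a)\<^sup>2 + 2 * (norm b)\<^sup>2" for a b :: complex
    proof -
      have "(norm (a + b))\<^sup>2 \<le> (norm a + norm b)\<^sup>2" by (simp add: norm_triangle_ineq power_mono)
      also have "\<dots> \<le> 2 * (norm a)\<^sup>2 + 2 * (norm b)\<^sup>2"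
        using sum_squares_bound[of "norm a" "norm b"] by (simp add: power2_sum)
      finally show ?thesis .
    qed
    then show "AE t in angle_measure. norm ((norm (f (cis t) + g (cis t)))\<^sup>2)
       \<le> norm (2 * (norm (f (cis t)))\<^sup>2 + 2 * (norm (g (cis t)))\<^sup>2)" by auto
  qed
  with m show ?thesis by (simp add: L2_circle_def)
qed

lemma L2_circle_diff:
  assumes "f \<in> L2_circle" "g \<in> L2_circle"
  shows "(\<lambda>z. f z - g z) \<in> L2_circle"
  using L2_circle_add[OF assms(1) L2_circle_cmult[OF assms(2), of "-1"]] by simp

lemma circle_inner_add:
  assumes "f \<in> L2_circle" "g \<in> L2_circle" "h \<in> L2_circle"
  shows "circle_inner (\<lambda>z. f z + g z) h = circle_inner f h + circle_inner g h"
  using L2_circle_mult_integrable[OF assms(1,3)] L2_circle_mult_integrable[OF assms(2,3)]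
  by (simp add: circle_inner_def distrib_right add_divide_distrib)

lemma circle_inner_diff:
  assumes "f \<in> L2_circle" "g \<in> L2_circle" "h \<in> L2_circle"
  shows "circle_inner (\<lambda>z. f z - g z) h = circle_inner f h - circle_inner g h"
  using L2_circle_mult_integrable[OF assms(1,3)] L2_circle_mult_integrable[OF assms(2,3)]
  by (simp add: circle_inner_def left_diff_distrib diff_divide_distrib)

lemma circle_inner_cmult: "circle_inner (\<lambda>z. c * f z) h = c * circle_inner f h"
  by (simp add: circle_inner_def mult.assoc)

lemma circle_inner_add_right:
  assumes "f \<in> L2_circle" "g \<in> L2_circle" "h \<in> L2_circle"
  shows "circle_inner h (\<lambda>z. f z + g z) = circle_inner h f + circle_inner h g"
  using L2_circle_mult_integrable[OF assms(3,1)] L2_circle_mult_integrable[OF assms(3,2)]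
  by (simp add: circle_inner_def distrib_left add_divide_distrib)

lemma circle_inner_cmult_right: "circle_inner h (\<lambda>z. c * f z) = cnj c * circle_inner h f"
proof -
  have "(LINT t|angle_measure. h (cis t) * cnj (c * f (cis t))) =
        (LINT t|angle_measure. cnj c * (h (cis t) * cnj (f (cis t))))"
    by (intro Bochner_Integration.integral_cong) (auto simp: mult_ac)
  then show ?thesis by (simp add: circle_inner_def)
qed

lemma circle_inner_cong:
  assumes "\<And>z. norm z = 1 \<Longrightarrow> f z = f' z" "\<And>z. norm z = 1 \<Longrightarrow> g z = g' z"
  shows "circle_inner f g = circle_inner f' g'"
  unfolding circle_inner_def using assms by simp

lemma circle_inner_cong_circle_eq:
  assumes "circle_eq f f'" "f \<in> L2_circle" "f' \<in> L2_circle" "g \<in> L2_circle"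
  shows "circle_inner f g = circle_inner f' g"
  unfolding circle_inner_def
  apply (rule arg_cong[where f = "\<lambda>x. x / _"])
  apply (rule integral_cong_AE)
  using assms(1) L2_circle_mult_integrable[OF assms(2,4)] L2_circle_mult_integrable[OF assms(3,4)]
  by (auto simp: circle_eq_def dest!: borel_measurable_integrable elim: AE_mp)

lemma continuous_on_sphere_powi [continuous_intros]:
  "continuous_on (sphere (0::complex) 1) (\<lambda>z. z powi n)"
  by (intro continuous_intros) auto

lemma powi_in_L2_circle [simp]: "(\<lambda>z. z powi n) \<in> L2_circle"
  by (intro continuous_in_L2_circle continuous_on_sphere_powi)

lemma integral_cis_multiple:
  "integral {0..2*pi} (\<lambda>t. cis (of_int k * t)) = (if k = 0 then 2 * of_real pi else 0)"
proof (cases "k = 0")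
  case True
  then show ?thesis by (simp add: scaleR_conv_of_real)
next
  case False
  have "((\<lambda>t. cis (of_int k * t)) has_integral
     (cis (of_int k * (2*pi)) / (\<i> * of_int k) - cis (of_int k * 0) / (\<i> * of_int k))) {0..2*pi}"
  proof (rule fundamental_theorem_of_calculus)
    fix t assume "t \<in> {0..2*pi}"
    show "((\<lambda>t. cis (of_int k * t) / (\<i> * of_int k)) has_vector_derivative cis (of_int k * t)) (at t within {0..2*pi})"
      unfolding cis_conv_exp
      using False
      by (auto intro!: derivative_eq_intros has_vector_derivative_real_field simp: field_simps)
  qed simp
  moreover have "cis (of_int k * (2*pi)) = 1"
    by (metis cis_multiple_2pi mult.commute Ints_of_int)
  ultimately show ?thesis using False by (simp add: integral_unique)
qed

lemma fourier_coeff_powi: "fourier_coeff (\<lambda>z. z powi m) n = (if m = n then 1 else 0)"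
proof -
  have eq: "cis t powi m * cnj (cis t powi n) = cis (of_int (m - n) * t)" for t
    by (simp add: cis_power_int cis_cnj cis_mult algebra_simps)
  have "(LINT t|angle_measure. cis (of_int (m - n) * t)) = integral {0..2*pi} (\<lambda>t. cis (of_int (m - n) * t))"
    by (intro lebesgue_integral_eq_integral integrable_angle_continuous continuous_intros) auto
  then show ?thesis
    unfolding fourier_coeff_def circle_inner_def eq integral_cis_multiple by simp
qed

lemma circle_eq_0_if_inner_self:
  assumes "f \<in> L2_circle" "circle_inner f f = 0"
  shows "circle_eq f (\<lambda>_. 0)"
proof -
  have "(LINT t|angle_measure. f (cis t) * cnj (f (cis t))) = of_real (LINT t|angle_measure. (norm (f (cis t)))\<^sup>2)"
    by (simp add: complex_norm_square[symmetric] flip: integral_complex_of_real)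
  then have "(LINT t|angle_measure. (norm (f (cis t)))\<^sup>2) = 0"
    using assms(2) by (simp add: circle_inner_def)
  then have "AE t in angle_measure. (norm (f (cis t)))\<^sup>2 = 0"
    using assms(1) by (subst (asm) integral_nonneg_eq_0_iff_AE) (auto simp: L2_circle_def)
  then show ?thesis by (simp add: circle_eq_def)
qed

subsection \<open>Completeness of the trigonometric system\<close>

definition trig_poly :: "(complex \<Rightarrow> complex) \<Rightarrow> bool" where
  "trig_poly p \<longleftrightarrow> (\<exists>A c. finite A \<and> (\<forall>z. norm z = 1 \<longrightarrow> p z = (\<Sum>n\<in>A. c n * z powi (n::int))))"

lemma trig_poly_monom: "trig_poly (\<lambda>z. c * z powi n)"
  unfolding trig_poly_def by (intro exI[of _ "{n}"] exI[of _ "\<lambda>_. c"]) auto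

lemma trig_poly_add:
  assumes "trig_poly p" "trig_poly q"
  shows "trig_poly (\<lambda>z. p z + q z)"
proof -
  obtain A a B b where A: "finite A" "\<And>z. norm z = 1 \<Longrightarrow> p z = (\<Sum>n\<in>A. a n * z powi (n::int))"
    and B: "finite B" "\<And>z. norm z = 1 \<Longrightarrow> q z = (\<Sum>n\<in>B. b n * z powi (n::int))"
    using assms unfolding trig_poly_def by blast
  show ?thesis unfolding trig_poly_def
  proof (intro exI[of _ "A \<union> B"] exI[of _ "\<lambda>n. (if n \<in> A then a n else 0) + (if n \<in> B then b n else 0)"] conjI allI impI)
    fix z :: complex assume z: "norm z = 1"
    have "(\<Sum>n\<in>A. a n * z powi n) = (\<Sum>n\<in>A\<union>B. (if n \<in> A then a n else 0) * z powi n)"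
      using A B by (intro sum.mono_neutral_cong_left) auto
    moreover have "(\<Sum>n\<in>B. b n * z powi n) = (\<Sum>n\<in>A\<union>B. (if n \<in> B then b n else 0) * z powi n)"
      using A B by (intro sum.mono_neutral_cong_left) auto
    ultimately show "p z + q z = (\<Sum>n\<in>A \<union> B. ((if n \<in> A then a n else 0) + (if n \<in> B then b n else 0)) * z powi n)"
      using A(2) B(2) z by (simp add: distrib_right sum.distrib)
  qed (use A B in auto)
qed

lemma trig_poly_sum:
  assumes "finite I" "\<And>i. i \<in> I \<Longrightarrow> trig_poly (p i)"
  shows "trig_poly (\<lambda>z. \<Sum>i\<in>I. p i z)"
  using assms
proof (induction I rule: finite_induct)
  case empty
  show ?case using trig_poly_monom[of 0 0] by simp
next
  case (insert x F)
  then show ?case using trig_poly_add[of "p x" "\<lambda>z. \<Sum>i\<in>F. p i z"] by simp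
qed

lemma trig_poly_cong: "trig_poly p \<Longrightarrow> (\<And>z. norm z = 1 \<Longrightarrow> p z = q z) \<Longrightarrow> trig_poly q"
  unfolding trig_poly_def by metis

lemma trig_poly_mult:
  assumes "trig_poly p" "trig_poly q"
  shows "trig_poly (\<lambda>z. p z * q z)"
proof -
  obtain A a B b where A: "finite A" "\<And>z. norm z = 1 \<Longrightarrow> p z = (\<Sum>n\<in>A. a n * z powi (n::int))"
    and B: "finite B" "\<And>z. norm z = 1 \<Longrightarrow> q z = (\<Sum>n\<in>B. b n * z powi (n::int))"
    using assms unfolding trig_poly_def by blast
  have "trig_poly (\<lambda>z. \<Sum>n\<in>A. \<Sum>m\<in>B. a n * b m * z powi (n + m))"
    using A B by (intro trig_poly_sum trig_poly_monom)
  then show ?thesis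
  proof (rule trig_poly_cong)
    fix z :: complex assume z: "norm z = 1"
    then have "z \<noteq> 0" by auto
    then show "(\<Sum>n\<in>A. \<Sum>m\<in>B. a n * b m * z powi (n + m)) = p z * q z"
      using z by (simp add: A B sum_product power_int_add mult_ac)
  qed
qed

text \<open>On the circle conjugation is inversion, so the real coordinates are trigonometric
  polynomials, and the class is an algebra.\<close>

lemma trig_poly_real_polynomial:
  assumes "real_polynomial_function p"
  shows "trig_poly (\<lambda>z. of_real (p z))"
  using assms
proof (induction rule: real_polynomial_function.induct)
  case (linear f)
  interpret bounded_linear f by fact
  \<comment> \<open>These coefficients come from f z = Re z f(1) + Im z f(i), with Re z = (z + 1/z)
    / 2 and Im z = -i (z - 1/z) / 2.\<close>
  have "trig_poly (\<lambda>z. of_real (f 1) / 2 * (z powi 1) + of_real (f 1) / 2 * (z powi (-1)) +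
      (- \<i> * of_real (f \<i>) / 2 * (z powi 1) + \<i> * of_real (f \<i>) / 2 * (z powi (-1))))"
    by (intro trig_poly_add trig_poly_monom)
  then show ?case
  proof (rule trig_poly_cong)
    fix z :: complex assume z: "norm z = 1"
    have inv: "z powi (-1) = cnj z"
      using z complex_norm_square[of z] by (simp add: power_int_minus inverse_unique)
    have fz: "f z = Re z * f 1 + Im z * f \<i>"
    proof -
      have "z = Re z *\<^sub>R 1 + Im z *\<^sub>R \<i>" by (simp add: complex_eq_iff)
      then have "f z = f (Re z *\<^sub>R 1 + Im z *\<^sub>R \<i>)" by simp
      then show ?thesis by (simp only: add scaleR) simp
    qed
    show "of_real (f 1) / 2 * (z powi 1) + of_real (f 1) / 2 * (z powi (-1)) +
      (- \<i> * of_real (f \<i>) / 2 * (z powi 1) + \<i> * of_real (f \<i>) / 2 * (z powi (-1))) = of_real (f z)"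
      unfolding inv fz by (rule complex_eqI) simp_all
  qed
next
  case (const c)
  show ?case using trig_poly_monom[of "of_real c" 0] by simp
qed (simp_all add: trig_poly_add trig_poly_mult)

lemma trig_poly_dense:
  assumes "continuous_on (sphere 0 1) k" "e > 0"
  obtains p where "trig_poly p" "\<And>z. norm z = 1 \<Longrightarrow> norm (k z - p z) < e"
proof -
  obtain g where g: "polynomial_function g" "\<And>x. x \<in> sphere 0 1 \<Longrightarrow> norm (k x - g x) < e"
    using Stone_Weierstrass_polynomial_function[OF compact_sphere assms] by blast
  have re: "real_polynomial_function (\<lambda>z. Re (g z))" "real_polynomial_function (\<lambda>z. Im (g z))"
    using g(1) bounded_linear_Re bounded_linear_Im unfolding polynomial_function_def o_def by blast+
  have "trig_poly (\<lambda>z. of_real (Re (g z)) + (\<i> * z powi 0) * of_real (Im (g z)))"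
    by (intro trig_poly_add trig_poly_mult trig_poly_monom trig_poly_real_polynomial re)
  then have "trig_poly g"
    by (rule trig_poly_cong) (simp add: complex_eq[symmetric])
  then show ?thesis using that g(2) by (metis dist_0_norm mem_sphere)
qed

lemma circle_inner_sum_right:
  assumes "finite A" "\<And>i. i \<in> A \<Longrightarrow> g i \<in> L2_circle" "f \<in> L2_circle"
  shows "circle_inner f (\<lambda>z. \<Sum>i\<in>A. g i z) = (\<Sum>i\<in>A. circle_inner f (g i)) \<and> (\<lambda>z. \<Sum>i\<in>A. g i z) \<in> L2_circle"
  using assms
proof (induction A rule: finite_induct)
  case empty
  then show ?case by (auto simp: circle_inner_def intro: continuous_in_L2_circle)
next
  case (insert x F)
  then show ?case by (simp add: circle_inner_add_right L2_circle_add)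
qed

lemma circle_inner_trig_poly:
  assumes "f \<in> L2_circle" "\<And>n. fourier_coeff f n = 0" "trig_poly p"
  shows "circle_inner f p = 0"
proof -
  obtain A a where A: "finite A" "\<And>z. norm z = 1 \<Longrightarrow> p z = (\<Sum>n\<in>A. a n * z powi (n::int))"
    using assms(3) unfolding trig_poly_def by blast
  have "circle_inner f p = circle_inner f (\<lambda>z. \<Sum>n\<in>A. a n * z powi n)"
    using A(2) by (intro circle_inner_cong) auto
  also have "\<dots> = (\<Sum>n\<in>A. circle_inner f (\<lambda>z. a n * z powi n))"
    using circle_inner_sum_right[OF A(1) L2_circle_cmult[OF powi_in_L2_circle] assms(1), of a "\<lambda>n. n"] by blast
  also have "\<dots> = 0"
    using assms(2) by (simp add: circle_inner_cmult_right fourier_coeff_def)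
  finally show ?thesis .
qed

lemma circle_inner_bound:
  assumes "f \<in> L2_circle" "g \<in> L2_circle" "\<And>z. norm z = 1 \<Longrightarrow> norm (g z) \<le> e"
  shows "norm (circle_inner f g) \<le> (LINT t|angle_measure. norm (f (cis t))) / (2 * pi) * e"
proof -
  have "norm (LINT t|angle_measure. f (cis t) * cnj (g (cis t))) \<le> (LINT t|angle_measure. norm (f (cis t)) * e)"
    using L2_circle_mult_integrable[OF assms(1,2)] L2_circle_integrable[OF assms(1)] assms(3)
    by (intro Bochner_Integration.integral_norm_bound_integral) (auto simp: norm_mult intro!: mult_left_mono)
  also have "\<dots> = (LINT t|angle_measure. norm (f (cis t))) * e" by simp
  finally show ?thesis
    by (simp add: circle_inner_def norm_divide field_simps)
qed

lemma circle_inner_continuous_eq_0: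
  assumes "f \<in> L2_circle" "\<And>n. fourier_coeff f n = 0" "continuous_on (sphere 0 1) k"
  shows "circle_inner f k = 0"
proof -
  define C where "C = (LINT t|angle_measure. norm (f (cis t))) / (2 * pi)"
  have C: "C \<ge> 0" unfolding C_def by simp
  have *: "norm (circle_inner f k) \<le> C * e" if e: "e > 0" for e
  proof -
    obtain p where p: "trig_poly p" "\<And>z. norm z = 1 \<Longrightarrow> norm (k z - p z) < e"
      using trig_poly_dense[OF assms(3) e] by blast
    obtain A a where A: "finite A" "\<And>z. norm z = 1 \<Longrightarrow> p z = (\<Sum>n\<in>A. a n * z powi (n::int))"
      using p(1) unfolding trig_poly_def by blast
    have "continuous_on (sphere 0 1) (\<lambda>z. \<Sum>n\<in>A. a n * z powi n)"
      by (intro continuous_intros) auto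
    then have pc: "continuous_on (sphere 0 1) p"
      by (rule continuous_on_eq) (use A in auto)
    note L = continuous_in_L2_circle[OF assms(3)] continuous_in_L2_circle[OF pc]
    have "circle_inner f k = circle_inner f (\<lambda>z. (k z - p z) + p z)" by simp
    also have "\<dots> = circle_inner f (\<lambda>z. k z - p z)"
      using circle_inner_add_right[OF L2_circle_diff[OF L] L(2) assms(1)]
        circle_inner_trig_poly[OF assms(1,2) p(1)] by simp
    finally show ?thesis
      using circle_inner_bound[OF assms(1) L2_circle_diff[OF L], of e] p(2)
      unfolding C_def by (metis less_imp_le)
  qed
  have "norm (circle_inner f k) \<le> 0 + e" if "e > 0" for e
  proof -
    \<comment> \<open>Dividing by \<open>C + 1\<close> instead of \<open>C\<close> covers the case C
      = 0.\<close>
    have "norm (circle_inner f k) \<le> C * (e / (C + 1))" using that C by (intro *) simp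
    also have "\<dots> = (C / (C + 1)) * e" by simp
    also have "\<dots> \<le> 1 * e" using that C by (intro mult_right_mono) auto
    finally show ?thesis by simp
  qed
  then show ?thesis using field_le_epsilon[of "norm (circle_inner f k)" 0] by simp
qed

text \<open>The angles 0 and 2 pi give the same point; keeping one of the two angles away from both
  endpoints is enough for injectivity.\<close>

lemma cis_inj_open_period:
  assumes "cis s = cis t" "s \<in> {0..2*pi}" "t \<in> {0<..<2*pi}"
  shows "s = t"
proof -
  have "sin s = sin t \<and> cos s = cos t" using assms(1) by (metis cis.sel)
  then obtain n :: int where n: "s = t + 2 * pi * of_int n" using sin_cos_eq_iff by blast
  have "2 * pi * of_int n < 2 * pi * 1" "2 * pi * (-1) < 2 * pi * of_int n"
    using assms(2,3) n unfolding atLeastAtMost_iff greaterThanLessThan_iff by linarith+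
  then have "(of_int n :: real) < 1" "-1 < (of_int n :: real)"
    using pi_gt_zero mult_less_cancel_left_pos[of "2*pi" "of_int n" 1]
      mult_less_cancel_left_pos[of "2*pi" "-1" "of_int n"] by simp_all
  then have "n = 0" by linarith
  then show ?thesis using n by simp
qed

lemma AE_angle_measureI: "AE t in lebesgue. P t \<Longrightarrow> AE t in angle_measure. P t"
  by (subst AE_restrict_space_iff) auto

text \<open>Continuous tent functions decrease to the indicator of the image of \<open>K\<close> on
  the circle, so dominated convergence carries the vanishing from continuous test functions to
  indicators of compact sets of angles.\<close>

lemma integral_compact_eq_0_if_fourier_0:
  assumes "f \<in> L2_circle" "\<And>n. fourier_coeff f n = 0" "compact K" "K \<subseteq> {0..2*pi}"
  shows "(LINT t|angle_measure. indicator K t *\<^sub>R f (cis t)) = 0"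
proof (cases "K = {}")
  case False
  define C where "C = cis ` K"
  have C: "compact C" "C \<noteq> {}" unfolding C_def using assms(3) False
    by (auto intro!: compact_continuous_image continuous_intros)
  \<comment> \<open>Equal to 1 on \<open>C\<close> and to 0 as soon as the distance to
    \<open>C\<close> reaches 1/n.\<close>
  define k where "k n z = complex_of_real (max 0 (1 - real n * infdist z C))" for n z
  have kc: "continuous_on S (k n)" for n S unfolding k_def by (intro continuous_intros)
  have int: "integrable angle_measure (\<lambda>t. f (cis t))" by (rule L2_circle_integrable[OF assms(1)])
  have "(\<lambda>n. LINT t|angle_measure. f (cis t) * cnj (k n (cis t))) \<longlonglongrightarrow>
        (LINT t|angle_measure. indicator K t *\<^sub>R f (cis t))"
  proof (rule integral_dominated_convergence[where w = "\<lambda>t. norm (f (cis t))"])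
    show "(\<lambda>t. indicator K t *\<^sub>R f (cis t)) \<in> borel_measurable angle_measure"
    proof (intro borel_measurable_scaleR borel_measurable_indicator borel_measurable_integrable[OF int])
      show "K \<in> sets angle_measure"
        using assms(3,4) by (simp add: sets_restrict_space_iff lmeasurable_compact fmeasurableD)
    qed
    show "(\<lambda>t. f (cis t) * cnj (k n (cis t))) \<in> borel_measurable angle_measure" for n
      by (rule borel_measurable_integrable[OF L2_circle_mult_integrable[OF assms(1) continuous_in_L2_circle[OF kc]]])
    show "integrable angle_measure (\<lambda>t. norm (f (cis t)))" using int by simp
    have "norm (k n z) \<le> 1" for n z unfolding k_def using infdist_nonneg[of z C] by (auto simp: max_def)
    then show "AE t in angle_measure. norm (f (cis t) * cnj (k n (cis t))) \<le> norm (f (cis t))" for n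
      by (auto simp: norm_mult mult_left_le)
    have conv: "(\<lambda>n. f (cis t) * cnj (k n (cis t))) \<longlonglongrightarrow> indicator K t *\<^sub>R f (cis t)"
      if t: "t \<in> {0<..<2*pi}" for t
    proof (cases "t \<in> K")
      case True
      then have "cis t \<in> C" by (simp add: C_def)
      then show ?thesis using True by (simp add: k_def)
    next
      case False
      have "cis t \<notin> C"
      proof
        assume "cis t \<in> C"
        then obtain s where "s \<in> K" "cis s = cis t" unfolding C_def by auto
        with cis_inj_open_period[OF _ _ t] assms(4) False show False by blast
      qed
      then have pos: "infdist (cis t) C > 0"
        using C infdist_pos_not_in_closed compact_imp_closed by blast
      obtain n0 :: nat where n0: "1 < real n0 * infdist (cis t) C"
        using reals_Archimedean3[OF pos] by blast
      have "\<forall>\<^sub>F n in sequentially. f (cis t) * cnj (k n (cis t)) = 0"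
        using eventually_ge_at_top[of n0]
      proof eventually_elim
        case (elim n)
        then have "1 < real n * infdist (cis t) C"
          using n0 pos by (meson less_le_trans mult_right_mono of_nat_le_iff less_imp_le)
        then show ?case by (simp add: k_def)
      qed
      then show ?thesis using False by (simp add: tendsto_eventually)
    qed
    \<comment> \<open>The two endpoints are discarded because \<open>cis\<close> identifies them,
      and \<open>K\<close> may contain only one of them.\<close>
    have "AE t in lebesgue. t \<notin> {0, 2*pi}"
      by (intro AE_not_in) (simp add: negligible_iff_null_sets[symmetric])
    then have "AE t in angle_measure. t \<notin> {0, 2*pi}" by (rule AE_angle_measureI)
    then show "AE t in angle_measure. (\<lambda>n. f (cis t) * cnj (k n (cis t))) \<longlonglongrightarrow> indicator K t *\<^sub>R f (cis t)"
      using AE_space[of angle_measure]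
      by eventually_elim (intro conv, auto)
  qed
  moreover have "(LINT t|angle_measure. f (cis t) * cnj (k n (cis t))) = 0" for n
    using circle_inner_continuous_eq_0[OF assms(1,2) kc] by (simp add: circle_inner_def)
  ultimately show ?thesis by (simp add: LIMSEQ_const_iff)
qed simp

text \<open>A measurable set of angles is, up to a null set, a countable union of compact sets.
  Increasing finite unions and dominated convergence make the integral of \<open>f\<close> vanish
  over every measurable set, which forces f = 0 almost everywhere.\<close>

lemma fourier_complete:
  assumes "f \<in> L2_circle" "\<And>n. fourier_coeff f n = 0"
  shows "circle_eq f (\<lambda>_. 0)"
proof -
  have int: "integrable angle_measure (\<lambda>t. f (cis t))" by (rule L2_circle_integrable[OF assms(1)])
  have "AE t in angle_measure. f (cis t) = 0"
  proof (rule sigma_finite_measure.density_zero[OF _ int])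
    have "finite_measure angle_measure"
      by (intro finite_measure_lebesgue_on) (metis cbox_interval lmeasurable_cbox)
    then show "sigma_finite_measure angle_measure" by (rule finite_measure.axioms(1))
  next
    fix A assume "A \<in> sets angle_measure"
    then have A: "A \<in> sets lebesgue" "A \<subseteq> {0..2*pi}" by (auto simp: sets_restrict_space_iff)
    obtain C T where CT: "fsigma C" "T \<in> null_sets lebesgue" "C \<union> T = A" "disjnt C T"
      using lebesgue_set_almost_fsigma[OF A(1)] by blast
    obtain F :: "nat \<Rightarrow> real set" where F: "range F \<subseteq> Collect compact" "C = \<Union>(range F)"
      using CT(1) by (auto simp: fsigma_Union_compact)
    define G where "G n = (\<Union>i\<le>n. F i)" for n
    have Gc: "compact (G n)" "G n \<subseteq> {0..2*pi}" for n
      unfolding G_def using F CT(3) A(2) by (auto intro!: compact_UN)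
    have "(\<lambda>n. LINT t|angle_measure. indicator (G n) t *\<^sub>R f (cis t)) \<longlonglongrightarrow>
        (LINT t|angle_measure. indicator A t *\<^sub>R f (cis t))"
    proof (rule integral_dominated_convergence[where w = "\<lambda>t. norm (f (cis t))"])
      show "(\<lambda>t. indicator A t *\<^sub>R f (cis t)) \<in> borel_measurable angle_measure"
      proof (intro borel_measurable_scaleR borel_measurable_indicator borel_measurable_integrable[OF int])
        show "A \<in> sets angle_measure"
          using A by (simp add: sets_restrict_space_iff)
      qed
      show "(\<lambda>t. indicator (G n) t *\<^sub>R f (cis t)) \<in> borel_measurable angle_measure" for n
      proof (intro borel_measurable_scaleR borel_measurable_indicator borel_measurable_integrable[OF int])
        show "G n \<in> sets angle_measure"
          using Gc[of n] by (simp add: sets_restrict_space_iff lmeasurable_compact fmeasurableD)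
      qed
      have "AE t in lebesgue. t \<notin> T"
        using CT(2) by (rule AE_not_in)
      then have "AE t in angle_measure. t \<notin> T" by (rule AE_angle_measureI)
      then show "AE t in angle_measure. (\<lambda>n. indicator (G n) t *\<^sub>R f (cis t)) \<longlonglongrightarrow> indicator A t *\<^sub>R f (cis t)"
      proof eventually_elim
        case (elim t)
        show ?case
        proof (cases "t \<in> A")
          case True
          then obtain n0 where "t \<in> F n0" using elim CT(3) F(2) by blast
          then have "\<forall>\<^sub>F n in sequentially. t \<in> G n"
            unfolding G_def eventually_sequentially by blast
          then have "\<forall>\<^sub>F n in sequentially. indicator (G n) t *\<^sub>R f (cis t) = indicator A t *\<^sub>R f (cis t)"
            by eventually_elim (use True in simp)
          then show ?thesis by (rule tendsto_eventually)
        next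
          case False
          then have "t \<notin> G n" for n using F CT(3) unfolding G_def by blast
          then show ?thesis using False by simp
        qed
      qed
    qed (use int in \<open>auto simp: indicator_def\<close>)
    then have "(LINT t|angle_measure. indicator A t *\<^sub>R f (cis t)) = 0"
      using integral_compact_eq_0_if_fourier_0[OF assms Gc] by (simp add: LIMSEQ_const_iff)
    then show "set_lebesgue_integral angle_measure A (\<lambda>t. f (cis t)) = 0"
      by (simp add: set_lebesgue_integral_def)
  qed
  then show ?thesis by (simp add: circle_eq_def)
qed

subsection \<open>Fourier coefficients of analytic functions\<close>

lemma integral_angle_continuous:
  fixes f :: "real \<Rightarrow> 'a::euclidean_space"
  assumes "continuous_on {0..2*pi} f"
  shows "(LINT t|angle_measure. f t) = integral {0..2*pi} f"
  by (intro lebesgue_integral_eq_integral integrable_angle_continuous assms) simp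

lemma contour_integral_circlepath_0:
  "contour_integral (circlepath 0 r) f =
     integral {0..2*pi} (\<lambda>t. f (of_real r * cis t) * of_real r * \<i> * cis t)"
proof -
  \<comment> \<open>Comparing the relations rather than the values makes the identity hold for all
    \<open>f\<close>: both integrals have the value 0 when they do not exist.\<close>
  have "((f has_contour_integral I) (circlepath 0 r)) \<longleftrightarrow>
      ((\<lambda>t. f (of_real r * cis t) * of_real r * \<i> * cis t) has_integral I) {0..2*pi}" for I
    unfolding circlepath_def by (subst has_contour_integral_part_circlepath_iff) auto
  then show ?thesis
    unfolding contour_integral_def Henstock_Kurzweil_Integration.integral_def
      contour_integrable_on_def integrable_on_def by simp
qed

lemma circle_mean_value:
  assumes "G holomorphic_on ball 0 R" "R > 1"
  shows "(LINT t|angle_measure. G (cis t)) = 2 * of_real pi * G 0"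
proof -
  have hol: "G holomorphic_on cball 0 1"
    using assms by (auto intro: holomorphic_on_subset)
  have cont: "continuous_on {0..2*pi} (\<lambda>t. G (cis t))"
    using holomorphic_on_imp_continuous_on[OF hol] continuous_on_subset[of "cball 0 1" G "sphere 0 1"]
    by (intro continuous_on_cis_comp) auto
  have "contour_integral (circlepath 0 1) (\<lambda>u. G u / (u - 0)) = 2 * of_real pi * \<i> * G 0"
    by (rule contour_integral_unique, rule Cauchy_integral_circlepath_simple[OF hol]) simp
  then have "2 * of_real pi * \<i> * G 0 = integral {0..2*pi} (\<lambda>t. \<i> * G (cis t))"
    unfolding contour_integral_circlepath_0 by (simp add: mult.commute)
  also have "\<dots> = \<i> * integral {0..2*pi} (\<lambda>t. G (cis t))"
    by (rule integral_mult_right)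
  finally show ?thesis
    unfolding integral_angle_continuous[OF cont] by (simp add: mult.commute mult.left_commute)
qed

text \<open>The integrand is holomorphic on the annulus, so the circle of integration may be moved.
  The freedom in \<open>r\<close> is the source of the exponential decay below.\<close>

lemma fourier_coeff_eq_contour_integral:
  assumes hol: "f holomorphic_on {z. \<bar>norm z - 1\<bar> < e}" and e: "e < 1"
    and r: "\<bar>r - 1\<bar> < e"
  shows "fourier_coeff f n = contour_integral (circlepath 0 r) (\<lambda>z. f z * z powi (- n - 1)) / (2 * of_real pi * \<i>)"
proof -
  define A where "A = {z::complex. \<bar>norm z - 1\<bar> < e}"
  have "open A" unfolding A_def by (intro open_Collect_less continuous_intros)
  have nz: "z \<noteq> 0" if "z \<in> A" for z using that e by (auto simp: A_def)
  have e0: "e > 0" using r by linarith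
  have r0: "r > 0" using r e by linarith
  have A1: "sphere 0 1 \<subseteq> A" using e0 by (auto simp: A_def)
  have holg: "(\<lambda>z. f z * z powi (- n - 1)) holomorphic_on A"
    using hol nz unfolding A_def by (intro holomorphic_intros) auto
  \<comment> \<open>Radial homotopy: the points between w and r w have modulus |1 + u (r - 1)|,
    which stays within \<open>e\<close> of 1.\<close>
  have hom: "homotopic_loops A (circlepath 0 1) (circlepath 0 r)"
  proof (rule homotopic_loops_linear)
    fix t :: real assume "t \<in> {0..1}"
    define w where "w = exp (2 * of_real pi * \<i> * of_real t)"
    have nw: "norm w = 1" unfolding w_def by simp
    have "closed_segment w (of_real r * w) \<subseteq> A"
    proof
      fix x assume "x \<in> closed_segment w (of_real r * w)"
      then obtain u where u: "0 \<le> u" "u \<le> 1" "x = (1 - u) *\<^sub>R w + u *\<^sub>R (of_real r * w)"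
        unfolding closed_segment_def by blast
      have "x = of_real (1 + u * (r - 1)) * w" unfolding u(3) by (simp add: scaleR_conv_of_real algebra_simps)
      then have nx: "norm x = \<bar>1 + u * (r - 1)\<bar>" using nw by (simp add: norm_mult del: of_real_add of_real_mult)
      have "\<bar>u * (r - 1)\<bar> \<le> 1 * \<bar>r - 1\<bar>" unfolding abs_mult using u by (intro mult_right_mono) auto
      then have "\<bar>u * (r - 1)\<bar> < e" using r unfolding mult_1 by (rule le_less_trans)
      moreover from this have "1 + u * (r - 1) > 0" using e by linarith
      ultimately show "x \<in> A" unfolding A_def mem_Collect_eq nx by simp
    qed
    then show "closed_segment (circlepath 0 1 t) (circlepath 0 r t) \<subseteq> A"
      by (simp add: circlepath w_def)
  qed auto
  have eq: "contour_integral (circlepath 0 1) (\<lambda>z. f z * z powi (- n - 1)) =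
        contour_integral (circlepath 0 r) (\<lambda>z. f z * z powi (- n - 1))"
    by (rule Cauchy_theorem_homotopic_loops[OF hom \<open>open A\<close> holg]) auto
  have contf: "continuous_on (sphere 0 1) f"
    using hol A1 unfolding A_def by (meson holomorphic_on_imp_continuous_on holomorphic_on_subset)
  have cont: "continuous_on {0..2*pi} (\<lambda>t. f (cis t) * cnj (cis t powi n))"
    by (intro continuous_on_cis_comp[of "\<lambda>z. f z * cnj (z powi n)"] continuous_intros contf) auto
  \<comment> \<open>The factor z in dz = i z dt raises the exponent -n - 1 to -n, and z^(-n) is the
    conjugate of z^n on the circle.\<close>
  have *: "f (cis t) * cis t powi (- n - 1) * \<i> * cis t = \<i> * (f (cis t) * cnj (cis t powi n))" for t
  proof -
    have "cis t powi (- n - 1) * cis t = cis t powi (- n)"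
      by (simp add: cis_power_int cis_mult algebra_simps)
    moreover have "cis t powi (- n) = cnj (cis t powi n)" by (simp add: cis_power_int cis_cnj)
    ultimately show ?thesis by (metis (no_types, lifting) mult.assoc mult.commute)
  qed
  have "contour_integral (circlepath 0 1) (\<lambda>z. f z * z powi (- n - 1)) =
     integral {0..2*pi} (\<lambda>t. \<i> * (f (cis t) * cnj (cis t powi n)))"
    unfolding contour_integral_circlepath_0 by (simp add: *)
  also have "\<dots> = \<i> * integral {0..2*pi} (\<lambda>t. f (cis t) * cnj (cis t powi n))"
    by (rule integral_mult_right)
  also have "\<dots> = \<i> * (2 * of_real pi) * fourier_coeff f n"
    unfolding fourier_coeff_def circle_inner_def integral_angle_continuous[OF cont] by simp
  finally show ?thesis unfolding eq[symmetric] by simp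
qed

text \<open>Radii below 1 give decay for negative indices and radii above 1 for positive ones; both
  are needed.\<close>

lemma fourier_coeff_radius_bound:
  assumes hol: "f holomorphic_on {z. \<bar>norm z - 1\<bar> < e}" and e: "e < 1"
    and r: "\<bar>r - 1\<bar> < e"
  shows "\<exists>M. \<forall>n. norm (fourier_coeff f n) \<le> M * r powi (- n)"
proof -
  have r0: "r > 0" using r e by linarith
  have sub: "sphere 0 r \<subseteq> {z::complex. \<bar>norm z - 1\<bar> < e}" using r by auto
  have "compact (f ` sphere 0 r)"
    using hol sub by (intro compact_continuous_image compact_sphere)
      (meson holomorphic_on_imp_continuous_on holomorphic_on_subset)
  then obtain M where M: "M > 0" "\<And>z. z \<in> sphere 0 r \<Longrightarrow> norm (f z) \<le> M"
    using bounded_pos[of "f ` sphere 0 r"] compact_imp_bounded by (metis imageI)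
  have "norm (fourier_coeff f n) \<le> M * r powi (- n)" for n
  proof -
    define g where "g = (\<lambda>z. f z * z powi (- n - 1))"
    have cont: "continuous_on (sphere 0 r) g" unfolding g_def
      using hol sub r0 by (intro continuous_intros)
       (auto intro: holomorphic_on_imp_continuous_on holomorphic_on_subset)
    have ci: "(g has_contour_integral contour_integral (circlepath 0 r) g) (circlepath 0 r)"
      using cont r0 by (intro has_contour_integral_integral contour_integrable_continuous_circlepath) auto
    have "norm (contour_integral (circlepath 0 r) g) \<le> (M * r powi (- n - 1)) * (2 * pi * r)"
    proof (rule has_contour_integral_bound_circlepath[OF ci])
      fix x :: complex assume "norm (x - 0) = r"
      then show "norm (g x) \<le> M * r powi (- n - 1)"
        unfolding g_def norm_mult norm_power_int using M(2)[of x] less_imp_le[OF M(1)] r0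
        by (intro mult_mono) auto
    qed (use M r0 in auto)
    also have "\<dots> = 2 * pi * (M * r powi (- n))"
      using r0 by (simp add: power_int_diff)
    finally show ?thesis
      unfolding fourier_coeff_eq_contour_integral[OF assms] g_def[symmetric]
      by (simp add: norm_divide norm_mult divide_le_eq mult_ac)
  qed
  then show ?thesis by blast
qed

lemma fourier_coeff_decay:
  assumes "f analytic_on sphere 0 1"
  shows "\<exists>M q. 0 < q \<and> q < 1 \<and> (\<forall>n. norm (fourier_coeff f (int n)) \<le> M * q ^ n \<and>
     norm (fourier_coeff f (- int n)) \<le> M * q ^ n)"
proof -
  obtain e where e: "e > 0" "e < 1" and hol: "f holomorphic_on {z. \<bar>norm z - 1\<bar> < e}"
    using analytic_on_sphere_holomorphic[OF assms] by blast
  define r where "r = 1 - e / 2"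
  define r' where "r' = 1 + e / 2"
  obtain M1 where M1: "\<And>n. norm (fourier_coeff f n) \<le> M1 * r powi (- n)"
    using fourier_coeff_radius_bound[OF hol e(2), of r] e(1) unfolding r_def by auto
  obtain M2 where M2: "\<And>n. norm (fourier_coeff f n) \<le> M2 * r' powi (- n)"
    using fourier_coeff_radius_bound[OF hol e(2), of r'] e(1) unfolding r'_def by auto
  define q where "q = max r (1 / r')"
  define M where "M = max \<bar>M1\<bar> \<bar>M2\<bar>"
  have q: "0 < q" "q < 1" "r \<le> q" "1 / r' \<le> q" "0 < r" "0 < 1 / r'"
    unfolding q_def r_def r'_def using e by auto
  have "norm (fourier_coeff f (int n)) \<le> M * q ^ n" for n
  proof -
    have "norm (fourier_coeff f (int n)) \<le> M2 * (1 / r') ^ n"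
      using M2[of "int n"] by (simp add: power_int_minus power_one_over inverse_eq_divide)
    also have "\<dots> \<le> M * q ^ n"
      unfolding M_def using q by (intro mult_mono power_mono) auto
    finally show ?thesis .
  qed
  moreover have "norm (fourier_coeff f (- int n)) \<le> M * q ^ n" for n
  proof -
    have "norm (fourier_coeff f (- int n)) \<le> M1 * r ^ n"
      using M1[of "- int n"] by simp
    also have "\<dots> \<le> M * q ^ n"
      unfolding M_def using q by (intro mult_mono power_mono) auto
    finally show ?thesis .
  qed
  ultimately show ?thesis using q by blast
qed

lemma power_series_decay_holomorphic:
  fixes a :: "nat \<Rightarrow> complex"
  assumes "\<And>n. norm (a n) \<le> M * q ^ n" "0 < q"
  shows "(\<lambda>u. \<Sum>n. a n * u ^ n) holomorphic_on ball 0 (1 / q)"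
    "norm u < 1 / q \<Longrightarrow> summable (\<lambda>n. norm (a n * u ^ n))"
proof -
  show *: "summable (\<lambda>n. norm (a n * u ^ n))" if "norm u < 1 / q" for u
  proof (rule summable_comparison_test')
    have "norm u * q < 1" using that assms(2) by (simp add: field_simps)
    then show "summable (\<lambda>n. M * (norm u * q) ^ n)"
      using assms(2) by (intro summable_mult summable_geometric) (simp add: abs_mult)
    show "norm (norm (a n * u ^ n)) \<le> M * (norm u * q) ^ n" for n
    proof -
      have "norm (a n) * norm u ^ n \<le> M * q ^ n * norm u ^ n"
        by (intro mult_right_mono assms) auto
      then show ?thesis by (simp add: norm_mult norm_power power_mult_distrib mult_ac)
    qed
  qed
  show "(\<lambda>u. \<Sum>n. a n * u ^ n) holomorphic_on ball 0 (1 / q)"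
  proof (rule power_series_holomorphic)
    fix w :: complex assume "w \<in> ball 0 (1 / q)"
    then have "summable (\<lambda>n. a n * w ^ n)" using summable_norm_cancel[OF *[of w]] by simp
    then show "(\<lambda>n. a n * (w - 0) ^ n) sums (\<Sum>n. a n * w ^ n)" by (simp add: summable_sums)
  qed
qed

text \<open>On the circle all powers have modulus 1, so summability of the coefficients justifies
  termwise integration. The exponents are left general to cover series in z as well as in
  1/z.\<close>

lemma circle_inner_power_series:
  assumes "summable (\<lambda>n. norm (a n))" "h \<in> L2_circle"
  shows "(\<lambda>n. a n * circle_inner (\<lambda>z. z powi k n) h) sums
     circle_inner (\<lambda>z. \<Sum>n. a n * z powi k n) h"
proof -
  have "(\<lambda>n. LINT t|angle_measure. a n * (cis t powi k n * cnj (h (cis t)))) sums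
     (LINT t|angle_measure. (\<Sum>n. a n * (cis t powi k n * cnj (h (cis t)))))"
  proof (rule sums_integral)
    have eq: "norm (a n * (cis t powi k n * cnj (h (cis t)))) = norm (a n) * norm (h (cis t))" for n t
      by (simp add: norm_mult norm_power_int)
    show "integrable angle_measure (\<lambda>t. a n * (cis t powi k n * cnj (h (cis t))))" for n
      using L2_circle_mult_integrable[OF powi_in_L2_circle assms(2), of "k n"] by simp
    show "AE t in angle_measure. summable (\<lambda>n. norm (a n * (cis t powi k n * cnj (h (cis t)))))"
      unfolding eq using assms(1) by (auto intro: summable_mult2)
    show "summable (\<lambda>n. LINT t|angle_measure. norm (a n * (cis t powi k n * cnj (h (cis t)))))"
      unfolding eq using assms(1) by (auto intro: summable_mult2)
  qed
  moreover have "(\<Sum>n. a n * (cis t powi k n * cnj (h (cis t)))) = (\<Sum>n. a n * cis t powi k n) * cnj (h (cis t))" for t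
  proof -
    have "summable (\<lambda>n. a n * cis t powi k n)"
      by (rule summable_norm_cancel) (simp add: norm_mult norm_power_int assms(1))
    then show ?thesis by (simp add: suminf_mult2 mult.assoc)
  qed
  ultimately have "(\<lambda>n. a n * (LINT t|angle_measure. cis t powi k n * cnj (h (cis t)))) sums
     (LINT t|angle_measure. (\<Sum>n. a n * cis t powi k n) * cnj (h (cis t)))"
    by simp
  from sums_divide[OF this, of "of_real (2*pi)"] show ?thesis
    by (simp add: circle_inner_def)
qed

lemma fourier_coeff_power_series:
  assumes "summable (\<lambda>n. norm (a n))" "inj k"
  shows "fourier_coeff (\<lambda>z. \<Sum>n. a n * z powi k n) m = (if m \<in> range k then a (inv k m) else 0)"
proof -
  have s: "(\<lambda>n. a n * (if k n = m then 1 else 0)) sums fourier_coeff (\<lambda>z. \<Sum>n. a n * z powi k n) m"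
    using circle_inner_power_series[OF assms(1) powi_in_L2_circle, of k m]
    unfolding fourier_coeff_def[symmetric] fourier_coeff_powi .
  show ?thesis
  proof (cases "m \<in> range k")
    case True
    then obtain n0 where n0: "m = k n0" by blast
    then have "(\<lambda>n. a n * (if k n = m then 1 else 0)) = (\<lambda>n. if n = n0 then a n else 0)"
      using assms(2) by (auto simp: inj_def)
    then have "fourier_coeff (\<lambda>z. \<Sum>n. a n * z powi k n) m = a n0"
      using s sums_unique2[OF _ sums_single[of n0 a]] by simp
    then show ?thesis using True n0 assms(2) by simp
  next
    case False
    then have "(\<lambda>n. a n * (if k n = m then 1 else 0)) = (\<lambda>_. 0)" by (auto simp: fun_eq_iff)
    then have "(\<lambda>_. 0) sums fourier_coeff (\<lambda>z. \<Sum>n. a n * z powi k n) m" using s by simp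
    from sums_unique2[OF this sums_zero] show ?thesis using False by simp
  qed
qed

section \<open>Hardy spaces and the Laurent splitting\<close>

lemma H2_cmult: "f \<in> H2 \<Longrightarrow> (\<lambda>z. c * f z) \<in> H2"
  by (simp add: H2_def fourier_coeff_def L2_circle_cmult circle_inner_cmult)

lemma H2_add: "f \<in> H2 \<Longrightarrow> g \<in> H2 \<Longrightarrow> (\<lambda>z. f z + g z) \<in> H2"
  by (simp add: H2_def fourier_coeff_def L2_circle_add circle_inner_add)

lemma H2_sum:
  assumes "finite I" "\<And>i. i \<in> I \<Longrightarrow> f i \<in> H2"
  shows "(\<lambda>z. \<Sum>i\<in>I. f i z) \<in> H2"
  using assms
proof (induction I rule: finite_induct)
  case empty
  show ?case by (simp add: H2_def fourier_coeff_def circle_inner_def continuous_in_L2_circle)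
next
  case (insert i I)
  then show ?case using H2_add[of "f i" "\<lambda>z. \<Sum>i\<in>I. f i z"] by simp
qed

lemma H2_diff: "f \<in> H2 \<Longrightarrow> g \<in> H2 \<Longrightarrow> (\<lambda>z. f z - g z) \<in> H2"
  by (simp add: H2_def fourier_coeff_def L2_circle_diff circle_inner_diff)

lemma H2_minus0_diff: "f \<in> H2_minus0 \<Longrightarrow> g \<in> H2_minus0 \<Longrightarrow> (\<lambda>z. f z - g z) \<in> H2_minus0"
  by (simp add: H2_minus0_def fourier_coeff_def L2_circle_diff circle_inner_diff)

lemma L2_circle_cong:
  assumes "\<And>z. norm z = 1 \<Longrightarrow> f z = g z"
  shows "f \<in> L2_circle \<longleftrightarrow> g \<in> L2_circle"
  unfolding L2_circle_def using assms by simp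

lemma H2_cong:
  assumes "\<And>z. norm z = 1 \<Longrightarrow> f z = g z"
  shows "f \<in> H2 \<longleftrightarrow> g \<in> H2"
proof -
  have "fourier_coeff f n = fourier_coeff g n" for n
    unfolding fourier_coeff_def using assms by (intro circle_inner_cong) auto
  then show ?thesis using L2_circle_cong[OF assms] by (simp add: H2_def)
qed

lemma H2_Int_H2_minus0:
  assumes "f \<in> H2" "f \<in> H2_minus0"
  shows "circle_eq f (\<lambda>_. 0)"
proof (rule fourier_complete)
  show "f \<in> L2_circle" using assms by (simp add: H2_def)
  show "fourier_coeff f n = 0" for n
    using assms by (cases "n < 0") (auto simp: H2_def H2_minus0_def)
qed

text \<open>\<open>F\<close> collects the negative modes as a power series in 1/z that converges
  beyond the circle. The remainder agrees with the sum \<open>H\<close> of the other modes because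
  the difference has no Fourier coefficients at all. The last conclusion is the property by which
  \<open>op_P\<close> is chosen.\<close>

lemma Laurent_splitting:
  assumes "f analytic_on sphere 0 1"
  obtains F where "F analytic_on closed_exterior" "(F \<longlongrightarrow> 0) at_infinity" "F \<in> H2_minus0"
    "(\<lambda>z. f z - F z) \<in> H2" "\<And>h. h \<in> H2_minus0 \<Longrightarrow> circle_inner (\<lambda>z. f z - F z) h = 0"
proof -
  obtain M q where q: "0 < q" "q < 1"
    and b: "\<And>n. norm (fourier_coeff f (int n)) \<le> M * q ^ n"
    and a: "\<And>n. norm (fourier_coeff f (- int n)) \<le> M * q ^ n"
    using fourier_coeff_decay[OF assms] by blast
  \<comment> \<open>The mode 0 belongs to the other part; removing it here also makes
    \<open>F\<close> vanish at infinity.\<close>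
  define A where "A n = (if n = 0 then 0 else fourier_coeff f (- int n))" for n
  define B where "B n = fourier_coeff f (int n)" for n
  have M0: "M \<ge> 0" using order_trans[OF norm_ge_zero b[of 0]] by simp
  have A: "norm (A n) \<le> M * q ^ n" for n using a[of n] M0 by (simp add: A_def)
  have B: "norm (B n) \<le> M * q ^ n" for n using b[of n] by (simp add: B_def)
  define G where "G u = (\<Sum>n. A n * u ^ n)" for u
  define H where "H u = (\<Sum>n. B n * u ^ n)" for u
  define F where "F z = G (inverse z)" for z
  have q1: "1 < 1 / q" using q by simp
  have Gh: "G holomorphic_on ball 0 (1/q)" and Hh: "H holomorphic_on ball 0 (1/q)"
    unfolding G_def H_def
    using power_series_decay_holomorphic(1)[OF A q(1)] power_series_decay_holomorphic(1)[OF B q(1)] by auto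
  have sA: "summable (\<lambda>n. norm (A n))" and sB: "summable (\<lambda>n. norm (B n))"
    using power_series_decay_holomorphic(2)[OF A q(1), of 1] power_series_decay_holomorphic(2)[OF B q(1), of 1] q1
    by auto
  have G0: "G 0 = 0" unfolding G_def using powser_sums_zero_iff[of A 0] by (simp add: A_def sums_iff)
  have Fan: "F analytic_on closed_exterior"
  proof -
    have "F holomorphic_on {z. q < norm z}"
    proof -
      have "(G \<circ> inverse) holomorphic_on {z. q < norm z}"
      proof (rule holomorphic_on_compose_gen[OF _ Gh])
        show "inverse holomorphic_on {z. q < norm z}" using q by (intro holomorphic_intros) auto
        show "inverse ` {z::complex. q < norm z} \<subseteq> ball 0 (1 / q)"
        proof clarify
          fix z :: complex assume z: "q < norm z"
          have "norm (inverse z) = 1 / norm z" by (metis inverse_eq_divide norm_inverse)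
          also have "\<dots> < 1 / q" using z q by (intro divide_strict_left_mono mult_pos_pos) auto
          finally show "inverse z \<in> ball 0 (1 / q)" unfolding mem_ball_0 .
        qed
      qed
      then show ?thesis by (simp add: F_def[abs_def] o_def)
    qed
    moreover have "open {z::complex. q < norm z}" by (intro open_Collect_less continuous_intros)
    ultimately show ?thesis
      unfolding closed_exterior_def analytic_on_holomorphic using q
      by (intro exI[of _ "{z. q < norm z}"]) auto
  qed
  have F0: "(F \<longlongrightarrow> 0) at_infinity"
  proof -
    have "isCont G 0"
      using Gh q by (meson centre_in_ball continuous_on_eq_continuous_at divide_pos_pos
          holomorphic_on_imp_continuous_on open_ball zero_less_one)
    then have "((\<lambda>z. G (inverse z)) \<longlongrightarrow> G 0) at_infinity"
      by (rule isCont_tendsto_compose) (rule tendsto_inverse_0)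
    then show ?thesis by (simp add: F_def[abs_def] G0)
  qed
  have FL: "F \<in> L2_circle"
    by (intro continuous_in_L2_circle analytic_on_imp_continuous_on analytic_on_subset[OF Fan])
      (auto simp: closed_exterior_def)
  have HL: "H \<in> L2_circle"
    using Hh q1 by (intro continuous_in_L2_circle)
     (auto intro: holomorphic_on_imp_continuous_on continuous_on_subset)
  have fL: "f \<in> L2_circle"
    using assms by (intro continuous_in_L2_circle analytic_on_imp_continuous_on)
  have Fs: "F z = (\<Sum>n. A n * z powi (- int n))" for z
    by (simp add: F_def G_def power_int_minus power_inverse)
  have Hs: "H z = (\<Sum>n. B n * z powi (int n))" for z
    by (simp add: H_def)
  have rA: "m \<in> range (\<lambda>n. - int n) \<longleftrightarrow> m \<le> 0" for m
  proof
    assume "m \<le> 0"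
    then have "m = - int (nat (- m))" by simp
    then show "m \<in> range (\<lambda>n. - int n)" by blast
  qed auto
  have rB: "m \<in> range int \<longleftrightarrow> m \<ge> 0" for m
    using zero_le_imp_eq_int by auto
  have iA: "inj (\<lambda>n. - int n)" by (auto simp: inj_def)
  have cF: "fourier_coeff F m = (if m < 0 then fourier_coeff f m else 0)" for m
  proof -
    have "fourier_coeff F m = (if m \<in> range (\<lambda>n. - int n) then A (inv (\<lambda>n. - int n) m) else 0)"
      unfolding Fs[abs_def] by (rule fourier_coeff_power_series[OF sA iA])
    moreover have "inv (\<lambda>n. - int n) m = nat (- m)" if "m \<le> 0"
      using that iA by (intro inv_f_eq) auto
    ultimately show ?thesis unfolding rA by (auto simp: A_def)
  qed
  have cH: "fourier_coeff H m = (if m \<ge> 0 then fourier_coeff f m else 0)" for m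
  proof -
    have "fourier_coeff H m = (if m \<in> range int then B (inv int m) else 0)"
      unfolding Hs[abs_def] by (rule fourier_coeff_power_series[OF sB]) simp
    moreover have "inv int m = nat m" if "m \<ge> 0"
      using that by (intro inv_f_eq) auto
    ultimately show ?thesis unfolding rB by (auto simp: B_def)
  qed
  have fF: "(\<lambda>z. f z - F z) \<in> L2_circle" by (rule L2_circle_diff[OF fL FL])
  have cfF: "fourier_coeff (\<lambda>z. f z - F z) m = fourier_coeff f m - fourier_coeff F m" for m
    unfolding fourier_coeff_def by (rule circle_inner_diff[OF fL FL]) simp
  have "circle_eq (\<lambda>z. (f z - F z) - H z) (\<lambda>_. 0)"
  proof (rule fourier_complete)
    show "(\<lambda>z. f z - F z - H z) \<in> L2_circle" by (rule L2_circle_diff[OF fF HL])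
    have "fourier_coeff (\<lambda>z. f z - F z - H z) m = fourier_coeff (\<lambda>z. f z - F z) m - fourier_coeff H m" for m
      unfolding fourier_coeff_def by (rule circle_inner_diff[OF fF HL]) simp
    then show "fourier_coeff (\<lambda>z. f z - F z - H z) m = 0" for m
      by (simp add: cfF cF cH)
  qed
  then have eq: "circle_eq (\<lambda>z. f z - F z) H" by (simp add: circle_eq_def)
  show ?thesis
  proof (rule that[OF Fan F0])
    show "F \<in> H2_minus0" using FL cF by (simp add: H2_minus0_def)
    show "(\<lambda>z. f z - F z) \<in> H2" using fF cfF cF by (simp add: H2_def)
    fix h assume h: "h \<in> H2_minus0"
    then have hL: "h \<in> L2_circle" by (simp add: H2_minus0_def)
    have "circle_inner (\<lambda>z. f z - F z) h = circle_inner H h"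
      by (rule circle_inner_cong_circle_eq[OF eq fF HL hL])
    \<comment> \<open>Pairing \<open>H\<close> with \<open>h\<close> is done term by term: each
      pairing is a conjugated Fourier coefficient of \<open>h\<close> with nonnegative
      index.\<close>
    moreover have z: "circle_inner (\<lambda>z. z powi int n) h = 0" for n
    proof -
      have "circle_inner (\<lambda>z. z powi int n) h = cnj (circle_inner h (\<lambda>z. z powi int n))"
      proof -
        have "(LINT t|angle_measure. cis t powi int n * cnj (h (cis t))) =
            (LINT t|angle_measure. cnj (h (cis t) * cnj (cis t powi int n)))"
          by (intro Bochner_Integration.integral_cong) auto
        also have "\<dots> = cnj (LINT t|angle_measure. h (cis t) * cnj (cis t powi int n))"
          by (rule Bochner_Integration.integral_cnj)
        finally show ?thesis by (simp add: circle_inner_def)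
      qed
      moreover have "circle_inner h (\<lambda>z. z powi int n) = 0"
        using h unfolding H2_minus0_def fourier_coeff_def mem_Collect_eq by (metis of_nat_0_le_iff)
      ultimately show ?thesis by (simp only: complex_cnj_zero)
    qed
    moreover have "(\<lambda>n. B n * circle_inner (\<lambda>z. z powi int n) h) sums circle_inner H h"
      unfolding Hs[abs_def] by (rule circle_inner_power_series[OF sB hL])
    ultimately have "(\<lambda>n. 0) sums circle_inner (\<lambda>z. f z - F z) h" by (simp only: mult_zero_right)
    then show "circle_inner (\<lambda>z. f z - F z) h = 0" by (rule sums_unique2) (rule sums_zero)
  qed
qed

subsection \<open>Functions holomorphic in a neighbourhood of the closed exterior disk\<close>

lemma analytic_closed_exterior_holomorphic:
  assumes "F analytic_on closed_exterior"
  shows "\<exists>e>0. e < 1 \<and> F holomorphic_on {z. 1 - e < norm z}"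
proof -
  obtain G where G: "open G" "closed_exterior \<subseteq> G" "F holomorphic_on G"
    using assms by (auto simp: analytic_on_holomorphic)
  have "near closed_exterior (\<lambda>z. z \<in> G)" unfolding near_def using G by blast
  then obtain e where e: "e > 0" "e < 1" "\<And>z. 1 - e < norm z \<Longrightarrow> z \<in> G"
    unfolding near_closed_exterior_iff by blast
  then show ?thesis using G(3) holomorphic_on_subset[of F G "{z. 1 - e < norm z}"] by blast
qed

lemma closed_exterior_analytic_on_sphere:
  "F analytic_on closed_exterior \<Longrightarrow> F analytic_on sphere 0 1"
  by (erule analytic_on_subset) (auto simp: closed_exterior_def)

text \<open>The Schwarz reflection of such a function is holomorphic in a disk, and the Fourier
  coefficients are mean values of holomorphic functions there.\<close>

lemma exterior_in_H2_minus0: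
  assumes an: "F analytic_on closed_exterior" and lim: "(F \<longlongrightarrow> 0) at_infinity"
  shows "F \<in> H2_minus0"
proof -
  obtain e where e: "e > 0" "e < 1" "F holomorphic_on {z. 1 - e < norm z}"
    using analytic_closed_exterior_holomorphic[OF an] by blast
  define R where "R = 1 / (1 - e)"
  have R: "R > 1" unfolding R_def using e by simp
  \<comment> \<open>The value at the origin is the limit of \<open>F\<close> at infinity, which
    makes the singularity removable.\<close>
  define G where "G u = (if u = 0 then 0 else F (inverse u))" for u
  have G_hol0: "G holomorphic_on (ball 0 R - {0})"
  proof -
    have "(F \<circ> inverse) holomorphic_on (ball 0 R - {0})"
    proof (rule holomorphic_on_compose_gen[OF _ e(3)])
      show "inverse holomorphic_on ball 0 R - {0}" by (intro holomorphic_intros) auto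
      show "inverse ` (ball 0 R - {0}) \<subseteq> {z::complex. 1 - e < norm z}"
      proof clarify
        fix u :: complex assume u: "u \<in> ball 0 R" "u \<noteq> 0"
        have "1 / R < 1 / norm u" using u R by (intro divide_strict_left_mono mult_pos_pos) auto
        then show "1 - e < norm (inverse u)" by (simp add: R_def norm_inverse inverse_eq_divide norm_divide)
      qed
    qed
    then show ?thesis by (rule holomorphic_transform) (auto simp: G_def)
  qed
  have G_cont: "continuous (at 0) G"
  proof -
    have "((\<lambda>u. F (inverse u)) \<longlongrightarrow> 0) (at 0)"
      by (rule filterlim_compose[OF lim filterlim_inverse_at_infinity])
    then have "(G \<longlongrightarrow> 0) (at 0)"
      by (rule Lim_transform_eventually) (auto simp: G_def eventually_at_filter)
    then show ?thesis by (simp add: isCont_def G_def)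
  qed
  have "continuous_on (ball 0 R) G"
  proof (rule continuous_at_imp_continuous_on, rule ballI)
    fix u :: complex assume u: "u \<in> ball 0 R"
    show "isCont G u"
    proof (cases "u = 0")
      case False
      have "open (ball 0 R - {0::complex})" by auto
      then show ?thesis
        using G_hol0 u False holomorphic_on_imp_continuous_on continuous_on_eq_continuous_at by blast
    qed (use G_cont in simp)
  qed
  then have Gh: "G holomorphic_on ball 0 R"
    by (rule no_isolated_singularity[OF _ G_hol0]) auto
  have im: "cnj ` ball 0 R = ball 0 R"
    by (auto simp: image_iff intro!: bexI[of _ "cnj _"])
  define K where "K = cnj \<circ> G \<circ> cnj"
  have Kh: "K holomorphic_on ball 0 R"
    unfolding K_def by (rule holomorphic_on_compose_cnj_cnj) (simp_all add: im Gh)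
  have Kc: "K (cis t) = cnj (F (cis t))" for t
    by (simp add: K_def G_def cis_cnj)
  have L: "F \<in> L2_circle"
    using closed_exterior_analytic_on_sphere[OF an]
    by (intro continuous_in_L2_circle analytic_on_imp_continuous_on)
  have "fourier_coeff F n = 0" if n: "n \<ge> 0" for n
  proof -
    have eq: "cnj (F (cis t) * cnj (cis t powi n)) = K (cis t) * cis t ^ nat n" for t
      using n by (simp add: Kc power_int_def)
    have "cnj (LINT t|angle_measure. F (cis t) * cnj (cis t powi n)) =
          (LINT t|angle_measure. K (cis t) * cis t ^ nat n)"
      unfolding eq[symmetric] by (rule Bochner_Integration.integral_cnj[symmetric])
    also have "\<dots> = 2 * of_real pi * (K 0 * 0 ^ nat n)"
      by (rule circle_mean_value[where G = "\<lambda>u. K u * u ^ nat n", OF _ R]) (intro holomorphic_intros Kh)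
    also have "\<dots> = 0" by (simp add: K_def G_def)
    finally show ?thesis by (simp add: fourier_coeff_def circle_inner_def)
  qed
  then show ?thesis using L by (simp add: H2_minus0_def)
qed

lemma circle_eq_continuous:
  assumes "circle_eq f g" "continuous_on (sphere 0 1) f" "continuous_on (sphere 0 1) g" "norm z = 1"
  shows "f z = g z"
proof -
  define d where "d t = norm (f (cis t) - g (cis t))" for t
  have d: "continuous_on {0..2*pi} d" unfolding d_def
    by (intro continuous_intros continuous_on_cis_comp assms)
  have "(LINT t|angle_measure. d t) = 0"
    using assms(1) by (intro integral_eq_zero_AE) (auto simp: circle_eq_def d_def elim: AE_mp)
  then have "integral {0..2*pi} d = 0" by (simp add: integral_angle_continuous[OF d])
  then have "\<forall>t\<in>{0..2*pi}. d t = 0"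
    by (subst (asm) integral_eq_0_iff) (use d in \<open>auto simp: d_def\<close>)
  moreover obtain t where "t \<in> {0..2*pi}" "z = cis t"
  proof (rule that[of "Arg2pi z"])
    show "Arg2pi z \<in> {0..2*pi}" using Arg2pi_ge_0[of z] Arg2pi_lt_2pi[of z] by auto
    show "z = cis (Arg2pi z)" using Arg2pi_eq[of z] assms(4) by (simp add: cis_conv_exp)
  qed
  ultimately show ?thesis by (simp add: d_def)
qed

section \<open>Uniqueness of exterior germs and the operator Q\<close>

lemma islimpt_unit_circle:
  assumes "norm (z::complex) = 1"
  shows "z islimpt sphere 0 1"
proof (rule connected_imp_perfect)
  show "connected (sphere (0::complex) 1)" by (rule connected_sphere) simp
  have "(1::complex) \<in> sphere 0 1" "(-1::complex) \<in> sphere 0 1" "(1::complex) \<noteq> -1" by auto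
  then show "sphere 0 1 \<noteq> {a}" for a :: complex by (metis singletonD)
qed (use assms in auto)

text \<open>Continuity upgrades equality almost everywhere to equality on the circle, and the
  identity theorem spreads it over the connected set |z| > 1 - e, the complement of a disk. This
  makes the choice in \<open>op_Q\<close> harmless.\<close>

lemma exterior_germ_unique:
  assumes "F analytic_on closed_exterior" "G analytic_on closed_exterior" "circle_eq F G"
  shows "near closed_exterior (\<lambda>z. F z = G z)"
proof -
  obtain e1 where e1: "e1 > 0" "e1 < 1" "F holomorphic_on {z. 1 - e1 < norm z}"
    using analytic_closed_exterior_holomorphic[OF assms(1)] by blast
  obtain e2 where e2: "e2 > 0" "e2 < 1" "G holomorphic_on {z. 1 - e2 < norm z}"
    using analytic_closed_exterior_holomorphic[OF assms(2)] by blast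
  define e where "e = min e1 e2"
  define A where "A = {z::complex. 1 - e < norm z}"
  have e: "e > 0" "e < 1" unfolding e_def using e1 e2 by auto
  have hol: "(\<lambda>z. F z - G z) holomorphic_on A"
    using e1(3) e2(3) unfolding A_def e_def
    by (intro holomorphic_intros) (auto elim!: holomorphic_on_subset)
  have "open A" unfolding A_def by (intro open_Collect_less continuous_intros)
  have A_eq: "A = - cball 0 (1 - e)" unfolding A_def by auto
  have "connected A"
    unfolding A_eq by (intro connected_complement_bounded_convex) auto
  have sph: "sphere 0 1 \<subseteq> A" using e by (auto simp: A_def)
  have lim: "(1::complex) islimpt sphere 0 1" by (rule islimpt_unit_circle) simp
  have zero: "F z - G z = 0" if "z \<in> sphere 0 1" for z
    using circle_eq_continuous[OF assms(3)] that assms(1,2)[THEN closed_exterior_analytic_on_sphere]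
    by (simp add: analytic_on_imp_continuous_on)
  have "F z = G z" if "1 - e < norm z" for z
    using analytic_continuation[OF hol \<open>open A\<close> \<open>connected A\<close> sph _ lim zero, of z] that e
    by (auto simp: A_def)
  then show ?thesis unfolding near_closed_exterior_iff using e by blast
qed

text \<open>The images under T involve conjugates and the weight, so they are in general not
  holomorphic near the circle. Agreement of the trace with a holomorphic function is exactly what Q
  requires.\<close>

definition circle_analytic :: "(complex \<Rightarrow> complex) \<Rightarrow> bool" where
  "circle_analytic f \<longleftrightarrow> (\<exists>g. g analytic_on sphere 0 1 \<and> (\<forall>z. norm z = 1 \<longrightarrow> f z = g z))"

lemma circle_analytic_continuous: "circle_analytic f \<Longrightarrow> continuous_on (sphere 0 1) f"
  unfolding circle_analytic_def
  by (metis analytic_on_imp_continuous_on continuous_on_eq dist_0_norm mem_sphere)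

text \<open>Both choices hidden in \<open>op_Q\<close> are shown to be possible, with the Laurent
  part \<open>F\<close> as witness, and then to be essentially unique, so that \<open>op_Q f\<close>
  inherits the properties of \<open>F\<close> on the circle.\<close>

lemma op_Q_props:
  assumes "circle_analytic f"
  shows "op_Q f analytic_on closed_exterior" "(op_Q f \<longlongrightarrow> 0) at_infinity"
    "(\<lambda>z. f z - op_Q f z) \<in> H2"
proof -
  obtain g where g: "g analytic_on sphere 0 1" "\<And>z. norm z = 1 \<Longrightarrow> f z = g z"
    using assms unfolding circle_analytic_def by blast
  obtain F where F: "F analytic_on closed_exterior" "(F \<longlongrightarrow> 0) at_infinity" "F \<in> H2_minus0"
    "(\<lambda>z. g z - F z) \<in> H2" "\<And>h. h \<in> H2_minus0 \<Longrightarrow> circle_inner (\<lambda>z. g z - F z) h = 0"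
    using Laurent_splitting[OF g(1)] by blast
  have fL: "op_R f \<in> L2_circle"
    using continuous_in_L2_circle[OF circle_analytic_continuous[OF assms]]
    by (subst L2_circle_cong[of _ f]) (auto simp: op_R_def)
  have F5: "circle_inner (\<lambda>z. op_R f z - F z) h = 0" if "h \<in> H2_minus0" for h
    using F(5)[OF that] g(2) by (subst circle_inner_cong[of _ "\<lambda>z. g z - F z" _ h]) (auto simp: op_R_def)
  define P where "P = op_P (op_R f)"
  have P: "P \<in> H2_minus0 \<and> (\<forall>h\<in>H2_minus0. circle_inner (\<lambda>z. op_R f z - P z) h = 0)"
    unfolding P_def op_P_def by (rule someI[of _ F]) (use F(3) F5 in blast)
  have L: "F \<in> L2_circle" "P \<in> L2_circle" using F(3) P by (auto simp: H2_minus0_def)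
  have "circle_eq (\<lambda>z. F z - P z) (\<lambda>_. 0)"
  proof (rule circle_eq_0_if_inner_self)
    \<comment> \<open>\<open>F\<close> and \<open>P\<close> both leave residuals orthogonal to
      \<open>H2_minus0\<close>; their difference lies in that space and is thus orthogonal to
      itself.\<close>
    define h where "h = (\<lambda>z. F z - P z)"
    have h: "h \<in> H2_minus0" unfolding h_def using F(3) P by (blast intro: H2_minus0_diff)
    then have hL: "h \<in> L2_circle" by (simp add: H2_minus0_def)
    have "circle_inner (\<lambda>z. (op_R f z - P z) - (op_R f z - F z)) h = 0"
      using P h F5[OF h] by (subst circle_inner_diff) (auto intro!: L2_circle_diff fL L hL)
    then show "circle_inner (\<lambda>z. F z - P z) (\<lambda>z. F z - P z) = 0"
      unfolding h_def by simp
    show "(\<lambda>z. F z - P z) \<in> L2_circle" using hL by (simp add: h_def)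
  qed
  then have FP: "circle_eq F P" by (simp add: circle_eq_def)
  have Q: "op_Q f analytic_on closed_exterior \<and> (op_Q f \<longlongrightarrow> 0) at_infinity \<and> circle_eq (op_Q f) P"
    unfolding op_Q_def P_def by (rule someI[of _ F]) (use F(1,2) FP P_def in blast)
  then show "op_Q f analytic_on closed_exterior" "(op_Q f \<longlongrightarrow> 0) at_infinity" by auto
  have "circle_eq (op_Q f) F"
    using Q FP unfolding circle_eq_def by (auto elim: AE_mp)
  then have "near closed_exterior (\<lambda>z. op_Q f z = F z)"
    using exterior_germ_unique F(1) Q by blast
  then have QF: "op_Q f z = F z" if "norm z = 1" for z
    using nearD[of closed_exterior _ z] that by (simp add: closed_exterior_def)
  show "(\<lambda>z. f z - op_Q f z) \<in> H2"
    using F(4) by (subst H2_cong[of _ "\<lambda>z. g z - F z"]) (auto simp: g(2) QF)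
qed

text \<open>The two Hardy spaces meet only in zero. Recognising a function as \<open>op_Q f\<close>
  thus amounts to checking that the remainder is in \<open>H2\<close>, which is how every formula
  for Q is obtained later.\<close>

lemma op_Q_unique:
  assumes "circle_analytic f" "F analytic_on closed_exterior" "(F \<longlongrightarrow> 0) at_infinity"
    "(\<lambda>z. f z - F z) \<in> H2"
  shows "near closed_exterior (\<lambda>z. F z = op_Q f z)"
proof (rule exterior_germ_unique[OF assms(2) op_Q_props(1)[OF assms(1)]])
  have "(\<lambda>z. (f z - op_Q f z) - (f z - F z)) \<in> H2"
    using H2_diff[OF op_Q_props(3)[OF assms(1)] assms(4)] .
  then have "(\<lambda>z. F z - op_Q f z) \<in> H2" by simp
  moreover have "(\<lambda>z. F z - op_Q f z) \<in> H2_minus0"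
    by (intro H2_minus0_diff exterior_in_H2_minus0 assms op_Q_props)
  ultimately have "circle_eq (\<lambda>z. F z - op_Q f z) (\<lambda>_. 0)" by (rule H2_Int_H2_minus0)
  then show "circle_eq F (op_Q f)" by (simp add: circle_eq_def)
qed

text \<open>\<open>op_R\<close> discards all values off the circle, so equality holds for total
  functions and not merely for germs.\<close>

lemma op_Q_cong:
  assumes "\<And>z. norm z = 1 \<Longrightarrow> f z = g z"
  shows "op_Q f = op_Q g"
proof -
  have "op_R f = op_R g" using assms by (auto simp: op_R_def)
  then show ?thesis by (simp add: op_Q_def)
qed

subsection \<open>Double power series\<close>

definition dps_summable :: "(nat \<Rightarrow> nat \<Rightarrow> complex) \<Rightarrow> real \<Rightarrow> bool" where
  "dps_summable c s \<longleftrightarrow> (\<lambda>(m, n). norm (c m n) * s ^ (m + n)) summable_on UNIV"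

text \<open>The arguments are complex although real-analyticity involves real ones only: this
  permits substituting holomorphic functions for the coordinates.\<close>

definition dps :: "(nat \<Rightarrow> nat \<Rightarrow> complex) \<Rightarrow> complex \<Rightarrow> complex \<Rightarrow> complex" where
  "dps c x y = (\<Sum>\<^sub>\<infinity>(m, n). c m n * x ^ m * y ^ n)"

lemma dps_term_bound:
  fixes c :: "nat \<Rightarrow> nat \<Rightarrow> complex"
  assumes "norm x \<le> s" "norm y \<le> s"
  shows "norm (c m n * x ^ m * y ^ n) \<le> norm (c m n) * s ^ (m + n)"
proof -
  have "norm x ^ m * norm y ^ n \<le> s ^ m * s ^ n"
    using assms order_trans[OF norm_ge_zero assms(1)] by (intro mult_mono power_mono) auto
  from mult_left_mono[OF this norm_ge_zero[of "c m n"]] show ?thesis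
    by (simp add: norm_mult norm_power power_add mult.assoc)
qed

lemma dps_abs_summable:
  assumes "dps_summable c s" "norm x \<le> s" "norm y \<le> s"
  shows "(\<lambda>p. norm (case p of (m, n) \<Rightarrow> c m n * x ^ m * y ^ n)) summable_on UNIV"
proof (rule Infinite_Sum.abs_summable_on_comparison_test')
  show "(\<lambda>(m, n). norm (c m n) * s ^ (m + n)) summable_on UNIV"
    using assms(1) by (simp add: dps_summable_def)
  show "norm (case p of (m, n) \<Rightarrow> c m n * x ^ m * y ^ n) \<le> (case p of (m, n) \<Rightarrow> norm (c m n) * s ^ (m + n))" for p
    using dps_term_bound[OF assms(2,3)] by (cases p) simp
qed

lemma dps_has_sum:
  assumes "dps_summable c s" "norm x \<le> s" "norm y \<le> s"
  shows "((\<lambda>(m, n). c m n * x ^ m * y ^ n) has_sum dps c x y) UNIV"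
  unfolding dps_def
  using Infinite_Sum.abs_summable_summable[OF dps_abs_summable[OF assms]] by (rule has_sum_infsum)

lemma has_sum_pair_imp_sums:
  fixes f :: "nat \<times> nat \<Rightarrow> 'a::{topological_comm_monoid_add, t2_space}"
  assumes "(f has_sum S) UNIV"
  shows "(\<lambda>i. f (prod_decode i)) sums S"
proof -
  have "((\<lambda>i. f (prod_decode i)) has_sum S) UNIV"
    using assms has_sum_reindex_bij_betw[OF bij_prod_decode, of f S] by blast
  then show ?thesis by (rule has_sum_imp_sums)
qed

lemma dps_summable_imp_summable:
  assumes "dps_summable c s"
  shows "summable (\<lambda>i. case prod_decode i of (m, n) \<Rightarrow> norm (c m n) * s ^ (m + n))"
proof -
  have "((\<lambda>(m, n). norm (c m n) * s ^ (m + n)) has_sum (\<Sum>\<^sub>\<infinity>(m, n). norm (c m n) * s ^ (m + n))) UNIV"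
    using assms unfolding dps_summable_def by (rule has_sum_infsum)
  from has_sum_pair_imp_sums[OF this] show ?thesis by (rule sums_summable)
qed

lemma nat_power_bound:
  fixes s t :: real
  assumes "0 < s" "s < t"
  shows "\<exists>C\<ge>0. \<forall>k. real k * s ^ (k - 1) \<le> C * t ^ k"
proof -
  have "(\<lambda>k. real k * (s / t) ^ k) \<longlonglongrightarrow> 0"
    using assms by (intro powser_times_n_limit_0) simp
  then have "Bseq (\<lambda>k. real k * (s / t) ^ k)" using convergent_imp_Bseq convergentI by blast
  then obtain K where K: "K > 0" "\<And>k. norm (real k * (s / t) ^ k) \<le> K" by (auto elim: BseqE)
  have "real k * s ^ (k - 1) \<le> K / s * t ^ k" for k
  proof (cases k)
    case (Suc j)
    have "real k * (s / t) ^ k \<le> K" using K(2)[of k] by simp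
    then have "real k * s ^ k \<le> K * t ^ k"
      using assms by (simp add: power_divide field_simps)
    then have "s * (real k * s ^ (k - 1)) \<le> s * (K / s * t ^ k)"
      using assms Suc by (simp add: mult_ac)
    then show ?thesis using assms(1) by (rule mult_left_le_imp_le)
  qed (use K assms in simp)
  then show ?thesis using K assms by (intro exI[of _ "K / s"]) auto
qed

lemma dps_summable_deriv:
  assumes "dps_summable c t" "0 < s" "s < t"
  shows "(\<lambda>(m, n). norm (c m n) * (real (m + n) * s ^ (m + n - 1))) summable_on UNIV"
proof -
  obtain C where C: "C \<ge> 0" "\<And>k. real k * s ^ (k - 1) \<le> C * t ^ k"
    using nat_power_bound[OF assms(2,3)] by blast
  show ?thesis
  proof (rule summable_on_comparison_test)
    show "(\<lambda>p. C * (case p of (m, n) \<Rightarrow> norm (c m n) * t ^ (m + n))) summable_on UNIV"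
      using assms(1) unfolding dps_summable_def by (rule summable_on_cmult_right)
    show "(case p of (m, n) \<Rightarrow> norm (c m n) * (real (m + n) * s ^ (m + n - 1)))
        \<le> C * (case p of (m, n) \<Rightarrow> norm (c m n) * t ^ (m + n))" for p
    proof (cases p)
      case (Pair m n)
      have "norm (c m n) * (real (m + n) * s ^ (m + n - 1)) \<le> norm (c m n) * (C * t ^ (m + n))"
        by (intro mult_left_mono C) auto
      then show ?thesis using Pair by (simp add: mult_ac)
    qed
    show "0 \<le> (case p of (m, n) \<Rightarrow> norm (c m n) * (real (m + n) * s ^ (m + n - 1)))" for p
      using assms by (cases p) auto
  qed
qed

definition dps_dx :: "(nat \<Rightarrow> nat \<Rightarrow> complex) \<Rightarrow> nat \<Rightarrow> nat \<Rightarrow> complex" where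
  "dps_dx c m n = of_nat (Suc m) * c (Suc m) n"

text \<open>Exchanging the variables makes the y-derivative an instance of the x-derivative.\<close>

definition dps_swap :: "(nat \<Rightarrow> nat \<Rightarrow> complex) \<Rightarrow> nat \<Rightarrow> nat \<Rightarrow> complex" where
  "dps_swap c m n = c n m"

lemma dps_summable_swap: "dps_summable (dps_swap c) s \<longleftrightarrow> dps_summable c s"
proof -
  have "(\<lambda>(m, n). norm (dps_swap c m n) * s ^ (m + n)) = (\<lambda>(m, n). norm (c m n) * s ^ (m + n)) \<circ> prod.swap"
    by (auto simp: fun_eq_iff dps_swap_def add.commute)
  then show ?thesis unfolding dps_summable_def
    using summable_on_reindex[of prod.swap UNIV "\<lambda>(m, n). norm (c m n) * s ^ (m + n)"]
    by (simp add: surj_swap)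
qed

lemma dps_swap: "dps (dps_swap c) x y = dps c y x"
proof -
  have "infsum (\<lambda>(m, n). c m n * y ^ m * x ^ n) (prod.swap ` UNIV) =
        infsum ((\<lambda>(m, n). c m n * y ^ m * x ^ n) \<circ> prod.swap) UNIV"
    by (rule infsum_reindex) simp
  moreover have "(\<lambda>(m, n). c m n * y ^ m * x ^ n) \<circ> prod.swap = (\<lambda>(m, n). dps_swap c m n * x ^ m * y ^ n)"
    by (auto simp: fun_eq_iff dps_swap_def mult_ac)
  ultimately show ?thesis by (simp add: dps_def surj_swap)
qed

lemma dps_summable_dx:
  assumes "dps_summable c t" "0 < s" "s < t"
  shows "dps_summable (dps_dx c) s"
proof -
  define f where "f = (\<lambda>(m, n). norm (c m n) * (real (m + n) * s ^ (m + n - 1)))"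
  define h where "h = map_prod Suc (\<lambda>n::nat. n)"
  have "f summable_on range h"
    using dps_summable_deriv[OF assms] unfolding f_def by (rule summable_on_subset_banach) simp
  moreover have "inj h" unfolding h_def by (auto simp: inj_def)
  ultimately have "(f \<circ> h) summable_on UNIV" using summable_on_reindex by blast
  then show ?thesis unfolding dps_summable_def
  proof (rule summable_on_comparison_test)
    show "(case p of (m, n) \<Rightarrow> norm (dps_dx c m n) * s ^ (m + n)) \<le> (f \<circ> h) p" for p
    proof (cases p)
      case (Pair m n)
      have "norm (c (Suc m) n) * (real (Suc m) * s ^ (m + n)) \<le> norm (c (Suc m) n) * (real (Suc m + n) * s ^ (m + n))"
        using assms by (intro mult_left_mono mult_right_mono) auto
      moreover have "(f \<circ> h) p = norm (c (Suc m) n) * (real (Suc m + n) * s ^ (m + n))"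
        by (simp add: Pair f_def h_def)
      moreover have "(case p of (m, n) \<Rightarrow> norm (dps_dx c m n) * s ^ (m + n)) =
          norm (c (Suc m) n) * (real (Suc m) * s ^ (m + n))"
        by (simp add: Pair dps_dx_def norm_mult del: of_nat_Suc)
      ultimately show ?thesis by (simp only:)
    qed
    show "0 \<le> (case p of (m, n) \<Rightarrow> norm (dps_dx c m n) * s ^ (m + n))" for p
      using assms by (cases p) auto
  qed
qed

text \<open>The terms keep the index of the original series so that they match its termwise
  derivatives; those with m = 0 vanish, hence the shift in \<open>dps_dx\<close> does not change the
  sum.\<close>

lemma dps_dx_has_sum:
  assumes "dps_summable (dps_dx c) s" "norm x \<le> s" "norm y \<le> s"
  shows "((\<lambda>(m, n). c m n * (of_nat m * x ^ (m - 1)) * y ^ n) has_sum dps (dps_dx c) x y) UNIV"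
proof -
  define g where "g = (\<lambda>(m, n). c m n * (of_nat m * x ^ (m - 1)) * y ^ n)"
  define h where "h = map_prod Suc (\<lambda>n::nat. n)"
  have inj: "inj h" unfolding h_def by (auto simp: inj_def)
  have "g \<circ> h = (\<lambda>(m, n). dps_dx c m n * x ^ m * y ^ n)"
    by (auto simp: fun_eq_iff g_def h_def dps_dx_def mult_ac simp del: of_nat_Suc)
  then have "((g \<circ> h) has_sum dps (dps_dx c) x y) UNIV" using dps_has_sum[OF assms] by simp
  then have "(g has_sum dps (dps_dx c) x y) (range h)" using has_sum_reindex[OF inj] by blast
  moreover have "g p = 0" if "p \<notin> range h" for p
  proof (cases p)
    case (Pair m n)
    have "m = 0"
    proof (rule ccontr)
      assume "m \<noteq> 0"
      then have "p = h (m - 1, n)" using Pair by (simp add: h_def)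
      then show False using that by blast
    qed
    then show ?thesis using Pair by (simp add: g_def)
  qed
  ultimately have "(g has_sum dps (dps_dx c) x y) UNIV"
    using has_sum_cong_neutral[of "range h" UNIV g g] by blast
  then show ?thesis by (simp add: g_def)
qed

lemma dps_dy_has_sum:
  assumes "dps_summable (dps_dx (dps_swap c)) s" "norm x \<le> s" "norm y \<le> s"
  shows "((\<lambda>(m, n). c m n * x ^ m * (of_nat n * y ^ (n - 1))) has_sum dps (dps_dx (dps_swap c)) y x) UNIV"
proof -
  have "((\<lambda>(m, n). dps_swap c m n * (of_nat m * y ^ (m - 1)) * x ^ n) has_sum dps (dps_dx (dps_swap c)) y x) (range prod.swap)"
    using dps_dx_has_sum[OF assms(1,3,2)] by (simp add: surj_swap)
  then have "(((\<lambda>(m, n). dps_swap c m n * (of_nat m * y ^ (m - 1)) * x ^ n) \<circ> prod.swap) has_sum dps (dps_dx (dps_swap c)) y x) UNIV"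
    by (subst (asm) has_sum_reindex) auto
  moreover have "((\<lambda>(m, n). dps_swap c m n * (of_nat m * y ^ (m - 1)) * x ^ n) \<circ> prod.swap) =
      (\<lambda>(m, n). c m n * x ^ m * (of_nat n * y ^ (n - 1)))"
    by (auto simp: fun_eq_iff dps_swap_def mult_ac)
  ultimately show ?thesis by simp
qed

text \<open>Uniform convergence of both partial derivatives is convergence of the total
  differentials in operator norm, the form used by the theorem on differentiating a series.\<close>

lemma uniform_limit_Re_Im_combination:
  fixes A B :: "'i \<Rightarrow> 'z \<Rightarrow> complex"
  assumes A: "uniform_limit S A a F" and B: "uniform_limit S B b F" and e: "e > 0"
  shows "\<forall>\<^sub>F n in F. \<forall>z\<in>S. \<forall>h::complex. norm ((of_real (Re h) * A n z + of_real (Im h) * B n z) -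
    (of_real (Re h) * a z + of_real (Im h) * b z)) \<le> e * norm (h::complex)"
proof -
  have "\<forall>\<^sub>F n in F. \<forall>z\<in>S. dist (A n z) (a z) < e / 2" "\<forall>\<^sub>F n in F. \<forall>z\<in>S. dist (B n z) (b z) < e / 2"
    using A B e unfolding uniform_limit_iff by (meson half_gt_zero)+
  then show ?thesis
  proof eventually_elim
    case (elim n)
    show ?case
    proof (intro ballI allI)
      fix z and h :: complex assume z: "z \<in> S"
      have "(of_real (Re h) * A n z + of_real (Im h) * B n z) - (of_real (Re h) * a z + of_real (Im h) * b z)
          = of_real (Re h) * (A n z - a z) + of_real (Im h) * (B n z - b z)"
        by (simp add: algebra_simps)
      also have "norm \<dots> \<le> \<bar>Re h\<bar> * norm (A n z - a z) + \<bar>Im h\<bar> * norm (B n z - b z)"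
        by (rule order_trans[OF norm_triangle_ineq]) (simp add: norm_mult)
      also have "\<dots> \<le> norm h * (e / 2) + norm h * (e / 2)"
        using elim z abs_Re_le_cmod[of h] abs_Im_le_cmod[of h]
        by (intro add_mono mult_mono) (auto simp: dist_norm less_imp_le)
      finally show "norm ((of_real (Re h) * A n z + of_real (Im h) * B n z) - (of_real (Re h) * a z + of_real (Im h) * b z)) \<le> e * norm h"
        by (simp add: algebra_simps)
    qed
  qed
qed

text \<open>The pairs of exponents are enumerated by \<open>prod_decode\<close>, which reduces the
  claim to ordinary series; a common majorant of the termwise partial derivatives gives uniform
  convergence.\<close>

lemma dps_has_derivative:
  fixes a :: complex
  assumes c: "dps_summable c t" and s: "0 < s" "s < t" and z: "z \<in> ball a s"
  defines "f \<equiv> \<lambda>z. dps c (of_real (Re (z - a))) (of_real (Im (z - a)))"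
  defines "fx \<equiv> \<lambda>z. dps (dps_dx c) (of_real (Re (z - a))) (of_real (Im (z - a)))"
  defines "fy \<equiv> \<lambda>z. dps (dps_dx (dps_swap c)) (of_real (Im (z - a))) (of_real (Re (z - a)))"
  shows "(f has_derivative (\<lambda>h. of_real (Re h) * fx z + of_real (Im h) * fy z)) (at z)"
proof -
  define S where "S = ball a s"
  define x where "x z = complex_of_real (Re (z - a))" for z
  define y where "y z = complex_of_real (Im (z - a))" for z
  define M N where "M i = fst (prod_decode i)" and "N i = snd (prod_decode i)" for i
  define T where "T i z = c (M i) (N i) * x z ^ M i * y z ^ N i" for i z
  define A where "A i z = c (M i) (N i) * (of_nat (M i) * x z ^ (M i - 1)) * y z ^ N i" for i z
  define B where "B i z = c (M i) (N i) * x z ^ M i * (of_nat (N i) * y z ^ (N i - 1))" for i z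
  \<comment> \<open>The total degree bounds either exponent and \<open>s\<close> bounds either
    coordinate, so one majorant serves both derivatives.\<close>
  define K where "K i = norm (c (M i) (N i)) * (real (M i + N i) * s ^ (M i + N i - 1))" for i
  have xy: "norm (x z) \<le> s" "norm (y z) \<le> s" if "z \<in> S" for z
  proof -
    have "norm (z - a) < s" using that by (simp add: S_def dist_norm norm_minus_commute)
    then show "norm (x z) \<le> s" "norm (y z) \<le> s"
      using abs_Re_le_cmod[of "z - a"] abs_Im_le_cmod[of "z - a"] unfolding x_def y_def norm_of_real by linarith+
  qed
  have c's: "dps_summable (dps_swap c) t" using c by (simp add: dps_summable_swap)
  note dxs = dps_summable_dx[OF c s] and dys = dps_summable_dx[OF c's s]
  have cs: "dps_summable c s"
    unfolding dps_summable_def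
    by (rule summable_on_comparison_test[OF c[unfolded dps_summable_def]])
      (use s in \<open>auto intro!: mult_left_mono power_mono\<close>)
  have Tsums: "(\<lambda>i. T i z) sums f z" if "z \<in> S" for z
    using has_sum_pair_imp_sums[OF dps_has_sum[OF cs xy[OF that]]]
    unfolding T_def f_def x_def y_def M_def N_def by (simp add: case_prod_beta)
  have Asums: "(\<lambda>i. A i z) sums fx z" if "z \<in> S" for z
    using has_sum_pair_imp_sums[OF dps_dx_has_sum[OF dxs xy[OF that]]]
    unfolding A_def fx_def x_def y_def M_def N_def by (simp add: case_prod_beta)
  have Bsums: "(\<lambda>i. B i z) sums fy z" if "z \<in> S" for z
    using has_sum_pair_imp_sums[OF dps_dy_has_sum[OF dys xy[OF that]]]
    unfolding B_def fy_def x_def y_def M_def N_def by (simp add: case_prod_beta)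
  have Ks: "summable K"
  proof -
    have "((\<lambda>(m, n). norm (c m n) * (real (m + n) * s ^ (m + n - 1))) has_sum
       infsum (\<lambda>(m, n). norm (c m n) * (real (m + n) * s ^ (m + n - 1))) UNIV) UNIV"
      by (rule has_sum_infsum[OF dps_summable_deriv[OF c s]])
    from sums_summable[OF has_sum_pair_imp_sums[OF this]] show ?thesis
      unfolding K_def M_def N_def by (simp add: case_prod_beta)
  qed
  have pw: "real m * (\<alpha> ^ (m - 1) * \<beta> ^ n) \<le> real (m + n) * s ^ (m + n - 1)"
    if "0 \<le> \<alpha>" "\<alpha> \<le> s" "0 \<le> \<beta>" "\<beta> \<le> s" for \<alpha> \<beta> :: real and m n
  proof (cases m)
    case (Suc k)
    have "\<alpha> ^ k * \<beta> ^ n \<le> s ^ k * s ^ n" using that by (intro mult_mono power_mono) auto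
    then have "real m * (\<alpha> ^ k * \<beta> ^ n) \<le> real (m + n) * (s ^ k * s ^ n)"
      by (rule mult_mono[rotated]) (use that s in auto)
    then show ?thesis using Suc by (simp add: power_add)
  qed (use s in simp)
  have AK: "norm (A i z) \<le> K i" if "z \<in> S" for i z
  proof -
    have "norm (A i z) = norm (c (M i) (N i)) * (real (M i) * (norm (x z) ^ (M i - 1) * norm (y z) ^ N i))"
      by (simp add: A_def norm_mult norm_power mult_ac)
    also have "\<dots> \<le> K i" unfolding K_def using xy[OF that] by (intro mult_left_mono pw) auto
    finally show ?thesis .
  qed
  have BK: "norm (B i z) \<le> K i" if "z \<in> S" for i z
  proof -
    have "norm (B i z) = norm (c (M i) (N i)) * (real (N i) * (norm (y z) ^ (N i - 1) * norm (x z) ^ M i))"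
      by (simp add: B_def norm_mult norm_power mult_ac)
    also have "\<dots> \<le> norm (c (M i) (N i)) * (real (N i + M i) * s ^ (N i + M i - 1))"
      using xy[OF that] by (intro mult_left_mono pw) auto
    finally show ?thesis by (simp add: K_def add.commute)
  qed
  have uA: "uniform_limit S (\<lambda>n z. \<Sum>i<n. A i z) (\<lambda>z. \<Sum>i. A i z) sequentially"
    by (rule Weierstrass_m_test[OF AK Ks])
  have uB: "uniform_limit S (\<lambda>n z. \<Sum>i<n. B i z) (\<lambda>z. \<Sum>i. B i z) sequentially"
    by (rule Weierstrass_m_test[OF BK Ks])
  have "\<exists>g. \<forall>z\<in>S. (\<lambda>i. T i z) sums g z \<and>
     (g has_derivative (\<lambda>h. of_real (Re h) * (\<Sum>i. A i z) + of_real (Im h) * (\<Sum>i. B i z))) (at z within S)"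
  proof (rule has_derivative_series)
    show "convex S" by (simp add: S_def)
    fix i w assume "w \<in> S"
    show "(T i has_derivative (\<lambda>h. of_real (Re h) * A i w + of_real (Im h) * B i w)) (at w within S)"
      unfolding T_def x_def y_def
      by (rule derivative_eq_intros refl)+
        (auto simp: fun_eq_iff A_def B_def x_def y_def algebra_simps)
  next
    fix e :: real assume "e > 0"
    from uniform_limit_Re_Im_combination[OF uA uB this]
    show "\<forall>\<^sub>F n in sequentially. \<forall>z\<in>S. \<forall>h. norm ((\<Sum>i<n. of_real (Re h) * A i z + of_real (Im h) * B i z) -
       (of_real (Re h) * (\<Sum>i. A i z) + of_real (Im h) * (\<Sum>i. B i z))) \<le> e * norm h"
      by (simp add: sum.distrib sum_distrib_left)
  next
    show "z \<in> S" using z by (simp add: S_def)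
    then show "(\<lambda>i. T i z) sums f z" by (rule Tsums)
  qed
  then obtain g where g: "\<And>z. z \<in> S \<Longrightarrow> (\<lambda>i. T i z) sums g z"
     "\<And>z. z \<in> S \<Longrightarrow> (g has_derivative (\<lambda>h. of_real (Re h) * (\<Sum>i. A i z) + of_real (Im h) * (\<Sum>i. B i z))) (at z within S)"
    by blast
  have gf: "g w = f w" if "w \<in> S" for w using sums_unique2[OF g(1)[OF that] Tsums[OF that]] .
  have zS: "z \<in> S" "open S" using z by (auto simp: S_def)
  have "(g has_derivative (\<lambda>h. of_real (Re h) * fx z + of_real (Im h) * fy z)) (at z within S)"
    using g(2)[OF zS(1)] sums_unique[OF Asums[OF zS(1)]] sums_unique[OF Bsums[OF zS(1)]] by simp
  then have "(f has_derivative (\<lambda>h. of_real (Re h) * fx z + of_real (Im h) * fy z)) (at z within S)"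
    by (rule has_derivative_transform[OF zS(1), rotated]) (simp add: gf)
  then show ?thesis using at_within_open[OF zS] by simp
qed

subsection \<open>Real-analytic functions\<close>

text \<open>The definition provides sums at real points only. Evaluating at the diagonal point (s,
  s) gives absolute summability for the whole bidisk of radius \<open>s\<close>, including complex
  arguments.\<close>

lemma real_analytic_dps:
  fixes f :: "complex \<Rightarrow> complex"
  assumes "real_analytic_on f S" "a \<in> S"
  obtains c s where "s > 0" "dps_summable c s"
    "\<And>z. z \<in> ball a s \<Longrightarrow> f z = dps c (of_real (Re (z - a))) (of_real (Im (z - a)))"
proof -
  obtain r c where r: "r > 0" and sum: "\<And>z. z \<in> ball a r \<Longrightarrow>
      ((\<lambda>(m, n). (Re (z - a) ^ m * Im (z - a) ^ n) *\<^sub>R c m n) has_sum f z) UNIV"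
    using assms unfolding real_analytic_on_def by blast
  have eq: "(\<lambda>(m, n). (Re w ^ m * Im w ^ n) *\<^sub>R c m n) =
     (\<lambda>(m, n). c m n * of_real (Re w) ^ m * of_real (Im w) ^ n)" for w
    by (auto simp: fun_eq_iff scaleR_conv_of_real)
  \<comment> \<open>The diagonal point s + i s then has modulus at most 2 s = r / 2, inside the
    ball.\<close>
  define s where "s = r / 4"
  have s: "s > 0" using r by (simp add: s_def)
  define w where "w = Complex s s"
  have "norm w < r"
    using cmod_le[of w] r by (simp add: w_def s_def)
  then have "((\<lambda>(m, n). c m n * of_real s ^ m * of_real s ^ n) has_sum f (a + w)) UNIV"
    using sum[of "a + w"] unfolding eq by (simp add: dist_norm w_def)
  then have "(\<lambda>p. norm (case p of (m, n) \<Rightarrow> c m n * of_real s ^ m * of_real s ^ n)) summable_on UNIV"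
    using summable_on_iff_abs_summable_on_complex has_sum_imp_summable by blast
  then have cs: "dps_summable c s"
    unfolding dps_summable_def
    by (rule summable_on_cong[THEN iffD1, rotated]) (use s in \<open>auto simp: norm_mult norm_power power_add\<close>)
  show ?thesis
  proof (rule that[OF s cs])
    fix z assume z: "z \<in> ball a s"
    then have "z \<in> ball a r" using r by (simp add: s_def)
    then have "((\<lambda>(m, n). c m n * of_real (Re (z - a)) ^ m * of_real (Im (z - a)) ^ n) has_sum f z) UNIV"
      using sum unfolding eq by blast
    then show "f z = dps c (of_real (Re (z - a))) (of_real (Im (z - a)))"
      unfolding dps_def by (simp add: infsumI)
  qed
qed

lemma real_analytic_dpsI:
  assumes "\<And>a. a \<in> S \<Longrightarrow> \<exists>s>0. \<exists>c. dps_summable c s \<and>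
    (\<forall>z\<in>ball a s. f z = dps c (of_real (Re (z - a))) (of_real (Im (z - a))))"
  shows "real_analytic_on f S"
  unfolding real_analytic_on_def
proof
  fix a assume "a \<in> S"
  then obtain s c where s: "s > 0" "dps_summable c s"
    "\<And>z. z \<in> ball a s \<Longrightarrow> f z = dps c (of_real (Re (z - a))) (of_real (Im (z - a)))"
    using assms by blast
  show "\<exists>r>0. \<exists>c. \<forall>z\<in>ball a r. ((\<lambda>(m, n). (Re (z - a) ^ m * Im (z - a) ^ n) *\<^sub>R c m n) has_sum f z) UNIV"
  proof (intro exI[of _ s] exI[of _ c] conjI ballI s(1))
    fix z assume z: "z \<in> ball a s"
    have eq: "(\<lambda>(m, n). (Re w ^ m * Im w ^ n) *\<^sub>R c m n) =
     (\<lambda>(m, n). c m n * of_real (Re w) ^ m * of_real (Im w) ^ n)" for w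
    by (auto simp: fun_eq_iff scaleR_conv_of_real)
    show "((\<lambda>(m, n). (Re (z - a) ^ m * Im (z - a) ^ n) *\<^sub>R c m n) has_sum f z) UNIV"
      unfolding eq s(3)[OF z]
    proof (rule dps_has_sum[OF s(2)])
      have "norm (z - a) < s" using z by (simp add: dist_norm norm_minus_commute)
      then show "norm (complex_of_real (Re (z - a))) \<le> s" "norm (complex_of_real (Im (z - a))) \<le> s"
        using abs_Re_le_cmod[of "z - a"] abs_Im_le_cmod[of "z - a"] unfolding norm_of_real by linarith+
    qed
  qed
qed

definition real_dx :: "(complex \<Rightarrow> complex) \<Rightarrow> complex \<Rightarrow> complex" where
  "real_dx f z = frechet_derivative f (at z) 1"

definition real_dy :: "(complex \<Rightarrow> complex) \<Rightarrow> complex \<Rightarrow> complex" where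
  "real_dy f z = frechet_derivative f (at z) \<i>"

text \<open>On a smaller ball the partial derivatives are given by the formally differentiated
  series, so real-analyticity passes to them.\<close>

lemma real_analytic_has_derivative:
  fixes f :: "complex \<Rightarrow> complex"
  assumes f: "real_analytic_on f S"
  shows "real_analytic_on (real_dx f) S" "real_analytic_on (real_dy f) S"
    "z \<in> S \<Longrightarrow> (f has_derivative (\<lambda>h. of_real (Re h) * real_dx f z + of_real (Im h) * real_dy f z)) (at z)"
proof -
  have *: "\<exists>s>0. \<exists>c c'. dps_summable c s \<and> dps_summable c' s \<and>
     (\<forall>z\<in>ball a s. real_dx f z = dps c (of_real (Re (z - a))) (of_real (Im (z - a))) \<and>
       real_dy f z = dps c' (of_real (Re (z - a))) (of_real (Im (z - a))) \<and>
       (f has_derivative (\<lambda>h. of_real (Re h) * real_dx f z + of_real (Im h) * real_dy f z)) (at z))"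
    if a: "a \<in> S" for a
  proof -
    obtain c t where t: "t > 0" "dps_summable c t"
      "\<And>z. z \<in> ball a t \<Longrightarrow> f z = dps c (of_real (Re (z - a))) (of_real (Im (z - a)))"
      using real_analytic_dps[OF f a] by blast
    define s where "s = t / 2"
    have s: "0 < s" "s < t" using t by (auto simp: s_def)
    define cx where "cx = dps_dx c"
    define cy where "cy = dps_swap (dps_dx (dps_swap c))"
    have sx: "dps_summable cx s" unfolding cx_def by (rule dps_summable_dx[OF t(2) s])
    have sy: "dps_summable cy s" unfolding cy_def dps_summable_swap
      by (rule dps_summable_dx[OF _ s]) (simp add: dps_summable_swap t)
    have "real_dx f z = dps cx (of_real (Re (z - a))) (of_real (Im (z - a))) \<and>
       real_dy f z = dps cy (of_real (Re (z - a))) (of_real (Im (z - a))) \<and>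
       (f has_derivative (\<lambda>h. of_real (Re h) * real_dx f z + of_real (Im h) * real_dy f z)) (at z)"
      if z: "z \<in> ball a s" for z
    proof -
      define X where "X = dps cx (of_real (Re (z - a))) (of_real (Im (z - a)))"
      define Y where "Y = dps cy (of_real (Re (z - a))) (of_real (Im (z - a)))"
      have "((\<lambda>z. dps c (of_real (Re (z - a))) (of_real (Im (z - a)))) has_derivative
          (\<lambda>h. of_real (Re h) * X + of_real (Im h) * Y)) (at z)"
        using dps_has_derivative[OF t(2) s z] unfolding X_def Y_def cx_def cy_def dps_swap .
      then have d: "(f has_derivative (\<lambda>h. of_real (Re h) * X + of_real (Im h) * Y)) (at z)"
      proof (rule has_derivative_transform_within_open)
        show "open (ball a t)" "z \<in> ball a t" using z s by auto
      qed (use t in simp)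
      have "frechet_derivative f (at z) = (\<lambda>h. of_real (Re h) * X + of_real (Im h) * Y)"
        by (rule frechet_derivative_at[OF d, symmetric])
      then have "real_dx f z = X" "real_dy f z = Y" by (simp_all add: real_dx_def real_dy_def)
      then show ?thesis using d X_def Y_def by simp
    qed
    then show ?thesis using sx sy s(1) by blast
  qed
  show "real_analytic_on (real_dx f) S" "real_analytic_on (real_dy f) S"
    by (rule real_analytic_dpsI, use * in meson)+
  show "(f has_derivative (\<lambda>h. of_real (Re h) * real_dx f z + of_real (Im h) * real_dy f z)) (at z)" if "z \<in> S"
    using *[OF that] by (metis centre_in_ball)
qed

lemma real_analytic_of_real:
  fixes f :: "complex \<Rightarrow> real"
  assumes "real_analytic_on f S"
  shows "real_analytic_on (\<lambda>z. complex_of_real (f z)) S"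
  unfolding real_analytic_on_def
proof
  fix a assume "a \<in> S"
  then obtain r c where r: "r > 0" and sum: "\<And>z. z \<in> ball a r \<Longrightarrow>
      ((\<lambda>(m, n). (Re (z - a) ^ m * Im (z - a) ^ n) *\<^sub>R c m n) has_sum f z) UNIV"
    using assms unfolding real_analytic_on_def by blast
  have "((\<lambda>(m, n). (Re (z - a) ^ m * Im (z - a) ^ n) *\<^sub>R complex_of_real (c m n)) has_sum of_real (f z)) UNIV"
    if "z \<in> ball a r" for z
  proof -
    have "((\<lambda>p. complex_of_real (case p of (m, n) \<Rightarrow> (Re (z - a) ^ m * Im (z - a) ^ n) *\<^sub>R c m n)) has_sum of_real (f z)) UNIV"
      by (rule has_sum_bounded_linear[OF bounded_linear_of_real sum[OF that]])
    then show ?thesis by (simp add: case_prod_unfold scaleR_conv_of_real)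
  qed
  then show "\<exists>r>0. \<exists>c. \<forall>z\<in>ball a r. ((\<lambda>(m, n). (Re (z - a) ^ m * Im (z - a) ^ n) *\<^sub>R c m n) has_sum complex_of_real (f z)) UNIV"
    using r by (intro exI[of _ r] conjI exI[of _ "\<lambda>m n. complex_of_real (c m n)"]) auto
qed

text \<open>Substituting holomorphic functions for the real coordinates in the power series extends the
  restriction of a real-analytic function to an analytic arc.\<close>

lemma real_analytic_complexify:
  fixes f :: "complex \<Rightarrow> complex"
  assumes f: "real_analytic_on f S" and a: "a \<in> S"
    and u: "u analytic_on {b}" "u b = of_real (Re a)" and w: "w analytic_on {b}" "w b = of_real (Im a)"
  obtains g where "g analytic_on {b}"
    "\<forall>\<^sub>F z in nhds b. \<forall>x y. u z = of_real x \<longrightarrow> w z = of_real y \<longrightarrow> g z = f (Complex x y)"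
proof -
  obtain c t where t: "t > 0" "dps_summable c t"
      "\<And>z. z \<in> ball a t \<Longrightarrow> f z = dps c (of_real (Re (z - a))) (of_real (Im (z - a)))"
    using real_analytic_dps[OF f a] by blast
  define U where "U z = u z - of_real (Re a)" for z
  define W where "W z = w z - of_real (Im a)" for z
  have UW: "U analytic_on {b}" "W analytic_on {b}" "U b = 0" "W b = 0"
    unfolding U_def W_def using u w by (auto intro!: analytic_intros)
  obtain d1 where d1: "d1 > 0" "U holomorphic_on ball b d1"
    using UW(1) unfolding analytic_on_def by auto
  obtain d2 where d2: "d2 > 0" "W holomorphic_on ball b d2"
    using UW(2) unfolding analytic_on_def by auto
  have "isCont U b" "isCont W b"
    using UW(1,2) analytic_on_imp_continuous_on analytic_at_imp_isCont by blast+
  then have "(U \<longlongrightarrow> U b) (nhds b)" "(W \<longlongrightarrow> W b) (nhds b)"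
    by (simp_all only: isCont_def tendsto_at_iff_tendsto_nhds)
  then have "\<forall>\<^sub>F z in nhds b. dist (U z) 0 < t / 2" "\<forall>\<^sub>F z in nhds b. dist (W z) 0 < t / 2"
    using tendstoD[of U 0 "nhds b" "t/2"] tendstoD[of W 0 "nhds b" "t/2"] UW(3,4) t(1) by simp_all
  then have "\<forall>\<^sub>F z in nhds b. norm (U z) < t / 2 \<and> norm (W z) < t / 2"
    by eventually_elim simp
  then obtain d3 where d3: "d3 > 0" "\<And>z. z \<in> ball b d3 \<Longrightarrow> norm (U z) < t / 2 \<and> norm (W z) < t / 2"
    unfolding eventually_nhds_metric by (auto simp: dist_commute)
  define d where "d = min d1 (min d2 d3)"
  define O' where "O' = ball b d"
  have d: "d > 0" using d1 d2 d3 by (simp add: d_def)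
  have small: "norm (U z) \<le> t" "norm (W z) \<le> t" "norm (U z) < t / 2" "norm (W z) < t / 2" if "z \<in> O'" for z
    using d3(2)[of z] that t(1) by (auto simp: O'_def d_def)
  define T where "T i z = (case prod_decode i of (m, n) \<Rightarrow> c m n * U z ^ m * W z ^ n)" for i z
  define g where "g z = dps c (U z) (W z)" for z
  have Ts: "(\<lambda>i. T i z) sums g z" if "z \<in> O'" for z
    unfolding T_def g_def using has_sum_pair_imp_sums[OF dps_has_sum[OF t(2) small(1,2)[OF that]]] .
  have Tb: "norm (T i z) \<le> (case prod_decode i of (m, n) \<Rightarrow> norm (c m n) * t ^ (m + n))" if "z \<in> O'" for i z
    unfolding T_def using dps_term_bound[OF small(1,2)[OF that]] by (auto split: prod.split)
  have ul: "uniform_limit O' (\<lambda>n z. \<Sum>i<n. T i z) (\<lambda>z. \<Sum>i. T i z) sequentially"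
    by (rule Weierstrass_m_test[OF Tb dps_summable_imp_summable[OF t(2)]])
  have ul: "uniform_limit O' (\<lambda>n z. \<Sum>i<n. T i z) g sequentially"
    using ul by (rule uniform_limit_cong'[THEN iffD1, rotated 2]) (use sums_unique[OF Ts] in auto)
  have Th: "T i holomorphic_on O'" for i
    unfolding T_def using d1(2) d2(2)
    by (cases "prod_decode i") (auto simp: O'_def d_def intro!: holomorphic_intros elim!: holomorphic_on_subset)
  have "g holomorphic_on O'"
  proof (rule holomorphic_uniform_sequence)
    show "open O'" by (simp add: O'_def)
    show "(\<lambda>z. \<Sum>i<n. T i z) holomorphic_on O'" for n by (intro holomorphic_intros Th)
    fix x assume "x \<in> O'"
    then obtain e where "e > 0" "cball x e \<subseteq> O'" using \<open>open O'\<close> open_contains_cball by blast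
    then show "\<exists>e>0. cball x e \<subseteq> O' \<and> uniform_limit (cball x e) (\<lambda>n z. \<Sum>i<n. T i z) g sequentially"
      using uniform_limit_on_subset[OF ul] by blast
  qed
  then have gan: "g analytic_on {b}"
    using d by (auto simp: analytic_on_def O'_def)
  have "\<forall>\<^sub>F z in nhds b. z \<in> O'" using d unfolding O'_def by (intro eventually_nhds_in_open) auto
  then have "\<forall>\<^sub>F z in nhds b. \<forall>x y. u z = of_real x \<longrightarrow> w z = of_real y \<longrightarrow> g z = f (Complex x y)"
  proof eventually_elim
    case (elim z)
    show ?case
    proof (intro allI impI)
      \<comment> \<open>Both coordinate increments were kept below \<open>t / 2\<close>, so the
        triangle inequality puts \<open>Complex x y\<close> into the ball where the series
        represents \<open>f\<close>.\<close>
      fix x y assume xy: "u z = of_real x" "w z = of_real y"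
      have UWz: "U z = of_real (x - Re a)" "W z = of_real (y - Im a)" by (simp_all add: U_def W_def xy)
      have "norm (Complex x y - a) \<le> \<bar>x - Re a\<bar> + \<bar>y - Im a\<bar>"
        using cmod_le[of "Complex x y - a"] by simp
      also have "\<dots> < t" using small(3,4)[OF elim] unfolding UWz norm_of_real by linarith
      finally have "Complex x y \<in> ball a t" by (simp add: dist_norm norm_minus_commute)
      from t(3)[OF this] show "g z = f (Complex x y)" by (simp add: g_def UWz)
    qed
  qed
  with gan show ?thesis by (rule that)
qed

subsection \<open>Analytic continuation from the circle\<close>

lemma inverse_cnj_circle: "norm z = 1 \<Longrightarrow> inverse (cnj z) = z"
  using complex_norm_square[of z] by (simp add: inverse_unique mult.commute)

text \<open>The reflection z to 1 / cnj z fixes the circle pointwise, and the outer conjugation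
  restores holomorphy. The result continues the conjugate of \<open>h\<close> off the
  circle.\<close>

lemma analytic_on_sphere_reflect:
  assumes "h analytic_on sphere 0 1"
  shows "(\<lambda>z. cnj (h (inverse (cnj z)))) analytic_on sphere 0 1"
proof -
  have "(h \<circ> inverse) analytic_on sphere 0 1"
  proof (rule analytic_on_compose)
    show "inverse analytic_on sphere (0::complex) 1"
      by (intro analytic_intros) auto
    show "h analytic_on inverse ` sphere 0 1"
      by (rule analytic_on_subset[OF assms]) (auto simp: norm_inverse)
  qed
  then obtain e where e: "e > 0" "e < 1" "(h \<circ> inverse) holomorphic_on {z. \<bar>norm z - 1\<bar> < e}"
    using analytic_on_sphere_holomorphic by blast
  define A where "A = {z::complex. \<bar>norm z - 1\<bar> < e}"
  have "open A" unfolding A_def by (intro open_Collect_less continuous_intros)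
  have "cnj ` A = A" unfolding A_def by (auto simp: image_iff intro!: exI[of _ "cnj _"])
  then have "(cnj \<circ> (h \<circ> inverse) \<circ> cnj) holomorphic_on A"
    using e(3) \<open>open A\<close> by (intro holomorphic_on_compose_cnj_cnj) (simp_all add: A_def)
  then have "(\<lambda>z. cnj (h (inverse (cnj z)))) holomorphic_on A" by (simp add: o_def)
  moreover have "sphere 0 1 \<subseteq> A" using e by (auto simp: A_def)
  ultimately show ?thesis using \<open>open A\<close> by (auto simp: analytic_on_holomorphic)
qed

lemma circle_analytic_cnj:
  assumes "h analytic_on sphere 0 1"
  shows "circle_analytic (\<lambda>z. cnj (h z))"
  unfolding circle_analytic_def using analytic_on_sphere_reflect[OF assms]
  by (intro exI[of _ "\<lambda>z. cnj (h (inverse (cnj z)))"]) (auto simp: inverse_cnj_circle)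

text \<open>Near the circle the germs are glued by evaluating, at each point, the one centred at its
  radial projection.\<close>

lemma circle_analytic_patch:
  assumes loc: "\<And>b. norm b = 1 \<Longrightarrow> \<exists>g. g analytic_on {b} \<and> (\<forall>\<^sub>F z in nhds b. norm z = 1 \<longrightarrow> g z = k z)"
  shows "circle_analytic k"
proof -
  define C where "C = {B. open B \<and> (\<exists>g. g holomorphic_on B \<and> (\<forall>z\<in>B. norm z = 1 \<longrightarrow> g z = k z))}"
  have "sphere 0 1 \<subseteq> \<Union>C"
  proof
    fix b :: complex assume "b \<in> sphere 0 1"
    then obtain g where g: "g analytic_on {b}" "\<forall>\<^sub>F z in nhds b. norm z = 1 \<longrightarrow> g z = k z"
      using loc[of b] by auto
    obtain B1 where B1: "open B1" "b \<in> B1" "g holomorphic_on B1"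
      using g(1) by (auto simp: analytic_at)
    obtain B2 where B2: "open B2" "b \<in> B2" "\<forall>z\<in>B2. norm z = 1 \<longrightarrow> g z = k z"
      using g(2) by (auto simp: eventually_nhds)
    have "B1 \<inter> B2 \<in> C"
      unfolding C_def using B1 B2 holomorphic_on_subset[OF B1(3), of "B1 \<inter> B2"] by blast
    then show "b \<in> \<Union>C" using B1 B2 by blast
  qed
  \<comment> \<open>A Lebesgue number of the cover provides one radius for all centres.\<close>
  then obtain e where e: "e > 0" "\<And>b. b \<in> sphere 0 1 \<Longrightarrow> \<exists>B\<in>C. ball b e \<subseteq> B"
    using Heine_Borel_lemma[OF compact_sphere[of "0::complex" 1], of C] C_def by blast
  have "\<forall>b. \<exists>g. norm b = 1 \<longrightarrow> g holomorphic_on ball b e \<and> (\<forall>z\<in>ball b e. norm z = 1 \<longrightarrow> g z = k z)"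
  proof
    fix b :: complex
    show "\<exists>g. norm b = 1 \<longrightarrow> g holomorphic_on ball b e \<and> (\<forall>z\<in>ball b e. norm z = 1 \<longrightarrow> g z = k z)"
    proof (cases "norm b = 1")
      case True
      then obtain B where B: "B \<in> C" "ball b e \<subseteq> B" using e(2)[of b] by auto
      then obtain g where "g holomorphic_on B" "\<forall>z\<in>B. norm z = 1 \<longrightarrow> g z = k z" unfolding C_def by blast
      then show ?thesis using B(2) holomorphic_on_subset by blast
    qed simp
  qed
  then obtain g where g: "\<And>b. norm b = 1 \<Longrightarrow> g b holomorphic_on ball b e"
    "\<And>b z. norm b = 1 \<Longrightarrow> z \<in> ball b e \<Longrightarrow> norm z = 1 \<Longrightarrow> g b z = k z"
    by metis
  define h where "h z = g (sgn z) z" for z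
  have "h analytic_on {b}" if b: "norm b = 1" for b
  proof -
    \<comment> \<open>With e/4, a point z near b and its projection s are close enough for z and s
      to lie in the balls of radius \<open>e\<close> about both b and s.\<close>
    define d where "d = min (e / 4) (1 / 2)"
    have d: "d > 0" "d \<le> e / 4" "d < 1" using e by (auto simp: d_def)
    have "g b z = h z" if z: "z \<in> ball b d" for z
    proof -
      have nz: "z \<noteq> 0" using z b d by (auto simp: dist_norm)
      define s where "s = sgn z"
      have s: "norm s = 1" using nz by (simp add: s_def norm_sgn)
      have "\<bar>norm z - 1\<bar> \<le> norm (z - b)" using norm_triangle_ineq3[of z b] b by simp
      then have zs: "dist z s < e / 4" unfolding s_def dist_sgn[OF nz] using z d by (auto simp: dist_norm norm_minus_commute)
      have zb: "dist z b < e / 4" using z d by (simp add: dist_commute)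
      have sb: "dist s b < e / 2" using dist_triangle[of s b z] zs zb by (simp add: dist_commute)
      \<comment> \<open>The overlap is convex and contains an arc of the circle around s on which
        both germs equal \<open>k\<close>; the identity theorem makes them agree at z.\<close>
      define O' where "O' = ball s e \<inter> ball b e"
      have O': "open O'" "connected O'" "s \<in> O'" "z \<in> O'"
        unfolding O'_def using sb zs zb e by (auto intro!: convex_connected convex_Int simp: dist_commute)
      have hol: "(\<lambda>w. g s w - g b w) holomorphic_on O'"
        unfolding O'_def using g(1)[OF s] g(1)[OF b]
        by (intro holomorphic_intros) (auto elim!: holomorphic_on_subset)
      have lim: "s islimpt (sphere 0 1 \<inter> O')"
        using islimpt_unit_circle[OF s] O'
        by (intro islimpt_Int_eventually) (auto intro: eventually_at_in_open' )
      have "g s z - g b z = 0"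
        by (rule analytic_continuation[OF hol O'(1,2) _ O'(3) lim _ O'(4)])
          (use g(2)[OF s] g(2)[OF b] in \<open>auto simp: O'_def\<close>)
      then show ?thesis by (simp add: h_def s_def)
    qed
    moreover have "g b holomorphic_on ball b d"
      using g(1)[OF b] d e by (elim holomorphic_on_subset) auto
    ultimately have "h holomorphic_on ball b d" using holomorphic_transform by blast
    then show ?thesis using d by (auto simp: analytic_on_def)
  qed
  then have "h analytic_on sphere 0 1" by (subst analytic_on_analytic_at) auto
  moreover have "k z = h z" if "norm z = 1" for z
  proof -
    have "sgn z = z" using that by (simp add: sgn_div_norm)
    then show ?thesis using g(2)[OF that _ that] e(1) by (simp add: h_def)
  qed
  ultimately show ?thesis unfolding circle_analytic_def by blast
qed

text \<open>The reflected function \<theta> continues the conjugate of \<psi>, so the real and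
  imaginary parts of \<psi> on the circle have the holomorphic continuations \<open>u\<close> and
  \<open>w\<close>, which can be inserted into the double series of \<open>f\<close>.\<close>

lemma circle_analytic_real_analytic_comp:
  assumes f: "real_analytic_on f S" and \<psi>: "\<psi> analytic_on sphere 0 1" "\<psi> ` sphere 0 1 \<subseteq> S"
  shows "circle_analytic (\<lambda>z. f (\<psi> z))"
proof (rule circle_analytic_patch)
  fix b :: complex assume b: "norm b = 1"
  define \<theta> where "\<theta> z = cnj (\<psi> (inverse (cnj z)))" for z
  have \<theta>: "\<theta> analytic_on sphere 0 1" unfolding \<theta>_def by (rule analytic_on_sphere_reflect[OF \<psi>(1)])
  have \<theta>c: "\<theta> z = cnj (\<psi> z)" if "norm z = 1" for z using inverse_cnj_circle[OF that] by (simp add: \<theta>_def)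
  define u where "u z = (\<psi> z + \<theta> z) / 2" for z
  define w where "w z = (\<psi> z - \<theta> z) / (2 * \<i>)" for z
  have an: "\<psi> analytic_on {b}" "\<theta> analytic_on {b}"
    using \<psi>(1) \<theta> b by (auto elim!: analytic_on_subset)
  have uw: "u analytic_on {b}" "w analytic_on {b}"
    unfolding u_def w_def using an by (auto intro!: analytic_intros)
  have on: "u z = of_real (Re (\<psi> z))" "w z = of_real (Im (\<psi> z))" if "norm z = 1" for z
    unfolding u_def w_def \<theta>c[OF that] by (auto simp: complex_eq_iff)
  have "\<psi> b \<in> S" using \<psi>(2) b by auto
  then obtain g where g: "g analytic_on {b}"
    "\<forall>\<^sub>F z in nhds b. \<forall>x y. u z = of_real x \<longrightarrow> w z = of_real y \<longrightarrow> g z = f (Complex x y)"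
    using real_analytic_complexify[OF f _ uw(1) on(1)[OF b] uw(2) on(2)[OF b]] by blast
  from g(2) have "\<forall>\<^sub>F z in nhds b. norm z = 1 \<longrightarrow> g z = f (\<psi> z)"
    by eventually_elim (simp add: on)
  with g(1) show "\<exists>g. g analytic_on {b} \<and> (\<forall>\<^sub>F z in nhds b. norm z = 1 \<longrightarrow> g z = f (\<psi> z))" by blast
qed

lemma circle_analytic_add: "circle_analytic f \<Longrightarrow> circle_analytic g \<Longrightarrow> circle_analytic (\<lambda>z. f z + g z)"
  unfolding circle_analytic_def by (metis (no_types, lifting) analytic_on_add)

lemma circle_analytic_mult: "circle_analytic f \<Longrightarrow> circle_analytic g \<Longrightarrow> circle_analytic (\<lambda>z. f z * g z)"
  unfolding circle_analytic_def by (metis (no_types, lifting) analytic_on_mult)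

subsection \<open>A differential algebra of germs along the circle\<close>

text \<open>This class of germs contains everything that the iterates of \<^const>\<open>op_T\<close> produce. Its members
  have derivatives in the class, and their restrictions to the circle extend holomorphically; closure
  of real-analyticity under general composition is never needed.\<close>

inductive circle_germ :: "(complex \<Rightarrow> complex) \<Rightarrow> complex set \<Rightarrow> (complex \<Rightarrow> complex) \<Rightarrow> bool"
  for \<psi> S where
  hol: "f analytic_on sphere 0 1 \<Longrightarrow> circle_germ \<psi> S f"
| cnj: "f analytic_on sphere 0 1 \<Longrightarrow> circle_germ \<psi> S (\<lambda>z. cnj (f z))"
| comp: "real_analytic_on f S \<Longrightarrow> circle_germ \<psi> S (\<lambda>z. f (\<psi> z))"
| add: "circle_germ \<psi> S f \<Longrightarrow> circle_germ \<psi> S g \<Longrightarrow> circle_germ \<psi> S (\<lambda>z. f z + g z)"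
| mult: "circle_germ \<psi> S f \<Longrightarrow> circle_germ \<psi> S g \<Longrightarrow> circle_germ \<psi> S (\<lambda>z. f z * g z)"
| germ: "circle_germ \<psi> S f \<Longrightarrow> near (sphere 0 1) (\<lambda>z. f z = g z) \<Longrightarrow> circle_germ \<psi> S g"

lemma circle_germ_const: "circle_germ \<psi> S (\<lambda>_. c)"
  by (rule circle_germ.hol) (rule analytic_on_const)

lemma circle_germ_id: "circle_germ \<psi> S (\<lambda>z. z)"
  by (rule circle_germ.hol) (rule analytic_on_ident)

lemma circle_germ_cmult: "circle_germ \<psi> S f \<Longrightarrow> circle_germ \<psi> S (\<lambda>z. c * f z)"
  using circle_germ.mult[OF circle_germ_const] .

lemma circle_germ_sum:
  "finite I \<Longrightarrow> (\<And>i. i \<in> I \<Longrightarrow> circle_germ \<psi> S (f i)) \<Longrightarrow> circle_germ \<psi> S (\<lambda>z. \<Sum>i\<in>I. f i z)"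
  by (induction I rule: finite_induct) (auto intro: circle_germ_const circle_germ.add)

lemma circle_germ_circle_analytic:
  assumes \<psi>: "\<psi> analytic_on sphere 0 1" "\<psi> ` sphere 0 1 \<subseteq> S" and "circle_germ \<psi> S f"
  shows "circle_analytic f"
  using assms(3)
proof induction
  case (hol f)
  then show ?case unfolding circle_analytic_def by blast
next
  case (germ f g)
  have "f z = g z" if "norm z = 1" for z using nearD[OF germ(2), of z] that by simp
  then show ?case using germ.IH by (simp add: circle_analytic_def)
qed (simp_all add: circle_analytic_cnj circle_analytic_real_analytic_comp[OF _ \<psi>]
    circle_analytic_add circle_analytic_mult)

text \<open>\<open>a\<close> and \<open>b\<close> are the two Wirtinger derivatives of a
  real-differentiable function. The total differential yields product and chain rules as well as
  derivatives along curves, which two axis directions alone would not give.\<close>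

definition has_wirtinger :: "(complex \<Rightarrow> complex) \<Rightarrow> complex \<Rightarrow> complex \<Rightarrow> complex \<Rightarrow> bool" where
  "has_wirtinger f a b z \<longleftrightarrow> (f has_derivative (\<lambda>h. a * h + b * cnj h)) (at z)"

lemma has_wirtinger_holomorphic:
  "(f has_field_derivative a) (at z) \<Longrightarrow> has_wirtinger f a 0 z"
  unfolding has_wirtinger_def has_field_derivative_def by simp

lemma has_wirtinger_cnj:
  assumes "has_wirtinger f a b z"
  shows "has_wirtinger (\<lambda>z. cnj (f z)) (cnj b) (cnj a) z"
  unfolding has_wirtinger_def
  by (rule has_derivative_eq_rhs[OF has_derivative_cnj[OF assms[unfolded has_wirtinger_def]]])
    (simp add: fun_eq_iff add.commute)

lemma has_wirtinger_add:
  assumes "has_wirtinger f a b z" "has_wirtinger g c d z"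
  shows "has_wirtinger (\<lambda>z. f z + g z) (a + c) (b + d) z"
  using has_derivative_add[OF assms[unfolded has_wirtinger_def]]
  unfolding has_wirtinger_def by (rule has_derivative_eq_rhs) (simp add: fun_eq_iff algebra_simps)

lemma has_wirtinger_mult:
  assumes "has_wirtinger f a b z" "has_wirtinger g c d z"
  shows "has_wirtinger (\<lambda>z. f z * g z) (f z * c + a * g z) (f z * d + b * g z) z"
  using has_derivative_mult[OF assms[unfolded has_wirtinger_def]]
  unfolding has_wirtinger_def by (rule has_derivative_eq_rhs) (simp add: fun_eq_iff algebra_simps)

lemma has_wirtinger_cong:
  assumes "has_wirtinger f a b z" "\<forall>\<^sub>F w in nhds z. f w = g w"
  shows "has_wirtinger g a b z"
proof -
  have "\<forall>\<^sub>F w in at z. f w = g w"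
    using assms(2) by (auto simp: eventually_at_filter elim: eventually_mono)
  from has_derivative_transform_eventually[OF assms(1)[unfolded has_wirtinger_def] this
      eventually_nhds_x_imp_x[OF assms(2)]]
  show ?thesis by (simp add: has_wirtinger_def)
qed

lemma has_wirtinger_exp:
  assumes "has_wirtinger f a b z"
  shows "has_wirtinger (\<lambda>z. exp (f z)) (exp (f z) * a) (exp (f z) * b) z"
proof -
  have "(exp has_derivative (\<lambda>h. exp (f z) * h)) (at (f z))"
    using DERIV_exp[of "f z"] by (simp add: has_field_derivative_def)
  from diff_chain_at[OF assms[unfolded has_wirtinger_def] this] show ?thesis
    unfolding has_wirtinger_def o_def by (rule has_derivative_eq_rhs) (simp add: fun_eq_iff algebra_simps)
qed

text \<open>The quotients (fx - i fy) / 2 and (fx + i fy) / 2 are the Wirtinger derivatives of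
  \<open>f\<close>; an inner holomorphic map multiplies them by its derivative and by the conjugate
  of it.\<close>

lemma has_wirtinger_comp:
  assumes f: "(f has_derivative (\<lambda>h. of_real (Re h) * fx + of_real (Im h) * fy)) (at (\<psi> z))"
    and \<psi>: "(\<psi> has_field_derivative d) (at z)"
  shows "has_wirtinger (\<lambda>z. f (\<psi> z)) ((fx - \<i> * fy) / 2 * d) ((fx + \<i> * fy) / 2 * cnj d) z"
proof -
  have R: "of_real (Re w) = (w + cnj w) / 2" "of_real (Im w) = (w - cnj w) / (2 * \<i>)" for w :: complex
    by (auto simp: complex_eq_iff)
  show ?thesis
    using diff_chain_at[OF \<psi>[unfolded has_field_derivative_def] f]
    unfolding has_wirtinger_def o_def R
    by (rule has_derivative_eq_rhs) (simp add: fun_eq_iff field_simps)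
qed

lemma has_wirtinger_isCont: "has_wirtinger f a b z \<Longrightarrow> isCont f z"
  unfolding has_wirtinger_def by (rule has_derivative_continuous)

lemma wirtinger_dz_eq:
  assumes "has_wirtinger f a b z"
  shows "wirtinger_dz f z = a"
proof -
  have d: "((\<lambda>t. f (z + c * of_real t)) has_vector_derivative (a * c + b * cnj c)) (at 0)" for c
  proof -
    have "((\<lambda>t. z + c * of_real t) has_derivative (\<lambda>t. c * of_real t)) (at (0::real))"
      by (auto intro!: derivative_eq_intros)
    moreover have "(f has_derivative (\<lambda>h. a * h + b * cnj h)) (at (z + c * of_real 0))"
      using assms by (simp add: has_wirtinger_def)
    ultimately have "((f \<circ> (\<lambda>t. z + c * of_real t)) has_derivative
        ((\<lambda>h. a * h + b * cnj h) \<circ> (\<lambda>t. c * of_real t))) (at (0::real))"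
      by (rule diff_chain_at)
    then show ?thesis
      unfolding has_vector_derivative_def o_def
      by (rule has_derivative_eq_rhs) (simp add: fun_eq_iff scaleR_conv_of_real algebra_simps)
  qed
  have 1: "vector_derivative (\<lambda>x. f (z + of_real x)) (at 0) = a + b"
    using vector_derivative_at[OF d[of 1]] by simp
  have 2: "vector_derivative (\<lambda>y. f (z + \<i> * of_real y)) (at 0) = \<i> * (a - b)"
    using vector_derivative_at[OF d[of \<i>]] by (simp add: algebra_simps)
  show ?thesis unfolding wirtinger_dz_def 1 2 by (simp flip: mult.assoc)
qed

text \<open>Each generating clause is closed under differentiation; for compositions with \<psi>
  this rests on the partial derivatives of a real-analytic function being real-analytic.\<close>

lemma circle_germ_deriv:
  assumes S: "open S" and \<psi>: "\<psi> analytic_on sphere 0 1" "\<psi> ` sphere 0 1 \<subseteq> S" and f: "circle_germ \<psi> S f"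
  shows "\<exists>a b. circle_germ \<psi> S a \<and> circle_germ \<psi> S b \<and> near (sphere 0 1) (\<lambda>z. has_wirtinger f (a z) (b z) z)"
  using f
proof induction
  case (hol f)
  have "near (sphere 0 1) (\<lambda>z. has_wirtinger f (deriv f z) 0 z)"
  proof -
    obtain G where G: "open G" "sphere 0 1 \<subseteq> G" "f holomorphic_on G"
      using hol by (auto simp: analytic_on_holomorphic)
    then show ?thesis unfolding near_def
      by (intro exI[of _ G]) (auto intro!: has_wirtinger_holomorphic holomorphic_derivI)
  qed
  then show ?case
    using circle_germ.hol[OF analytic_deriv[OF hol]] circle_germ_const[of \<psi> S 0] by blast
next
  case (cnj f)
  have "near (sphere 0 1) (\<lambda>z. has_wirtinger (\<lambda>z. cnj (f z)) 0 (cnj (deriv f z)) z)"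
  proof -
    obtain G where G: "open G" "sphere 0 1 \<subseteq> G" "f holomorphic_on G"
      using cnj by (auto simp: analytic_on_holomorphic)
    have "has_wirtinger (\<lambda>z. cnj (f z)) 0 (cnj (deriv f z)) z" if "z \<in> G" for z
      using has_wirtinger_cnj[OF has_wirtinger_holomorphic[OF holomorphic_derivI[OF G(3,1) that]]] by simp
    then show ?thesis unfolding near_def using G by blast
  qed
  then show ?case
    using circle_germ.cnj[OF analytic_deriv[OF cnj]] circle_germ_const[of \<psi> S 0] by blast
next
  case (comp f)
  note D = real_analytic_has_derivative[OF comp]
  obtain G where G: "open G" "sphere 0 1 \<subseteq> G" "\<psi> holomorphic_on G"
    using \<psi>(1) by (auto simp: analytic_on_holomorphic)
  define G' where "G' = G \<inter> \<psi> -` S"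
  have G': "open G'" "sphere 0 1 \<subseteq> G'"
    unfolding G'_def using continuous_open_preimage[OF holomorphic_on_imp_continuous_on[OF G(3)] G(1) S] G(2) \<psi>(2)
    by auto
  define a where "a z = (real_dx f (\<psi> z) + (- \<i>) * real_dy f (\<psi> z)) * ((1/2) * deriv \<psi> z)" for z
  define b where "b z = (real_dx f (\<psi> z) + \<i> * real_dy f (\<psi> z)) * ((1/2) * cnj (deriv \<psi> z))" for z
  have "has_wirtinger (\<lambda>z. f (\<psi> z)) (a z) (b z) z" if z: "z \<in> G'" for z
  proof -
    have zG: "z \<in> G" "\<psi> z \<in> S" using z by (auto simp: G'_def)
    have "has_wirtinger (\<lambda>z. f (\<psi> z)) ((real_dx f (\<psi> z) - \<i> * real_dy f (\<psi> z)) / 2 * deriv \<psi> z)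
       ((real_dx f (\<psi> z) + \<i> * real_dy f (\<psi> z)) / 2 * cnj (deriv \<psi> z)) z"
      by (rule has_wirtinger_comp[OF D(3)[OF zG(2)] holomorphic_derivI[OF G(3,1) zG(1)]])
    then show ?thesis by (simp add: a_def b_def)
  qed
  then have "near (sphere 0 1) (\<lambda>z. has_wirtinger (\<lambda>z. f (\<psi> z)) (a z) (b z) z)"
    unfolding near_def using G' by blast
  moreover have "circle_germ \<psi> S a" "circle_germ \<psi> S b"
    unfolding a_def[abs_def] b_def[abs_def]
    by (intro circle_germ.add circle_germ.mult circle_germ_const circle_germ.comp[OF D(1)]
        circle_germ.comp[OF D(2)] circle_germ.hol[OF analytic_deriv[OF \<psi>(1)]]
        circle_germ.cnj[OF analytic_deriv[OF \<psi>(1)]])+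
  ultimately show ?case by blast
next
  case (add f g)
  then obtain a b c d where *: "circle_germ \<psi> S a" "circle_germ \<psi> S b" "circle_germ \<psi> S c" "circle_germ \<psi> S d"
    "near (sphere 0 1) (\<lambda>z. has_wirtinger f (a z) (b z) z)" "near (sphere 0 1) (\<lambda>z. has_wirtinger g (c z) (d z) z)"
    by blast
  have "near (sphere 0 1) (\<lambda>z. has_wirtinger (\<lambda>z. f z + g z) (a z + c z) (b z + d z) z)"
    using *(5,6) by (rule near_elim2) (rule has_wirtinger_add)
  moreover have "circle_germ \<psi> S (\<lambda>z. a z + c z)" "circle_germ \<psi> S (\<lambda>z. b z + d z)"
    by (intro circle_germ.add *)+
  ultimately show ?case
    by (rule_tac exI[of _ "\<lambda>z. a z + c z"], rule_tac exI[of _ "\<lambda>z. b z + d z"]) blast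
next
  case (mult f g)
  then obtain a b c d where *: "circle_germ \<psi> S a" "circle_germ \<psi> S b" "circle_germ \<psi> S c" "circle_germ \<psi> S d"
    "near (sphere 0 1) (\<lambda>z. has_wirtinger f (a z) (b z) z)" "near (sphere 0 1) (\<lambda>z. has_wirtinger g (c z) (d z) z)"
    by blast
  have "near (sphere 0 1) (\<lambda>z. has_wirtinger (\<lambda>z. f z * g z) (f z * c z + a z * g z) (f z * d z + b z * g z) z)"
    using *(5,6) by (rule near_elim2) (rule has_wirtinger_mult)
  moreover have "circle_germ \<psi> S (\<lambda>z. f z * c z + a z * g z)" "circle_germ \<psi> S (\<lambda>z. f z * d z + b z * g z)"
    by (intro circle_germ.add circle_germ.mult * mult.hyps)+
  ultimately show ?case
    by (rule_tac exI[of _ "\<lambda>z. f z * c z + a z * g z"], rule_tac exI[of _ "\<lambda>z. f z * d z + b z * g z"]) blast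
next
  case (germ f g)
  then obtain a b where *: "circle_germ \<psi> S a" "circle_germ \<psi> S b"
    "near (sphere 0 1) (\<lambda>z. has_wirtinger f (a z) (b z) z)" by blast
  have "near (sphere 0 1) (\<lambda>z. has_wirtinger g (a z) (b z) z)"
    unfolding near_iff
  proof
    \<comment> \<open>Equality near the circle holds in a neighbourhood of every nearby point, which
      is what transferring a derivative requires.\<close>
    fix x :: complex assume x: "x \<in> sphere 0 1"
    have "\<forall>\<^sub>F z in nhds x. \<forall>\<^sub>F w in nhds z. f w = g w"
      using germ(2) x unfolding near_iff by (simp add: eventually_eventually)
    moreover have "\<forall>\<^sub>F z in nhds x. has_wirtinger f (a z) (b z) z" using *(3) x unfolding near_iff by blast
    ultimately show "\<forall>\<^sub>F z in nhds x. has_wirtinger g (a z) (b z) z"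
      by eventually_elim (rule has_wirtinger_cong)
  qed
  with * show ?case by blast
qed

subsection \<open>The operator T on germs\<close>

text \<open>With \<Omega> = exp \<rho> the division by \<open>\<Omega>\<close> cancels: T becomes a
  first-order operator whose only extra coefficient is z times the derivative of \<rho>.\<close>

lemma op_T_eq:
  assumes f: "has_wirtinger f a b z" and \<rho>: "has_wirtinger \<rho> r s z"
    and \<Omega>: "\<forall>\<^sub>F w in nhds z. complex_of_real (\<Omega> w) = exp (\<rho> w)"
  shows "op_T \<Omega> f z = z * a + f z + z * r * f z"
    "has_wirtinger (\<lambda>w. f w * of_real (\<Omega> w)) ((a + r * f z) * of_real (\<Omega> z)) ((b + s * f z) * of_real (\<Omega> z)) z"
proof -
  have \<Omega>z: "complex_of_real (\<Omega> z) = exp (\<rho> z)" using \<Omega> by (rule eventually_nhds_x_imp_x)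
  have "has_wirtinger (\<lambda>w. f w * exp (\<rho> w)) ((a + r * f z) * of_real (\<Omega> z)) ((b + s * f z) * of_real (\<Omega> z)) z"
    using has_wirtinger_mult[OF f has_wirtinger_exp[OF \<rho>]] unfolding \<Omega>z by (simp add: algebra_simps)
  then show *: "has_wirtinger (\<lambda>w. f w * of_real (\<Omega> w)) ((a + r * f z) * of_real (\<Omega> z)) ((b + s * f z) * of_real (\<Omega> z)) z"
    by (rule has_wirtinger_cong) (use \<Omega> in eventually_elim, simp)
  have "complex_of_real (\<Omega> z) \<noteq> 0" unfolding \<Omega>z by simp
  then show "op_T \<Omega> f z = z * a + f z + z * r * f z"
    unfolding op_T_def wirtinger_dz_eq[OF *] by (simp add: field_simps)
qed

text \<open>The weight enters through its logarithm \<rho>, because \<open>circle_germ\<close> has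
  clauses for sums and products but none for exponentials or quotients.\<close>

locale circle_weight =
  fixes \<psi> :: "complex \<Rightarrow> complex" and S :: "complex set" and \<Omega> :: "complex \<Rightarrow> real" and \<rho> :: "complex \<Rightarrow> complex"
  assumes S: "open S" and \<psi>: "\<psi> analytic_on sphere 0 1" "\<psi> ` sphere 0 1 \<subseteq> S"
    and \<rho>: "circle_germ \<psi> S \<rho>" and \<Omega>: "near (sphere 0 1) (\<lambda>z. complex_of_real (\<Omega> z) = exp (\<rho> z))"
begin

lemma \<Omega>_eventually: "near (sphere 0 1) (\<lambda>z. \<forall>\<^sub>F w in nhds z. complex_of_real (\<Omega> w) = exp (\<rho> w))"
  using \<Omega> unfolding near_iff by (simp add: eventually_eventually)

text \<open>The second part displays the derivative of f \<Omega> as a germ times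
  \<open>\<Omega>\<close>, together with its relation to T; the Green formula is applied in this
  form.\<close>

lemma op_T_germ:
  assumes f: "circle_germ \<psi> S f"
  shows "circle_germ \<psi> S (op_T \<Omega> f)"
    and "\<exists>a b. circle_germ \<psi> S a \<and> circle_germ \<psi> S b \<and>
      near (sphere 0 1) (\<lambda>z. has_wirtinger (\<lambda>w. f w * of_real (\<Omega> w)) (a z * of_real (\<Omega> z)) (b z * of_real (\<Omega> z)) z \<and>
        op_T \<Omega> f z = z * a z + f z)"
proof -
  obtain a b where ab: "circle_germ \<psi> S a" "circle_germ \<psi> S b"
    "near (sphere 0 1) (\<lambda>z. has_wirtinger f (a z) (b z) z)" using circle_germ_deriv[OF S \<psi> f] by blast
  obtain r s where rs: "circle_germ \<psi> S r" "circle_germ \<psi> S s"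
    "near (sphere 0 1) (\<lambda>z. has_wirtinger \<rho> (r z) (s z) z)" using circle_germ_deriv[OF S \<psi> \<rho>] by blast
  have *: "near (sphere 0 1) (\<lambda>z. has_wirtinger (\<lambda>w. f w * of_real (\<Omega> w)) ((a z + r z * f z) * of_real (\<Omega> z)) ((b z + s z * f z) * of_real (\<Omega> z)) z \<and>
        op_T \<Omega> f z = z * (a z + r z * f z) + f z)"
    unfolding near_iff
  proof
    fix x :: complex assume x: "x \<in> sphere 0 1"
    have "\<forall>\<^sub>F z in nhds x. has_wirtinger f (a z) (b z) z" "\<forall>\<^sub>F z in nhds x. has_wirtinger \<rho> (r z) (s z) z"
      "\<forall>\<^sub>F z in nhds x. \<forall>\<^sub>F w in nhds z. complex_of_real (\<Omega> w) = exp (\<rho> w)"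
      using ab(3) rs(3) \<Omega>_eventually x unfolding near_iff by blast+
    then show "\<forall>\<^sub>F z in nhds x. has_wirtinger (\<lambda>w. f w * of_real (\<Omega> w)) ((a z + r z * f z) * of_real (\<Omega> z)) ((b z + s z * f z) * of_real (\<Omega> z)) z \<and>
        op_T \<Omega> f z = z * (a z + r z * f z) + f z"
    proof eventually_elim
      case (elim z)
      show ?case using op_T_eq[OF elim] by (simp add: algebra_simps)
    qed
  qed
  have g: "circle_germ \<psi> S (\<lambda>z. a z + r z * f z)" "circle_germ \<psi> S (\<lambda>z. b z + s z * f z)"
    by (intro circle_germ.add circle_germ.mult ab rs f)+
  show "\<exists>a b. circle_germ \<psi> S a \<and> circle_germ \<psi> S b \<and>
      near (sphere 0 1) (\<lambda>z. has_wirtinger (\<lambda>w. f w * of_real (\<Omega> w)) (a z * of_real (\<Omega> z)) (b z * of_real (\<Omega> z)) z \<and>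
        op_T \<Omega> f z = z * a z + f z)"
    by (rule exI[of _ "\<lambda>z. a z + r z * f z"], rule exI[of _ "\<lambda>z. b z + s z * f z"]) (use g * in blast)
  have "circle_germ \<psi> S (\<lambda>z. z * (a z + r z * f z) + f z)"
    by (rule circle_germ.add[OF circle_germ.mult[OF circle_germ_id g(1)] f])
  then show "circle_germ \<psi> S (op_T \<Omega> f)"
    by (rule circle_germ.germ) (use * in \<open>rule near_mono, simp\<close>)
qed

lemma op_T_pow_germ: "circle_germ \<psi> S f \<Longrightarrow> circle_germ \<psi> S ((op_T \<Omega> ^^ k) f)"
  by (induction k) (auto intro: op_T_germ)

text \<open>T differentiates, so agreement of \<open>h\<close> with the combination is required on a
  neighbourhood of the circle. Taking c = 1 and d = 0 later gives invariance of T under equality of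
  germs.\<close>

lemma op_T_linear:
  assumes f: "circle_germ \<psi> S f" and g: "circle_germ \<psi> S g"
    and h: "near (sphere 0 1) (\<lambda>z. h z = c * f z + d * g z)"
  shows "near (sphere 0 1) (\<lambda>z. op_T \<Omega> h z = c * op_T \<Omega> f z + d * op_T \<Omega> g z)"
proof -
  obtain a b where ab: "near (sphere 0 1) (\<lambda>z. has_wirtinger f (a z) (b z) z)"
    using circle_germ_deriv[OF S \<psi> f] by blast
  obtain a' b' where ab': "near (sphere 0 1) (\<lambda>z. has_wirtinger g (a' z) (b' z) z)"
    using circle_germ_deriv[OF S \<psi> g] by blast
  obtain r s where rs: "near (sphere 0 1) (\<lambda>z. has_wirtinger \<rho> (r z) (s z) z)"
    using circle_germ_deriv[OF S \<psi> \<rho>] by blast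
  show ?thesis unfolding near_iff
  proof
    fix x :: complex assume x: "x \<in> sphere 0 1"
    have "\<forall>\<^sub>F z in nhds x. has_wirtinger f (a z) (b z) z" "\<forall>\<^sub>F z in nhds x. has_wirtinger g (a' z) (b' z) z"
      "\<forall>\<^sub>F z in nhds x. has_wirtinger \<rho> (r z) (s z) z"
      "\<forall>\<^sub>F z in nhds x. \<forall>\<^sub>F w in nhds z. complex_of_real (\<Omega> w) = exp (\<rho> w)"
      "\<forall>\<^sub>F z in nhds x. \<forall>\<^sub>F w in nhds z. h w = c * f w + d * g w"
      using ab ab' rs \<Omega>_eventually h x unfolding near_iff by (simp_all add: eventually_eventually)
    then show "\<forall>\<^sub>F z in nhds x. op_T \<Omega> h z = c * op_T \<Omega> f z + d * op_T \<Omega> g z"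
    proof eventually_elim
      case (elim z)
      have w0: "has_wirtinger (\<lambda>_. e) 0 0 z" for e
        by (rule has_wirtinger_holomorphic) simp
      have "has_wirtinger (\<lambda>z. c * f z + d * g z) (c * a z + d * a' z) (c * b z + d * b' z) z"
        using has_wirtinger_add[OF has_wirtinger_mult[OF w0[of c] elim(1)] has_wirtinger_mult[OF w0[of d] elim(2)]] by simp
      then have "has_wirtinger h (c * a z + d * a' z) (c * b z + d * b' z) z"
        by (rule has_wirtinger_cong) (use elim(5) in eventually_elim, simp)
      from op_T_eq(1)[OF this elim(3,4)] op_T_eq(1)[OF elim(1,3,4)] op_T_eq(1)[OF elim(2,3,4)]
      show ?case using eventually_nhds_x_imp_x[OF elim(5)] by (simp add: algebra_simps)
    qed
  qed
qed

end

subsection \<open>Integration over thin annuli in polar coordinates\<close>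

definition annulus :: "real \<Rightarrow> complex set" where
  "annulus \<delta> = {z. 1 - \<delta> \<le> norm z \<and> norm z \<le> 1}"

text \<open>The area integral over the collar as an iterated one-dimensional integral, with Jacobian
  r, so that it can be treated by calculus in the radius and the angle separately.\<close>

definition polar_integral :: "real \<Rightarrow> (complex \<Rightarrow> complex) \<Rightarrow> complex" where
  "polar_integral \<delta> G = integral {1-\<delta>..1} (\<lambda>r. integral {0..2*pi} (\<lambda>t. of_real r * G (of_real r * cis t)))"

lemma compact_annulus: "compact (annulus \<delta>)"
proof -
  have "annulus \<delta> = cball 0 1 \<inter> {z. 1 - \<delta> \<le> norm z}" by (auto simp: annulus_def)
  moreover have "closed {z::complex. 1 - \<delta> \<le> norm z}" by (intro closed_Collect_le continuous_intros)
  ultimately show ?thesis by (simp add: compact_Int_closed)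
qed

lemma annulus_mono: "\<delta> \<le> \<delta>' \<Longrightarrow> annulus \<delta> \<subseteq> annulus \<delta>'"
  by (auto simp: annulus_def)

lemma polar_in_annulus:
  assumes "\<delta> \<le> 1" "r \<in> {1-\<delta>..1}"
  shows "of_real r * cis t \<in> annulus \<delta>"
  using assms by (auto simp: annulus_def norm_mult)

lemma near_sphere_imp_annulus:
  assumes "near (sphere 0 1) P"
  shows "\<exists>e>0. e < 1 \<and> (\<forall>z\<in>annulus e. P z)"
proof -
  obtain e where e: "e > 0" "e < 1" "\<forall>z. \<bar>norm z - 1\<bar> < e \<longrightarrow> P z"
    using near_sphere_annulus[OF assms] by blast
  then show ?thesis by (intro exI[of _ "e/2"]) (auto simp: annulus_def)
qed

lemma continuous_on_polar:
  fixes G :: "complex \<Rightarrow> complex"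
  assumes G: "continuous_on (annulus \<delta>) G" and "\<delta> \<le> 1"
  shows "continuous_on ({1-\<delta>..1} \<times> {0..2*pi}) (\<lambda>(r, t). G (of_real r * cis t))"
proof -
  have "continuous_on ({1-\<delta>..1} \<times> {0..2*pi}) (\<lambda>p. G (of_real (fst p) * cis (snd p)))"
    by (rule continuous_on_compose2[OF G])
      (use polar_in_annulus[OF assms(2)] in \<open>auto intro!: continuous_intros\<close>)
  then show ?thesis by (simp add: case_prod_unfold)
qed

lemma polar_inner_continuous:
  fixes G :: "complex \<Rightarrow> complex"
  assumes G: "continuous_on (annulus \<delta>) G" and "\<delta> \<le> 1"
  shows "continuous_on {1-\<delta>..1} (\<lambda>r. integral {0..2*pi} (\<lambda>t. of_real r * G (of_real r * cis t)))"
proof -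
  have "continuous_on ({1-\<delta>..1} \<times> cbox 0 (2*pi)) (\<lambda>(r, t). of_real r * G (of_real r * cis t))"
    using continuous_on_polar[OF assms] by (auto simp: case_prod_unfold intro!: continuous_intros)
  from integral_continuous_on_param[OF this] show ?thesis by simp
qed

lemma polar_inner_integrable:
  fixes G :: "complex \<Rightarrow> complex"
  assumes G: "continuous_on (annulus \<delta>) G" and "\<delta> \<le> 1" and r: "r \<in> {1-\<delta>..1}"
  shows "(\<lambda>t. of_real r * G (of_real r * cis t)) integrable_on {0..2*pi}"
  by (intro integrable_continuous_interval continuous_intros continuous_on_compose2[OF G])
    (use polar_in_annulus[OF assms(2) r] in auto)

lemma polar_integral_cong:
  assumes "\<delta> \<le> 1" "\<And>z. z \<in> annulus \<delta> \<Longrightarrow> G z = H z"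
  shows "polar_integral \<delta> G = polar_integral \<delta> H"
  unfolding polar_integral_def
  by (intro Henstock_Kurzweil_Integration.integral_cong) (simp add: assms polar_in_annulus)

lemma polar_integral_add:
  fixes G :: "complex \<Rightarrow> complex"
  assumes G: "continuous_on (annulus \<delta>) G" and H: "continuous_on (annulus \<delta>) H" and d: "\<delta> \<le> 1"
  shows "polar_integral \<delta> (\<lambda>z. G z + H z) = polar_integral \<delta> G + polar_integral \<delta> H"
proof -
  have "polar_integral \<delta> (\<lambda>z. G z + H z) = integral {1-\<delta>..1} (\<lambda>r.
      integral {0..2*pi} (\<lambda>t. of_real r * G (of_real r * cis t)) + integral {0..2*pi} (\<lambda>t. of_real r * H (of_real r * cis t)))"
    unfolding polar_integral_def
    by (intro Henstock_Kurzweil_Integration.integral_cong)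
      (simp add: distrib_left Henstock_Kurzweil_Integration.integral_add polar_inner_integrable[OF G d] polar_inner_integrable[OF H d])
  also have "\<dots> = polar_integral \<delta> G + polar_integral \<delta> H"
    unfolding polar_integral_def
    by (intro Henstock_Kurzweil_Integration.integral_add integrable_continuous_interval polar_inner_continuous G H d)
  finally show ?thesis .
qed

lemma polar_integral_cmult: "polar_integral \<delta> (\<lambda>z. c * G z) = c * polar_integral \<delta> G"
proof -
  have "integral {0..2*pi} (\<lambda>t. of_real r * (c * G (of_real r * cis t))) =
      c * integral {0..2*pi} (\<lambda>t. of_real r * G (of_real r * cis t))" for r
    by (subst Henstock_Kurzweil_Integration.integral_mult_right[symmetric]) (simp add: mult_ac)
  then show ?thesis unfolding polar_integral_def
    by (simp only: Henstock_Kurzweil_Integration.integral_mult_right)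
qed

lemma polar_integral_sum:
  assumes "finite I" "\<And>i. i \<in> I \<Longrightarrow> continuous_on (annulus \<delta>) (G i)" and d: "\<delta> \<le> 1"
  shows "polar_integral \<delta> (\<lambda>z. \<Sum>i\<in>I. G i z) = (\<Sum>i\<in>I. polar_integral \<delta> (G i))"
  using assms(1,2)
proof (induction I rule: finite_induct)
  case empty
  show ?case by (simp add: polar_integral_def)
next
  case (insert i I)
  then show ?case
    by (simp add: polar_integral_add[OF _ _ d] continuous_on_sum)
qed

text \<open>The radial integral of r^N is at most 1 / (N + 1), whatever the width of the collar.
  This gain is what raises a pointwise error by one order in 1/N.\<close>

lemma polar_integral_bound:
  assumes G: "continuous_on (annulus \<delta>) G" and d: "0 \<le> \<delta>" "\<delta> \<le> 1" and K: "K \<ge> 0"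
    and bd: "\<And>z. z \<in> annulus \<delta> \<Longrightarrow> norm (G z) \<le> K * norm z ^ N"
  shows "norm (polar_integral \<delta> G) \<le> 2 * pi * K / real (N + 1)"
proof -
  have inner: "norm (integral {0..2*pi} (\<lambda>t. of_real r * G (of_real r * cis t))) \<le> 2 * pi * K * r ^ N"
    if r: "r \<in> {1-\<delta>..1}" for r
  proof -
    have r01: "0 \<le> r" "r \<le> 1" using r d by auto
    have "norm (integral {0..2*pi} (\<lambda>t. of_real r * G (of_real r * cis t))) \<le> integral {0..2*pi} (\<lambda>t. K * r ^ N)"
    proof (rule Henstock_Kurzweil_Integration.integral_norm_bound_integral)
      fix t
      have "norm (G (of_real r * cis t)) \<le> K * r ^ N"
        using bd[OF polar_in_annulus[OF d(2) r, of t]] r01 by (simp add: norm_mult)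
      then have "r * norm (G (of_real r * cis t)) \<le> 1 * (K * r ^ N)"
        using r01 K by (intro mult_mono) auto
      then show "norm (of_real r * G (of_real r * cis t)) \<le> K * r ^ N"
        using r01 by (simp add: norm_mult)
    qed (use polar_inner_integrable[OF G d(2) r] in auto)
    then show ?thesis by (simp add: mult_ac)
  qed
  have hi: "((\<lambda>r. 2 * pi * K * r ^ N) has_integral (2 * pi * K * 1 ^ (N+1) / real (N+1) - 2 * pi * K * (1-\<delta>) ^ (N+1) / real (N+1))) {1-\<delta>..1}"
  proof (rule fundamental_theorem_of_calculus)
    fix r assume "r \<in> {1-\<delta>..1}"
    have "((\<lambda>r. 2 * pi * K * r ^ (N+1) / real (N+1)) has_real_derivative 2 * pi * K * (real (N+1) * r ^ N) / real (N+1)) (at r within {1-\<delta>..1})"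
      by (rule derivative_eq_intros refl | simp)+
    moreover have "2 * pi * K * (real (N+1) * r ^ N) / real (N+1) = 2 * pi * K * r ^ N" by simp
    ultimately show "((\<lambda>r. 2 * pi * K * r ^ (N+1) / real (N+1)) has_vector_derivative 2 * pi * K * r ^ N) (at r within {1-\<delta>..1})"
      by (simp only: has_real_derivative_iff_has_vector_derivative)
  qed (use d in auto)
  have "norm (polar_integral \<delta> G) \<le> integral {1-\<delta>..1} (\<lambda>r. 2 * pi * K * r ^ N)"
    unfolding polar_integral_def
    by (intro Henstock_Kurzweil_Integration.integral_norm_bound_integral inner integrable_continuous_interval
        polar_inner_continuous[OF G d(2)] continuous_intros)
  also have "\<dots> = 2 * pi * K * 1 ^ (N+1) / real (N+1) - 2 * pi * K * (1-\<delta>) ^ (N+1) / real (N+1)"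
    using hi by (rule integral_unique)
  also have "\<dots> \<le> 2 * pi * K / real (N + 1)"
    using K d by simp
  finally show ?thesis .
qed

lemma has_wirtinger_path:
  assumes "has_wirtinger g a b (\<gamma> x)" "(\<gamma> has_vector_derivative v) (at x within X)"
  shows "((\<lambda>x. g (\<gamma> x)) has_vector_derivative (a * v + b * cnj v)) (at x within X)"
  using has_derivative_compose[OF assms(2)[unfolded has_vector_derivative_def] assms(1)[unfolded has_wirtinger_def]]
  unfolding has_vector_derivative_def
  by (rule has_derivative_eq_rhs) (simp add: fun_eq_iff scaleR_conv_of_real algebra_simps)

lemma circle_vector_derivatives:
  "((\<lambda>r. of_real r * cis t) has_vector_derivative cis t) (at r within X)"
  "((\<lambda>t. of_real r * cis t) has_vector_derivative (\<i> * (of_real r * cis t))) (at t within Y)"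
  "((\<lambda>t. cis (- t)) has_vector_derivative (- \<i> * cis (- t))) (at t within Y)"
proof -
  have e: "((\<lambda>t. exp (c * of_real t)) has_vector_derivative (c * exp (c * of_real t))) (at t within Y)" for c :: complex
    by (rule has_vector_derivative_real_field) (auto intro!: derivative_eq_intros)
  show "((\<lambda>r. of_real r * cis t) has_vector_derivative cis t) (at r within X)"
    by (auto intro!: derivative_eq_intros simp: has_vector_derivative_def scaleR_conv_of_real)
  show "((\<lambda>t. of_real r * cis t) has_vector_derivative (\<i> * (of_real r * cis t))) (at t within Y)"
    using has_vector_derivative_mult_right[OF e[of \<i>], of "of_real r"]
    by (simp add: cis_conv_exp mult.left_commute)
  show "((\<lambda>t. cis (- t)) has_vector_derivative (- \<i> * cis (- t))) (at t within Y)"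
    using e[of "- \<i>"] by (simp add: cis_conv_exp)
qed

text \<open>Differentiating in the radius under the integral sign and integrating by parts in the angle
  gives the complex Green formula for an annulus.\<close>

lemma green_annulus:
  assumes d: "0 \<le> \<delta>" "\<delta> \<le> 1"
    and g: "\<And>z. z \<in> annulus \<delta> \<Longrightarrow> has_wirtinger g (a z) (b z) z"
    and a: "continuous_on (annulus \<delta>) a" and b: "continuous_on (annulus \<delta>) b"
  shows "2 * polar_integral \<delta> a = integral {0..2*pi} (\<lambda>t. cis (- t) * g (cis t)) -
    of_real (1-\<delta>) * integral {0..2*pi} (\<lambda>t. cis (- t) * g (of_real (1-\<delta>) * cis t))"
proof -
  \<comment> \<open>On the circle of radius r the factor r cis (-t) is the conjugate of z, so this
    is the boundary term of the formula.\<close>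
  define J where "J r = integral {0..2*pi} (\<lambda>t. of_real r * (cis (- t) * g (of_real r * cis t)))" for r
  have gc: "continuous_on (annulus \<delta>) g"
    using g has_wirtinger_isCont by (blast intro: continuous_at_imp_continuous_on)
  define Fr where "Fr r t = cis (- t) * g (of_real r * cis t) +
     of_real r * (cis (- t) * (a (of_real r * cis t) * cis t + b (of_real r * cis t) * cnj (cis t)))" for r t
  note cp = continuous_on_polar[OF gc d(2)] continuous_on_polar[OF a d(2)] continuous_on_polar[OF b d(2)]
  have Jd: "(J has_vector_derivative integral {0..2*pi} (Fr r)) (at r within {1-\<delta>..1})"
    if r: "r \<in> {1-\<delta>..1}" for r
  proof -
    have "((\<lambda>r. integral (cbox 0 (2*pi)) (\<lambda>t. of_real r * (cis (- t) * g (of_real r * cis t)))) has_vector_derivative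
        integral (cbox 0 (2*pi)) (Fr r)) (at r within {1-\<delta>..1})"
    proof (rule leibniz_rule_vector_derivative)
      fix x t assume x: "x \<in> {1-\<delta>..1}"
      have 1: "((\<lambda>r. g (of_real r * cis t)) has_vector_derivative
          (a (of_real x * cis t) * cis t + b (of_real x * cis t) * cnj (cis t))) (at x within {1-\<delta>..1})"
        by (rule has_wirtinger_path[OF g[OF polar_in_annulus[OF d(2) x]] circle_vector_derivatives(1)])
      have 2: "(complex_of_real has_vector_derivative 1) (at x within {1-\<delta>..1})"
        by (auto intro!: derivative_eq_intros simp: has_vector_derivative_def scaleR_conv_of_real)
      show "((\<lambda>x. of_real x * (cis (- t) * g (of_real x * cis t))) has_vector_derivative Fr x t) (at x within {1-\<delta>..1})"
        using has_vector_derivative_mult[OF 2 has_vector_derivative_mult_right[OF 1, of "cis (-t)"]]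
        by (simp add: Fr_def algebra_simps)
    next
      fix x assume x: "x \<in> {1-\<delta>..1}"
      show "(\<lambda>t. of_real x * (cis (- t) * g (of_real x * cis t))) integrable_on cbox 0 (2*pi)"
        by (intro integrable_continuous continuous_intros continuous_on_compose2[OF gc])
          (use polar_in_annulus[OF d(2) x] in auto)
    next
      show "continuous_on ({1-\<delta>..1} \<times> cbox 0 (2*pi)) (\<lambda>(x, t). Fr x t)"
        using cp unfolding Fr_def case_prod_unfold cbox_interval by (intro continuous_intros) auto
    qed (use r in auto)
    then show ?thesis by (simp add: J_def[abs_def])
  qed
  \<comment> \<open>The difference of the two integrands is the angular derivative of i cis (-t) g,
    a periodic function, so it integrates to zero; this eliminates \<open>b\<close>.\<close>
  have eq: "integral {0..2*pi} (Fr r) = integral {0..2*pi} (\<lambda>t. 2 * (of_real r * a (of_real r * cis t)))"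
    if r: "r \<in> {1-\<delta>..1}" for r
  proof -
    define E where "E t = Fr r t - 2 * (of_real r * a (of_real r * cis t))" for t
    have "(E has_integral (\<i> * (cis (- (2*pi)) * g (of_real r * cis (2*pi))) - \<i> * (cis (- 0) * g (of_real r * cis 0)))) {0..2*pi}"
    proof (rule fundamental_theorem_of_calculus)
      fix t assume "t \<in> {0..2*pi}"
      define z where "z = of_real r * cis t"
      have 1: "((\<lambda>t. g (of_real r * cis t)) has_vector_derivative
          (a z * (\<i> * z) + b z * cnj (\<i> * z))) (at t within {0..2*pi})"
        unfolding z_def
        by (rule has_wirtinger_path[OF g[OF polar_in_annulus[OF d(2) r]] circle_vector_derivatives(2)])
      have c1: "cis (- t) * cis t = 1" by (simp add: cis_mult)
      have "E t = \<i> * (cis (- t) * (a z * (\<i> * z) + b z * cnj (\<i> * z)) + - \<i> * cis (- t) * g z)"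
      proof -
        have "cis (- t) * z = of_real r" using c1 by (simp add: z_def mult.left_commute)
        then have eq1: "cis (- t) * (a z * (\<i> * z)) = \<i> * (of_real r * a z)" by (simp add: mult_ac)
        have eq2: "Fr r t = cis (- t) * g z + of_real r * a z + cis (- t) * (b z * cnj z)"
          unfolding Fr_def z_def[symmetric] using c1 by (simp add: z_def algebra_simps)
        have eq3: "E t = Fr r t - 2 * (of_real r * a z)" by (simp only: E_def z_def)
        have "\<i> * (cis (- t) * (a z * (\<i> * z) + b z * cnj (\<i> * z)) + - \<i> * cis (- t) * g z) =
            \<i> * (cis (- t) * (a z * (\<i> * z))) + cis (- t) * (b z * cnj z) + cis (- t) * g z"
          by (simp add: algebra_simps)
        also have "\<dots> = E t" unfolding eq1 eq2 eq3 by (simp add: algebra_simps)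
        finally show ?thesis by (rule sym)
      qed
      moreover have "((\<lambda>t. \<i> * (cis (- t) * g (of_real r * cis t))) has_vector_derivative
         \<i> * (cis (- t) * (a z * (\<i> * z) + b z * cnj (\<i> * z)) + - \<i> * cis (- t) * g (of_real r * cis t))) (at t within {0..2*pi})"
        by (intro has_vector_derivative_mult_right has_vector_derivative_mult circle_vector_derivatives 1)
      ultimately show "((\<lambda>t. \<i> * (cis (- t) * g (of_real r * cis t))) has_vector_derivative E t) (at t within {0..2*pi})"
        by (simp add: z_def)
    qed simp
    then have "(E has_integral 0) {0..2*pi}" by (simp flip: cis_cnj)
    moreover have "(\<lambda>t. 2 * (of_real r * a (of_real r * cis t))) integrable_on {0..2*pi}"
      using integrable_on_cmult_left[OF polar_inner_integrable[OF a d(2) r], of 2] by simp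
    ultimately have "((\<lambda>t. E t + 2 * (of_real r * a (of_real r * cis t))) has_integral
       (0 + integral {0..2*pi} (\<lambda>t. 2 * (of_real r * a (of_real r * cis t))))) {0..2*pi}"
      by (intro has_integral_add integrable_integral)
    then show ?thesis by (simp add: E_def integral_unique)
  qed
  have "((\<lambda>r. integral {0..2*pi} (Fr r)) has_integral (J 1 - J (1-\<delta>))) {1-\<delta>..1}"
    by (rule fundamental_theorem_of_calculus) (use Jd d in auto)
  then have "J 1 - J (1-\<delta>) = integral {1-\<delta>..1} (\<lambda>r. integral {0..2*pi} (Fr r))"
    by (simp add: integral_unique)
  also have "\<dots> = integral {1-\<delta>..1} (\<lambda>r. integral {0..2*pi} (\<lambda>t. of_real r * (2 * a (of_real r * cis t))))"
  proof (rule Henstock_Kurzweil_Integration.integral_cong)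
    fix r assume r: "r \<in> {1-\<delta>..1}"
    show "integral {0..2*pi} (Fr r) = integral {0..2*pi} (\<lambda>t. of_real r * (2 * a (of_real r * cis t)))"
      unfolding eq[OF r] by (simp add: mult.left_commute)
  qed
  also have "\<dots> = 2 * polar_integral \<delta> a"
    using polar_integral_cmult[of \<delta> 2 a] by (simp add: polar_integral_def)
  finally show ?thesis
    by (simp add: J_def Henstock_Kurzweil_Integration.integral_mult_right)
qed

section \<open>One integration by parts against the kernel\<close>

context circle_weight
begin

text \<open>The shape of the pulled-back product of two orthogonal polynomials: the powers stem from
  the powers of \<phi>, while \<open>f\<close> and \<open>h\<close> stand for the slowly varying
  quotients.\<close>

definition kernel :: "nat \<Rightarrow> nat \<Rightarrow> (complex \<Rightarrow> complex) \<Rightarrow> (complex \<Rightarrow> complex) \<Rightarrow> complex \<Rightarrow> complex" where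
  "kernel N M f h z = z ^ N * cnj (z ^ M * h z) * (f z * of_real (\<Omega> z))"

lemma circle_germ_isCont: "circle_germ \<psi> S f \<Longrightarrow> near (sphere 0 1) (isCont f)"
  using circle_germ_deriv[OF S \<psi>] by (metis (no_types, lifting) has_wirtinger_isCont near_mono)

lemma circle_germ_continuous_annulus:
  assumes "circle_germ \<psi> S f"
  shows "\<exists>e>0. e < 1 \<and> continuous_on (annulus e) f \<and> continuous_on (annulus e) (\<lambda>z. complex_of_real (\<Omega> z))"
proof -
  obtain a b where ab: "near (sphere 0 1) (\<lambda>z. has_wirtinger (\<lambda>w. 1 * complex_of_real (\<Omega> w)) (a z * of_real (\<Omega> z)) (b z * of_real (\<Omega> z)) z \<and>
        op_T \<Omega> (\<lambda>_. 1) z = z * a z + 1)" using op_T_germ(2)[OF circle_germ_const[of \<psi> S 1]] by blast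
  have "near (sphere 0 1) (\<lambda>z. isCont f z \<and> isCont (\<lambda>w. complex_of_real (\<Omega> w)) z)"
    using circle_germ_isCont[OF assms] ab by (rule near_elim2) (auto dest: has_wirtinger_isCont)
  then show ?thesis
    using near_sphere_imp_annulus by (blast intro: continuous_at_imp_continuous_on)
qed

lemma continuous_on_kernel:
  assumes "continuous_on A f" "continuous_on A (\<lambda>z. complex_of_real (\<Omega> z))" "continuous_on A h"
  shows "continuous_on A (kernel N M f h)"
  unfolding kernel_def[abs_def]
  by (intro continuous_on_mult continuous_on_power continuous_on_cnj continuous_on_id assms)

lemma kernel_bound:
  assumes "norm z \<le> 1" "norm (h z) \<le> B" "norm (f z * of_real (\<Omega> z)) \<le> C"
  shows "norm (kernel N M f h z) \<le> C * B * norm z ^ N"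
proof -
  have 1: "norm z ^ M * norm (h z) \<le> 1 * B"
    using assms by (intro mult_mono power_le_one) auto
  have B: "B \<ge> 0" using assms(2) norm_ge_zero order_trans by blast
  have "norm (kernel N M f h z) = norm z ^ N * (norm z ^ M * norm (h z)) * norm (f z * of_real (\<Omega> z))"
    by (simp add: kernel_def norm_mult norm_power)
  also have "\<dots> \<le> norm z ^ N * (1 * B) * C"
  proof (rule mult_mono)
    show "norm z ^ N * (norm z ^ M * norm (h z)) \<le> norm z ^ N * (1 * B)"
      by (rule mult_left_mono[OF 1]) simp
  qed (use assms B in auto)
  finally show ?thesis by (simp add: mult_ac)
qed

text \<open>Apply the Green formula to z^(N+1) f \<Omega> times the conjugate of z^M h. The
  conjugate factor is not differentiated, and the 1 in N + 1 is absorbed by the identity in T, so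
  the derivative is N times the kernel of \<open>f\<close> plus the kernel of T f. The outer circle
  gives the trace, the inner one the factor (1 - \<delta>)^N. \<open>e\<close> and \<open>C\<close>
  depend on \<open>f\<close> alone, which matters since \<delta> and \<open>h\<close> will vary with
  N.\<close>

lemma one_step:
  assumes f: "circle_germ \<psi> S f"
  shows "\<exists>e>0. \<exists>C\<ge>0. e < 1 \<and> (\<forall>\<delta> h B N M. 0 < \<delta> \<longrightarrow> \<delta> \<le> e \<longrightarrow> h analytic_on annulus \<delta> \<longrightarrow> (\<forall>z\<in>annulus \<delta>. norm (h z) \<le> B) \<longrightarrow>
     norm (polar_integral \<delta> (kernel N M f h)) \<le> C * B / real (N + 1) \<and>
     norm (of_nat N * polar_integral \<delta> (kernel N M f h) + polar_integral \<delta> (kernel N M (op_T \<Omega> f) h)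
       - integral {0..2*pi} (\<lambda>t. kernel N M f h (cis t)) / 2) \<le> C * B * (1-\<delta>) ^ N)"
proof -
  obtain a b where ab: "circle_germ \<psi> S a" "circle_germ \<psi> S b"
    and T: "near (sphere 0 1) (\<lambda>z. has_wirtinger (\<lambda>w. f w * of_real (\<Omega> w)) (a z * of_real (\<Omega> z)) (b z * of_real (\<Omega> z)) z \<and>
        op_T \<Omega> f z = z * a z + f z)"
    using op_T_germ(2)[OF f] by blast
  obtain e1 where e1: "e1 > 0" "e1 < 1" "continuous_on (annulus e1) f" "continuous_on (annulus e1) (\<lambda>z. complex_of_real (\<Omega> z))"
    using circle_germ_continuous_annulus[OF f] by blast
  obtain e2 where e2: "e2 > 0" "e2 < 1" "continuous_on (annulus e2) a" using circle_germ_continuous_annulus[OF ab(1)] by blast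
  obtain e3 where e3: "e3 > 0" "e3 < 1" "continuous_on (annulus e3) b" using circle_germ_continuous_annulus[OF ab(2)] by blast
  obtain e4 where e4: "e4 > 0" "e4 < 1" "\<And>z. z \<in> annulus e4 \<Longrightarrow> has_wirtinger (\<lambda>w. f w * of_real (\<Omega> w)) (a z * of_real (\<Omega> z)) (b z * of_real (\<Omega> z)) z \<and>
        op_T \<Omega> f z = z * a z + f z" using near_sphere_imp_annulus[OF T] by blast
  define e where "e = min (min e1 e2) (min e3 e4)"
  have e: "e > 0" "e < 1" "e \<le> e1" "e \<le> e2" "e \<le> e3" "e \<le> e4" using e1 e2 e3 e4 by (auto simp: e_def)
  have "compact ((\<lambda>z. f z * of_real (\<Omega> z)) ` annulus e)"
    by (intro compact_continuous_image compact_annulus continuous_on_mult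
        continuous_on_subset[OF e1(3) annulus_mono[OF e(3)]] continuous_on_subset[OF e1(4) annulus_mono[OF e(3)]])
  then obtain K where K: "K > 0" "\<And>z. z \<in> annulus e \<Longrightarrow> norm (f z * of_real (\<Omega> z)) \<le> K"
    using bounded_pos[of "(\<lambda>z. f z * of_real (\<Omega> z)) ` annulus e"] compact_imp_bounded by blast
  \<comment> \<open>One constant for both estimates: 2 pi arises from the angular integration,
    \<open>K\<close> bounds f \<Omega> on the widest collar.\<close>
  define C where "C = 2 * pi * K"
  have C: "C \<ge> 0" using K by (simp add: C_def)
  have "norm (polar_integral \<delta> (kernel N M f h)) \<le> C * B / real (N + 1) \<and>
     norm (of_nat N * polar_integral \<delta> (kernel N M f h) + polar_integral \<delta> (kernel N M (op_T \<Omega> f) h)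
       - integral {0..2*pi} (\<lambda>t. kernel N M f h (cis t)) / 2) \<le> C * B * (1-\<delta>) ^ N"
    if d: "0 < \<delta>" "\<delta> \<le> e" and h: "h analytic_on annulus \<delta>" and B: "\<forall>z\<in>annulus \<delta>. norm (h z) \<le> B" for \<delta> h B N M
  proof -
    have d1: "0 \<le> \<delta>" "\<delta> \<le> 1" using d e by auto
    have sub: "annulus \<delta> \<subseteq> annulus e" by (rule annulus_mono[OF d(2)])
    note subs = order_trans[OF sub annulus_mono[OF e(3)]] order_trans[OF sub annulus_mono[OF e(4)]]
      order_trans[OF sub annulus_mono[OF e(5)]] order_trans[OF sub annulus_mono[OF e(6)]]
    have fc: "continuous_on (annulus \<delta>) f" and \<Omega>c: "continuous_on (annulus \<delta>) (\<lambda>z. complex_of_real (\<Omega> z))"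
      and ac: "continuous_on (annulus \<delta>) a" and bc: "continuous_on (annulus \<delta>) b"
      using e1 e2 e3 subs continuous_on_subset by blast+
    have hc: "continuous_on (annulus \<delta>) h" using h by (rule analytic_on_imp_continuous_on)
    have h'c: "continuous_on (annulus \<delta>) (deriv h)" using analytic_deriv[OF h] by (rule analytic_on_imp_continuous_on)
    have Tc: "continuous_on (annulus \<delta>) (op_T \<Omega> f)"
    proof -
      have "continuous_on (annulus \<delta>) (\<lambda>z. z * a z + f z)" by (intro continuous_intros ac fc)
      then show ?thesis by (rule continuous_on_eq) (use e4(3) subs(4) in auto)
    qed
    have "1 \<in> annulus \<delta>" using d1 by (simp add: annulus_def)
    then have B0: "B \<ge> 0" using B norm_ge_zero order_trans by blast
    have kb: "norm (kernel N M f h z) \<le> K * B * norm z ^ N" if "z \<in> annulus \<delta>" for z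
      using that sub B K(2) by (intro kernel_bound) (auto simp: annulus_def)
    have 1: "norm (polar_integral \<delta> (kernel N M f h)) \<le> C * B / real (N + 1)"
      using polar_integral_bound[OF continuous_on_kernel[OF fc \<Omega>c hc] d1 _ kb] K B0
      by (simp add: C_def mult.assoc)
    define q where "q z = z ^ M * h z" for z
    define q' where "q' z = z ^ M * deriv h z + of_nat M * z ^ (M - 1) * h z" for z
    have qd: "(q has_field_derivative q' z) (at z)" if "z \<in> annulus \<delta>" for z
    proof -
      have "(h has_field_derivative deriv h z) (at z)"
        using h that by (meson analytic_on_imp_differentiable_at field_differentiable_derivI)
      then show ?thesis unfolding q_def q'_def
        by (auto intro!: derivative_eq_intros simp: algebra_simps)
    qed
    define g where "g z = z ^ (N + 1) * (cnj (q z) * (f z * of_real (\<Omega> z)))" for z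
    define ga where "ga z = of_nat N * kernel N M f h z + kernel N M (op_T \<Omega> f) h z" for z
    define gb where "gb z = z ^ (N + 1) * (cnj (q z) * (b z * of_real (\<Omega> z)) + cnj (q' z) * (f z * of_real (\<Omega> z)))" for z
    have gw: "has_wirtinger g (ga z) (gb z) z" if z: "z \<in> annulus \<delta>" for z
    proof -
      have w1: "has_wirtinger (\<lambda>z. z ^ (N + 1)) (of_nat (N + 1) * z ^ N) 0 z"
        by (rule has_wirtinger_holomorphic, rule DERIV_cong[OF DERIV_power[OF DERIV_ident]]) simp
      have w2: "has_wirtinger (\<lambda>z. cnj (q z)) 0 (cnj (q' z)) z"
        using has_wirtinger_cnj[OF has_wirtinger_holomorphic[OF qd[OF z]]] by simp
      have w3: "has_wirtinger (\<lambda>w. f w * of_real (\<Omega> w)) (a z * of_real (\<Omega> z)) (b z * of_real (\<Omega> z)) z"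
        and Tz: "op_T \<Omega> f z = z * a z + f z" using e4(3) z subs(4) by blast+
      from has_wirtinger_mult[OF w1 has_wirtinger_mult[OF w2 w3]]
      show ?thesis unfolding g_def
        by (simp add: ga_def gb_def kernel_def Tz q_def algebra_simps)
    qed
    have gac: "continuous_on (annulus \<delta>) ga" unfolding ga_def
      by (intro continuous_on_add continuous_on_mult continuous_on_const continuous_on_kernel fc \<Omega>c hc Tc)
    have gbc: "continuous_on (annulus \<delta>) gb" unfolding gb_def q_def q'_def
      by (intro continuous_on_mult continuous_on_add continuous_on_power continuous_on_cnj continuous_on_id
          continuous_on_const fc \<Omega>c hc h'c bc)
    \<comment> \<open>The spare factor z of z^(N+1) cancels against cis (-t), which turns the
      boundary terms of the Green formula into traces of the kernel.\<close>
    have gk: "of_real r * (cis (- t) * g (of_real r * cis t)) = of_real r ^ 2 * kernel N M f h (of_real r * cis t)" for r t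
    proof -
      define z where "z = of_real r * cis t"
      have 1: "cis (- t) * z = of_real r" by (simp add: z_def cis_mult mult.left_commute)
      have "of_real r * (cis (- t) * g z) = of_real r * ((cis (- t) * z) * (z ^ N * (cnj (q z) * (f z * of_real (\<Omega> z)))))"
        unfolding g_def by (simp add: mult_ac)
      also have "\<dots> = of_real r ^ 2 * kernel N M f h z"
        unfolding 1 kernel_def q_def by (simp add: power2_eq_square mult_ac)
      finally show ?thesis by (simp only: z_def)
    qed
    have "2 * polar_integral \<delta> ga = integral {0..2*pi} (\<lambda>t. cis (- t) * g (cis t)) -
      of_real (1-\<delta>) * integral {0..2*pi} (\<lambda>t. cis (- t) * g (of_real (1-\<delta>) * cis t))"
      by (rule green_annulus[OF d1 gw gac gbc])
    also have "(\<lambda>t. cis (- t) * g (cis t)) = (\<lambda>t. kernel N M f h (cis t))"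
      using gk[of 1] by (simp add: fun_eq_iff)
    also have "of_real (1-\<delta>) * integral {0..2*pi} (\<lambda>t. cis (- t) * g (of_real (1-\<delta>) * cis t)) =
       integral {0..2*pi} (\<lambda>t. of_real (1-\<delta>) ^ 2 * kernel N M f h (of_real (1-\<delta>) * cis t))"
      unfolding gk[symmetric] by (rule Henstock_Kurzweil_Integration.integral_mult_right[symmetric])
    finally have 2: "2 * polar_integral \<delta> ga = integral {0..2*pi} (\<lambda>t. kernel N M f h (cis t)) -
       integral {0..2*pi} (\<lambda>t. of_real (1-\<delta>) ^ 2 * kernel N M f h (of_real (1-\<delta>) * cis t))" .
    have 3: "polar_integral \<delta> ga = of_nat N * polar_integral \<delta> (kernel N M f h) + polar_integral \<delta> (kernel N M (op_T \<Omega> f) h)"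
      unfolding ga_def
      by (subst polar_integral_add[OF _ _ d1(2)])
        (auto intro!: continuous_on_mult continuous_on_kernel fc \<Omega>c hc Tc simp: polar_integral_cmult)
    define I where "I = integral {0..2*pi} (\<lambda>t. of_real (1-\<delta>) ^ 2 * kernel N M f h (of_real (1-\<delta>) * cis t))"
    have mem: "of_real (1-\<delta>) * cis t \<in> annulus \<delta>" for t
      by (rule polar_in_annulus[OF d1(2)]) (use d1 in auto)
    have "norm I \<le> integral {0..2*pi} (\<lambda>t. K * B * (1-\<delta>) ^ N)"
      unfolding I_def
    proof (rule Henstock_Kurzweil_Integration.integral_norm_bound_integral)
      show "(\<lambda>t. of_real (1-\<delta>) ^ 2 * kernel N M f h (of_real (1-\<delta>) * cis t)) integrable_on {0..2*pi}"
        by (intro integrable_continuous_interval continuous_intros continuous_on_compose2[OF continuous_on_kernel[OF fc \<Omega>c hc]])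
          (use mem in auto)
      fix t
      have "norm (kernel N M f h (of_real (1-\<delta>) * cis t)) \<le> K * B * (1-\<delta>) ^ N"
        using kb[OF mem, of t] d1 by (simp add: norm_mult del: of_real_diff)
      moreover have "(1-\<delta>) ^ 2 \<le> 1" using d1 by (intro power_le_one) auto
      ultimately have "(1-\<delta>) ^ 2 * norm (kernel N M f h (of_real (1-\<delta>) * cis t)) \<le> 1 * (K * B * (1-\<delta>) ^ N)"
        using d1 K B0 by (intro mult_mono) auto
      then show "norm (of_real (1-\<delta>) ^ 2 * kernel N M f h (of_real (1-\<delta>) * cis t)) \<le> K * B * (1-\<delta>) ^ N"
        using d1 by (simp add: norm_mult norm_power del: of_real_diff)
    qed auto
    then have I: "norm I \<le> C * B * (1-\<delta>) ^ N" by (simp add: C_def mult_ac)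
    have "of_nat N * polar_integral \<delta> (kernel N M f h) + polar_integral \<delta> (kernel N M (op_T \<Omega> f) h)
       - integral {0..2*pi} (\<lambda>t. kernel N M f h (cis t)) / 2 = - I / 2"
      using 2 unfolding 3[symmetric] I_def[symmetric] by (simp add: field_simps)
    then have "norm (of_nat N * polar_integral \<delta> (kernel N M f h) + polar_integral \<delta> (kernel N M (op_T \<Omega> f) h)
       - integral {0..2*pi} (\<lambda>t. kernel N M f h (cis t)) / 2) \<le> norm I"
      by (simp add: norm_divide)
    with 1 I show ?thesis by linarith
  qed
  then show ?thesis using e C by (intro exI[of _ e] conjI exI[of _ C]) auto
qed

end

subsection \<open>Change of variables to polar coordinates\<close>

no_notation fps_nth (infixl \<open>$\<close> 75)

text \<open>Lebesgue measure is determined by boxes, and a map matching two orthonormal bases pulls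
  boxes back to boxes with the same side lengths. It links complex and real pairs with
  \<open>real^2\<close>, the setting of the change-of-variables theorem.\<close>

lemma lborel_distr_orthonormal:
  fixes f :: "'a::euclidean_space \<Rightarrow> 'b::euclidean_space"
  assumes f: "f \<in> borel_measurable borel" and bij: "bij_betw f Basis Basis"
    and inner: "\<And>x b. b \<in> Basis \<Longrightarrow> f x \<bullet> f b = x \<bullet> b"
  shows "lborel = distr lborel borel f"
proof (rule lborel_eqI)
  fix l u :: 'b assume lu: "\<And>b. b \<in> Basis \<Longrightarrow> l \<bullet> b \<le> u \<bullet> b"
  have fb: "f b \<in> Basis" if "b \<in> Basis" for b using bij that by (auto simp: bij_betw_def)
  \<comment> \<open>Coordinates transported back along the bijection of the bases.\<close>
  define g where "g y = (\<Sum>b\<in>Basis. (y \<bullet> f b) *\<^sub>R b)" for y :: 'b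
  have g: "g y \<bullet> b = y \<bullet> f b" if "b \<in> Basis" for y b
    using that by (simp add: g_def inner_sum_left inner_Basis if_distrib sum.If_cases cong: if_cong)
  have "f -` box l u = box (g l) (g u)"
  proof -
    have "x \<in> f -` box l u \<longleftrightarrow> x \<in> box (g l) (g u)" for x
    proof -
      have "x \<in> f -` box l u \<longleftrightarrow> (\<forall>c\<in>f ` Basis. l \<bullet> c < f x \<bullet> c \<and> f x \<bullet> c < u \<bullet> c)"
        using bij by (simp add: mem_box bij_betw_def)
      also have "\<dots> \<longleftrightarrow> x \<in> box (g l) (g u)" by (simp add: mem_box inner g)
      finally show ?thesis .
    qed
    then show ?thesis by blast
  qed
  then have "emeasure (distr lborel borel f) (box l u) = emeasure lborel (box (g l) (g u))"
    using f by (subst emeasure_distr) auto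
  also have "\<dots> = ennreal (\<Prod>b\<in>Basis. (g u - g l) \<bullet> b)"
    by (rule emeasure_lborel_box) (simp add: g lu fb)
  also have "(\<Prod>b\<in>Basis. (g u - g l) \<bullet> b) = (\<Prod>b\<in>Basis. (u - l) \<bullet> f b)"
    by (intro prod.cong) (auto simp: g inner_diff_left)
  also have "\<dots> = (\<Prod>c\<in>Basis. (u - l) \<bullet> c)"
    using prod.reindex_bij_betw[OF bij, of "\<lambda>c. (u - l) \<bullet> c"] .
  finally show "emeasure (distr lborel borel f) (box l u) = ennreal (\<Prod>b\<in>Basis. (u - l) \<bullet> b)" .
qed simp

definition vec2_complex :: "real^2 \<Rightarrow> complex" where
  "vec2_complex x = Complex (x $ 1) (x $ 2)"

definition complex_vec2 :: "complex \<Rightarrow> real^2" where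
  "complex_vec2 z = vector [Re z, Im z]"

definition vec2_pair :: "real^2 \<Rightarrow> real \<times> real" where
  "vec2_pair x = (x $ 1, x $ 2)"

lemma vec2_complex_inverse [simp]: "vec2_complex (complex_vec2 z) = z" "complex_vec2 (vec2_complex x) = x"
  by (simp_all add: vec2_complex_def complex_vec2_def vec_eq_iff forall_2)

lemma bounded_linear_vec2_complex: "bounded_linear vec2_complex"
  by (intro linear_conv_bounded_linear[THEN iffD1] linearI)
    (simp_all add: vec2_complex_def complex_eq_iff)

lemma bounded_linear_complex_vec2: "bounded_linear complex_vec2"
  by (intro linear_conv_bounded_linear[THEN iffD1] linearI)
    (simp_all add: complex_vec2_def vec_eq_iff forall_2)

lemma bounded_linear_vec2_pair: "bounded_linear vec2_pair"
  by (intro linear_conv_bounded_linear[THEN iffD1] linearI)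
    (simp_all add: vec2_pair_def)

lemma Basis_vec2: "(Basis :: (real^2) set) = {axis 1 1, axis 2 1}"
  by (auto simp: Basis_vec_def exhaust_2) (metis exhaust_2)

lemma lborel_vec2_complex: "lborel = distr lborel borel vec2_complex"
proof (rule lborel_distr_orthonormal)
  show "vec2_complex \<in> borel_measurable borel"
    by (intro borel_measurable_continuous_onI linear_continuous_on bounded_linear_vec2_complex)
  show "bij_betw vec2_complex Basis Basis"
    unfolding bij_betw_def Basis_vec2 Basis_complex_def
    by (auto simp: vec2_complex_def axis_def inj_on_def complex_eq_iff image_iff)
  show "vec2_complex x \<bullet> vec2_complex b = x \<bullet> b" for x b
    by (simp add: vec2_complex_def inner_vec_def sum_2 inner_complex_def)
qed

lemma lborel_vec2_pair: "lborel = distr lborel borel vec2_pair"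
proof (rule lborel_distr_orthonormal)
  show "vec2_pair \<in> borel_measurable borel"
    by (intro borel_measurable_continuous_onI linear_continuous_on bounded_linear_vec2_pair)
  show "bij_betw vec2_pair Basis Basis"
    unfolding bij_betw_def Basis_vec2 Basis_prod_def
    by (auto simp: vec2_pair_def axis_def inj_on_def image_iff)
  show "vec2_pair x \<bullet> vec2_pair b = x \<bullet> b" for x b
    by (simp add: vec2_pair_def inner_vec_def sum_2)
qed

lemma integral_cbox_vec2:
  fixes H :: "real \<times> real \<Rightarrow> complex"
  assumes "continuous_on (cbox (a, c) (b, d)) H"
  shows "integral (cbox (vector [a, c]) (vector [b, d] :: real^2)) (\<lambda>x. H (vec2_pair x)) =
    integral {a..b} (\<lambda>r. integral {c..d} (\<lambda>t. H (r, t)))"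
proof -
  define Q where "Q = cbox (vector [a, c]) (vector [b, d] :: real^2)"
  define R where "R = cbox (a, c) (b, d)"
  have QR: "x \<in> Q \<longleftrightarrow> vec2_pair x \<in> R" for x
    by (auto simp: Q_def R_def mem_box_cart forall_2 vec2_pair_def cbox_Pair_eq)
  have intR: "integrable lborel (\<lambda>p. indicator R p *\<^sub>R H p)"
    unfolding R_def by (rule borel_integrable_compact[OF compact_cbox assms])
  have meas: "vec2_pair \<in> measurable lborel borel"
    using linear_continuous_on[OF bounded_linear_vec2_pair] by (simp add: borel_measurable_continuous_onI)
  have m: "(\<lambda>p. indicator R p *\<^sub>R H p) \<in> borel_measurable borel" using intR by simp
  have "(LINT p|lborel. indicator R p *\<^sub>R H p) = (LINT x|lborel. indicator R (vec2_pair x) *\<^sub>R H (vec2_pair x))"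
    by (subst lborel_vec2_pair) (rule integral_distr[OF meas m])
  moreover have "integrable lborel (\<lambda>x. indicator R (vec2_pair x) *\<^sub>R H (vec2_pair x))"
    using intR by (subst (asm) lborel_vec2_pair) (simp add: integrable_distr_eq[OF meas m])
  moreover have "indicator R (vec2_pair x) = (indicator Q x :: real)" for x using QR[of x] by (simp add: indicator_def)
  ultimately have e: "(LINT x:R|lborel. H x) = (LINT x:Q|lborel. H (vec2_pair x))"
    and i: "set_integrable lborel Q (\<lambda>x. H (vec2_pair x))"
    by (simp_all add: set_lebesgue_integral_def set_integrable_def)
  have "integral Q (\<lambda>x. H (vec2_pair x)) = integral R H"
    using set_borel_integral_eq_integral(2)[OF i] set_borel_integral_eq_integral(2)[of R H] intR e
    by (simp add: set_integrable_def)
  also have "\<dots> = integral (cbox a b) (\<lambda>r. integral (cbox c d) (\<lambda>t. H (r, t)))"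
    unfolding R_def by (rule integral_prod_continuous) (use assms in simp)
  finally show ?thesis by (simp add: Q_def)
qed

text \<open>The half-open range of angles meets each point once, and \<delta> < 1 keeps the radii
  positive.\<close>

lemma polar_bij:
  assumes "0 < \<delta>" "\<delta> < 1"
  defines "S \<equiv> {x::real^2. 1 - \<delta> < x $ 1 \<and> x $ 1 < 1 \<and> 0 \<le> x $ 2 \<and> x $ 2 < 2 * pi}"
  shows "inj_on (\<lambda>x::real^2. of_real (x $ 1) * cis (x $ 2)) S"
    "(\<lambda>x::real^2. of_real (x $ 1) * cis (x $ 2)) ` S = {z. 1 - \<delta> < norm z \<and> norm z < 1}"
proof -
  show "inj_on (\<lambda>x::real^2. of_real (x $ 1) * cis (x $ 2)) S"
  proof (rule inj_onI)
    fix x y assume x: "x \<in> S" and y: "y \<in> S"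
      and eq: "of_real (x $ 1) * cis (x $ 2) = of_real (y $ 1) * cis (y $ 2)"
    from arg_cong[OF eq, of norm] have 1: "x $ 1 = y $ 1"
      using x y assms by (simp add: norm_mult S_def)
    then have c: "cis (x $ 2) = cis (y $ 2)" using eq x assms by (simp add: S_def)
    have "x $ 2 = y $ 2"
    proof (cases "y $ 2 = 0")
      case False
      then show ?thesis using cis_inj_open_period[OF c] x y by (simp add: S_def)
    next
      \<comment> \<open>At the angle 0 the roles are exchanged, since the injectivity lemma requires
        one angle in the open period.\<close>
      case True
      show ?thesis
      proof (rule ccontr)
        assume "x $ 2 \<noteq> y $ 2"
        then show False using cis_inj_open_period[OF c[symmetric]] x y True by (simp add: S_def)
      qed
    qed
    with 1 show "x = y" by (simp add: vec_eq_iff forall_2)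
  qed
  show "(\<lambda>x::real^2. of_real (x $ 1) * cis (x $ 2)) ` S = {z. 1 - \<delta> < norm z \<and> norm z < 1}"
  proof
    show "(\<lambda>x::real^2. of_real (x $ 1) * cis (x $ 2)) ` S \<subseteq> {z. 1 - \<delta> < norm z \<and> norm z < 1}"
      using assms by (auto simp: S_def norm_mult)
    show "{z. 1 - \<delta> < norm z \<and> norm z < 1} \<subseteq> (\<lambda>x::real^2. of_real (x $ 1) * cis (x $ 2)) ` S"
    proof
      fix z :: complex assume z: "z \<in> {z. 1 - \<delta> < norm z \<and> norm z < 1}"
      define x :: "real^2" where "x = vector [norm z, Arg2pi z]"
      have "x \<in> S" using z Arg2pi_ge_0[of z] Arg2pi_lt_2pi[of z] by (simp add: x_def S_def)
      moreover have "z = of_real (x $ 1) * cis (x $ 2)" using Arg2pi_eq[of z] by (simp add: x_def cis_conv_exp)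
      ultimately show "z \<in> (\<lambda>x::real^2. of_real (x $ 1) * cis (x $ 2)) ` S" by blast
    qed
  qed
qed

text \<open>For a conformal map after polar coordinates the radial and angular derivatives are
  orthogonal, of lengths |u| and r |u|; the Jacobian is the area of that rectangle.\<close>

lemma det_complex_columns:
  fixes L :: "real^2 \<Rightarrow> complex"
  assumes "L (axis 1 1) = u" "L (axis 2 1) = of_real r * \<i> * u"
  shows "det (matrix (\<lambda>h. complex_vec2 (L h))) = r * (norm u)\<^sup>2"
  unfolding det_2 matrix_def
  by (simp add: assms complex_vec2_def cmod_def power2_eq_square algebra_simps)

text \<open>Polar coordinates followed by \<psi> form one injective map on a rectangle, whose
  Jacobian r |\<psi>'|^2 supplies both the weight in \<open>polar_integral\<close> and the factor in
  the integrand.\<close>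

lemma polar_change_of_variables:
  fixes \<psi> f :: "complex \<Rightarrow> complex"
  assumes d: "0 < \<delta>" "\<delta> < 1" and G: "open G" "annulus \<delta> \<subseteq> G" and \<psi>: "\<psi> holomorphic_on G" "inj_on \<psi> G"
    and f: "continuous_on (\<psi> ` annulus \<delta>) f"
  defines "A \<equiv> {z. 1 - \<delta> < norm z \<and> norm z < 1}"
  shows "set_integrable lborel (\<psi> ` A) f"
    "(LINT z:\<psi> ` A|lborel. f z) = polar_integral \<delta> (\<lambda>z. of_real ((norm (deriv \<psi> z))\<^sup>2) * f (\<psi> z))"
proof -
  have AA: "A \<subseteq> annulus \<delta>" unfolding A_def annulus_def by auto
  have AG: "A \<subseteq> G" using AA G(2) by blast
  have "open A" unfolding A_def by (intro open_Collect_conj open_Collect_less continuous_intros)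
  then have oA: "open (\<psi> ` A)"
    using open_mapping_thm3[of \<psi> A] \<psi> AG by (meson holomorphic_on_subset inj_on_subset)
  have \<psi>c: "continuous_on (annulus \<delta>) \<psi>"
    using \<psi>(1) G(2) by (meson holomorphic_on_imp_continuous_on holomorphic_on_subset)
  have cpt: "compact (\<psi> ` annulus \<delta>)" by (rule compact_continuous_image[OF \<psi>c compact_annulus])
  have "set_integrable lborel (\<psi> ` annulus \<delta>) f"
    unfolding set_integrable_def by (rule borel_integrable_compact[OF cpt f])
  then show si: "set_integrable lborel (\<psi> ` A) f"
    by (rule set_integrable_subset) (use oA AA in auto)
  define S where "S = {x::real^2. 1 - \<delta> < x $ 1 \<and> x $ 1 < 1 \<and> 0 \<le> x $ 2 \<and> x $ 2 < 2 * pi}"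
  define p where "p x = of_real (x $ 1) * cis (x $ 2)" for x :: "real^2"
  have pS: "inj_on p S" "p ` S = A" unfolding p_def S_def A_def using polar_bij[OF d] by auto
  define T where "T x = complex_vec2 (\<psi> (p x))" for x
  define T' where "T' x h = complex_vec2 (deriv \<psi> (p x) * (of_real (h $ 1) * cis (x $ 2) + of_real (h $ 2) * (\<i> * p x)))" for x h :: "real^2"
  have Td: "(T has_derivative T' x) (at x within S)" if x: "x \<in> S" for x
  proof -
    have px: "p x \<in> G" using pS(2) AG x by blast
    have pd: "(p has_derivative (\<lambda>h. of_real (h $ 1) * cis (x $ 2) + of_real (h $ 2) * (\<i> * p x))) (at x)"
    proof -
      have 1: "((\<lambda>x::real^2. x $ i) has_derivative (\<lambda>h. h $ i)) (at x)" for i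
        by (rule bounded_linear_imp_has_derivative) (rule bounded_linear_vec_nth)
      have 2: "((\<lambda>x::real^2. complex_of_real (x $ 1)) has_derivative (\<lambda>h. of_real (h $ 1))) (at x)"
        by (rule has_derivative_of_real[OF 1])
      have 3: "((\<lambda>x::real^2. cis (x $ 2)) has_derivative (\<lambda>h. (h $ 2) *\<^sub>R (\<i> * cis (x $ 2)))) (at x)"
        using has_derivative_compose[OF 1[of 2], of cis "\<lambda>h. h *\<^sub>R (\<i> * cis (x $ 2))"]
          circle_vector_derivatives(2)[of 1 "x $ 2" UNIV] by (simp add: has_vector_derivative_def)
      show ?thesis unfolding p_def
        by (rule has_derivative_eq_rhs[OF has_derivative_mult[OF 2 3]])
          (simp add: fun_eq_iff scaleR_conv_of_real algebra_simps)
    qed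
    have \<psi>d: "(\<psi> has_derivative (\<lambda>h. deriv \<psi> (p x) * h)) (at (p x))"
      using holomorphic_derivI[OF \<psi>(1) G(1) px] by (simp add: has_field_derivative_def)
    from bounded_linear.has_derivative[OF bounded_linear_complex_vec2 has_derivative_compose[OF pd \<psi>d]]
    show ?thesis unfolding T_def T'_def by (rule has_derivative_at_withinI)
  qed
  have Tinj: "inj_on T S"
  proof (rule inj_onI)
    fix x y assume xy: "x \<in> S" "y \<in> S" "T x = T y"
    from arg_cong[OF xy(3), of vec2_complex] have "\<psi> (p x) = \<psi> (p y)" by (simp add: T_def)
    then have "p x = p y" using \<psi>(2) pS(2) AG xy by (meson imageI inj_onD subsetD)
    then show "x = y" using pS(1) xy by (meson inj_onD)
  qed
  \<comment> \<open>The closed rectangle differs from the parameter set by a part of its boundary, a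
    null set, and admits Fubini for continuous integrands.\<close>
  define Q where "Q = cbox (vector [1-\<delta>, 0]) (vector [1, 2*pi] :: real^2)"
  have SQ: "S \<subseteq> Q" "Q - S \<subseteq> Q - box (vector [1-\<delta>, 0]) (vector [1, 2*pi])"
    unfolding S_def Q_def by (auto simp: mem_box_cart forall_2)
  have QS: "negligible (Q - S)"
    using negligible_subset[OF negligible_frontier_interval SQ(2)[unfolded Q_def]] by (simp add: Q_def)
  have Sm: "S \<in> sets lebesgue"
  proof -
    have "S = Q - (Q - S)" using SQ(1) by blast
    moreover have "Q \<in> sets lebesgue" by (simp add: Q_def)
    moreover have "Q - S \<in> sets lebesgue" using QS negligible_imp_sets by blast
    ultimately show ?thesis by (metis sets.Diff)
  qed
  have det: "\<bar>det (matrix (T' x))\<bar> = x $ 1 * (norm (deriv \<psi> (p x)))\<^sup>2" if x: "x \<in> S" for x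
  proof -
    have "det (matrix (T' x)) = x $ 1 * (norm (deriv \<psi> (p x) * cis (x $ 2)))\<^sup>2"
      unfolding T'_def by (rule det_complex_columns) (simp_all add: axis_def p_def)
    then show ?thesis using x d by (simp add: norm_mult S_def abs_mult)
  qed
  define E where "E = T ` S"
  have E: "x \<in> E \<longleftrightarrow> vec2_complex x \<in> \<psi> ` A" for x
    unfolding E_def T_def pS(2)[symmetric] by (auto simp: image_iff) (metis vec2_complex_inverse(2))
  have meas: "vec2_complex \<in> measurable lborel borel"
    using linear_continuous_on[OF bounded_linear_vec2_complex] by (simp add: borel_measurable_continuous_onI)
  have m: "(\<lambda>z. indicator (\<psi> ` A) z *\<^sub>R f z) \<in> borel_measurable borel" using si by (simp add: set_integrable_def)
  have "(LINT z|lborel. indicator (\<psi> ` A) z *\<^sub>R f z) = (LINT x|lborel. indicator (\<psi> ` A) (vec2_complex x) *\<^sub>R f (vec2_complex x))"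
    by (subst lborel_vec2_complex) (rule integral_distr[OF meas m])
  moreover have "integrable lborel (\<lambda>x. indicator (\<psi> ` A) (vec2_complex x) *\<^sub>R f (vec2_complex x))"
    using si unfolding set_integrable_def
    by (subst (asm) lborel_vec2_complex) (simp add: integrable_distr_eq[OF meas m])
  moreover have "indicator (\<psi> ` A) (vec2_complex x) = (indicator E x :: real)" for x using E[of x] by (simp add: indicator_def)
  ultimately have e: "(LINT z:\<psi> ` A|lborel. f z) = (LINT x:E|lborel. f (vec2_complex x))"
    and i: "set_integrable lborel E (\<lambda>x. f (vec2_complex x))"
    by (simp_all add: set_lebesgue_integral_def set_integrable_def)
  have ai: "(\<lambda>x. f (vec2_complex x)) absolutely_integrable_on E"
    using i integrable_completion[of "\<lambda>x. indicator E x *\<^sub>R f (vec2_complex x)" lborel]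
    by (auto simp: set_integrable_def borel_measurable_integrable)
  \<comment> \<open>The substitution theorem is applied to vector-valued integrands, so complex
    values are encoded as vectors and decoded afterwards.\<close>
  define F where "F = complex_vec2 \<circ> (\<lambda>x. f (vec2_complex x))"
  have aF: "F absolutely_integrable_on T ` S"
    unfolding F_def E_def[symmetric] by (rule absolutely_integrable_linear[OF ai bounded_linear_complex_vec2])
  have cov: "(\<lambda>x. \<bar>det (matrix (T' x))\<bar> *\<^sub>R F (T x)) absolutely_integrable_on S \<and>
      integral S (\<lambda>x. \<bar>det (matrix (T' x))\<bar> *\<^sub>R F (T x)) = integral (T ` S) F"
    using has_absolute_integral_change_of_variables[OF Sm Td Tinj, of F "integral (T ` S) F"] aF by blast
  have "(LINT z:\<psi> ` A|lborel. f z) = integral E (\<lambda>x. f (vec2_complex x))"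
    unfolding e by (rule set_borel_integral_eq_integral(2)[OF i])
  also have "\<dots> = integral E (vec2_complex \<circ> F)" by (simp add: F_def o_def)
  also have "\<dots> = vec2_complex (integral E F)"
    using aF by (intro integral_linear bounded_linear_vec2_complex)
      (auto simp: E_def absolutely_integrable_on_def intro: set_lebesgue_integral_eq_integral(1))
  also have "\<dots> = vec2_complex (integral S (\<lambda>x. \<bar>det (matrix (T' x))\<bar> *\<^sub>R F (T x)))"
    using cov by (simp add: E_def)
  also have "\<dots> = integral S (vec2_complex \<circ> (\<lambda>x. \<bar>det (matrix (T' x))\<bar> *\<^sub>R F (T x)))"
    using cov by (intro integral_linear[symmetric] bounded_linear_vec2_complex)
      (auto intro: set_lebesgue_integral_eq_integral(1))
  also have "\<dots> = integral S (\<lambda>x. of_real (x $ 1) * (of_real ((norm (deriv \<psi> (p x)))\<^sup>2) * f (\<psi> (p x))))"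
  proof (rule Henstock_Kurzweil_Integration.integral_cong)
    fix x assume x: "x \<in> S"
    have "(vec2_complex \<circ> (\<lambda>x. \<bar>det (matrix (T' x))\<bar> *\<^sub>R F (T x))) x = \<bar>det (matrix (T' x))\<bar> *\<^sub>R f (\<psi> (p x))"
      using bounded_linear_vec2_complex by (simp add: linear_simps F_def T_def)
    then show "(vec2_complex \<circ> (\<lambda>x. \<bar>det (matrix (T' x))\<bar> *\<^sub>R F (T x))) x =
        of_real (x $ 1) * (of_real ((norm (deriv \<psi> (p x)))\<^sup>2) * f (\<psi> (p x)))"
      by (simp add: det[OF x] scaleR_conv_of_real)
  qed
  also have "\<dots> = integral Q (\<lambda>x. of_real (x $ 1) * (of_real ((norm (deriv \<psi> (p x)))\<^sup>2) * f (\<psi> (p x))))"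
    using QS SQ(1) by (intro integral_spike_set) (auto intro: negligible_subset simp: Diff_eq_empty_iff[THEN iffD2])
  also have "\<dots> = integral {1-\<delta>..1} (\<lambda>r. integral {0..2*pi} (\<lambda>t. of_real r *
      (of_real ((norm (deriv \<psi> (of_real r * cis t)))\<^sup>2) * f (\<psi> (of_real r * cis t)))))"
  proof -
    have "continuous_on (annulus \<delta>) (\<lambda>z. of_real ((norm (deriv \<psi> z))\<^sup>2) * f (\<psi> z))"
    proof (intro continuous_intros)
      show "continuous_on (annulus \<delta>) (deriv \<psi>)"
        using holomorphic_deriv[OF \<psi>(1) G(1)] G(2) by (meson holomorphic_on_imp_continuous_on holomorphic_on_subset)
      show "continuous_on (annulus \<delta>) (\<lambda>z. f (\<psi> z))" by (rule continuous_on_compose2[OF f \<psi>c]) auto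
    qed
    from continuous_on_polar[OF this] have "continuous_on (cbox (1-\<delta>, 0) (1, 2*pi))
      (\<lambda>(r, t). of_real r * (of_real ((norm (deriv \<psi> (of_real r * cis t)))\<^sup>2) * f (\<psi> (of_real r * cis t))))"
      using d by (auto simp: cbox_Pair_eq case_prod_unfold intro!: continuous_on_mult continuous_on_of_real continuous_on_fst)
    from integral_cbox_vec2[OF this] show ?thesis
      unfolding Q_def p_def by (simp add: vec2_pair_def)
  qed
  finally show "(LINT z:\<psi> ` A|lborel. f z) = polar_integral \<delta> (\<lambda>z. of_real ((norm (deriv \<psi> z))\<^sup>2) * f (\<psi> z))"
    unfolding polar_integral_def .
qed

subsection \<open>The exterior conformal map\<close>

text \<open>By the Jordan curve theorem the curve is the boundary of both complementary components.
  Hence boundary points are limits of exterior points, from which the boundary values of \<phi> are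
  obtained.\<close>

lemma analytic_jordan_domain_props:
  assumes "analytic_jordan_domain D"
  shows "open D" "bounded D" "frontier D \<subseteq> closure (- closure D)"
proof -
  obtain h A where h: "open A" "sphere 0 1 \<subseteq> A" "h holomorphic_on A" "inj_on h A"
    "D = inside (h ` sphere 0 1)"
    using assms unfolding analytic_jordan_domain_def by blast
  define c where "c = h \<circ> circlepath 0 1"
  have img: "path_image c = h ` sphere 0 1" by (simp add: c_def path_image_compose)
  have "simple_path c" unfolding c_def
  proof (rule simple_path_continuous_image)
    show "simple_path (circlepath 0 1)" by (simp add: simple_path_circlepath)
    show "continuous_on (path_image (circlepath 0 1)) h"
      using holomorphic_on_imp_continuous_on[OF h(3)] h(2) continuous_on_subset by simp blast
    show "inj_on h (path_image (circlepath 0 1))" using h(2,4) inj_on_subset by simp blast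
  qed
  moreover have "pathfinish c = pathstart c" by (simp add: c_def pathfinish_compose pathstart_compose)
  ultimately have J: "open (inside (path_image c))" "bounded (inside (path_image c))"
     "inside (path_image c) \<inter> outside (path_image c) = {}"
     "inside (path_image c) \<union> outside (path_image c) = - path_image c"
     "frontier (inside (path_image c)) = path_image c" "frontier (outside (path_image c)) = path_image c"
    using Jordan_inside_outside[of c] by auto
  note D = h(5)[folded img]
  show "open D" "bounded D" using J D by auto
  have "closure D = D \<union> path_image c" using J(5) D closure_Un_frontier by metis
  then have "- closure D = outside (path_image c)" using J(3,4) D by blast
  moreover have "frontier D = frontier (outside (path_image c))" using J(5,6) D by simp
  moreover have "frontier T \<subseteq> closure T" for T :: "complex set" by (simp add: frontier_def)
  ultimately show "frontier D \<subseteq> closure (- closure D)" by simp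
qed

locale exterior_map =
  fixes D U :: "complex set" and \<phi> :: "complex \<Rightarrow> complex" and c :: real
  assumes dom: "analytic_jordan_domain D" and conf: "exterior_conformal_map D U \<phi> c"
begin

lemmas D_props = analytic_jordan_domain_props[OF dom]

lemma \<phi>_props: "open U" "- D \<subseteq> U" "\<phi> holomorphic_on U" "inj_on \<phi> U"
  "\<phi> ` (- closure D) = {z. 1 < norm z}" "filterlim \<phi> at_infinity at_infinity" "0 < c"
  using conf unfolding exterior_conformal_map_def by auto

lemma frontier_D: "frontier D = closure D - D"
  using D_props(1) by (simp add: frontier_def interior_open)

lemma \<phi>_continuous: "continuous_on U \<phi>"
  using \<phi>_props(3) by (rule holomorphic_on_imp_continuous_on)

lemma norm_\<phi>_exterior: "z \<notin> closure D \<Longrightarrow> 1 < norm (\<phi> z)"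
  using \<phi>_props(5) by blast

text \<open>Continuity from outside gives modulus at least 1. A larger modulus is excluded by
  injectivity, as such values are already taken outside the closure.\<close>

lemma norm_\<phi>_frontier:
  assumes z: "z \<in> frontier D"
  shows "norm (\<phi> z) = 1"
proof -
  have zD: "z \<in> - D" "z \<in> closure D" using z by (auto simp: frontier_D)
  have ge: "1 \<le> norm (\<phi> z)"
  proof -
    obtain w where w: "\<And>n. w n \<in> - closure D" "w \<longlonglongrightarrow> z"
      using D_props(3) z closure_sequential by blast
    have wU: "w n \<in> U" for n using w(1)[of n] \<phi>_props(2) closure_subset by blast
    have zU: "z \<in> U" using zD \<phi>_props(2) by blast
    have "(\<lambda>n. norm (\<phi> (w n))) \<longlonglongrightarrow> norm (\<phi> z)"
      using continuous_on_tendsto_compose[OF \<phi>_continuous w(2) zU] wU by (intro tendsto_norm) auto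
    then show ?thesis by (rule LIMSEQ_le_const) (use w(1) norm_\<phi>_exterior in \<open>auto intro: less_imp_le\<close>)
  qed
  have "\<not> 1 < norm (\<phi> z)"
  proof
    assume "1 < norm (\<phi> z)"
    then obtain w where w: "w \<in> - closure D" "\<phi> w = \<phi> z" using \<phi>_props(5) by (metis (mono_tags, lifting) imageE mem_Collect_eq)
    then have "w = z" using \<phi>_props(2,4) zD closure_subset by (metis ComplD ComplI inj_onD subsetD)
    then show False using w zD by simp
  qed
  with ge show ?thesis by simp
qed

lemma \<phi>_compl: "\<phi> ` (- D) = closed_exterior"
proof
  show "\<phi> ` (- D) \<subseteq> closed_exterior"
  proof clarify
    fix z assume "z \<notin> D"
    then show "\<phi> z \<in> closed_exterior"
      using norm_\<phi>_exterior[of z] norm_\<phi>_frontier[of z] by (cases "z \<in> closure D") (auto simp: closed_exterior_def frontier_D)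
  qed
  show "closed_exterior \<subseteq> \<phi> ` (- D)"
  proof
    fix z assume z: "z \<in> closed_exterior"
    show "z \<in> \<phi> ` (- D)"
    proof (cases "1 < norm z")
      case True
      then show ?thesis using \<phi>_props(5) closure_subset by blast
    next
      case False
      then have nz: "norm z = 1" using z by (simp add: closed_exterior_def)
      \<comment> \<open>A circle point is approached radially from outside, where preimages are
        known; a limit of the preimages is the preimage sought.\<close>
      define s where "s n = of_real (1 + 1 / real (Suc n)) * z" for n
      have s_lim: "s \<longlonglongrightarrow> z"
      proof -
        have "(\<lambda>n. of_real (1 + 1 / real (Suc n)) * z) \<longlonglongrightarrow> of_real (1 + 0) * z"
          by (intro tendsto_intros LIMSEQ_Suc[OF lim_1_over_n])
        then show ?thesis by (simp add: s_def[abs_def])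
      qed
      have s1: "1 < norm (s n)" "norm (s n) \<le> 2" for n
        using nz by (simp_all add: s_def norm_mult del: of_real_add)
      have "\<forall>n. \<exists>w. w \<in> - closure D \<and> \<phi> w = s n"
        using \<phi>_props(5) s1(1) by (metis (mono_tags, lifting) imageE mem_Collect_eq)
      then obtain w where w: "\<And>n. w n \<in> - closure D" "\<And>n. \<phi> (w n) = s n" by metis
      have "\<forall>\<^sub>F x in at_infinity. 3 \<le> norm (\<phi> x)"
        using \<phi>_props(6) unfolding filterlim_at_infinity_conv_norm_at_top filterlim_at_top by blast
      \<comment> \<open>The threshold 3 exceeds the bound 2 on the points \<open>s n\<close>, so all
        their preimages lie in one ball and a subsequence converges.\<close>
      then obtain R where R: "\<And>x. R \<le> norm x \<Longrightarrow> 3 \<le> norm (\<phi> x)" unfolding eventually_at_infinity by blast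
      have "w n \<in> cball 0 R" for n
        using R[of "w n"] s1(2)[of n] w(2)[of n] by (cases "R \<le> norm (w n)") auto
      then obtain l r where l: "strict_mono r" "(w \<circ> r) \<longlonglongrightarrow> l"
        using compact_cball[of "0::complex" R] unfolding compact_def by meson
      have "closed (- D)" using D_props(1) by (simp add: closed_def)
      moreover have "w n \<in> - D" for n using w(1)[of n] closure_subset by blast
      ultimately have lD: "l \<in> - D" using closed_sequentially[OF _ _ l(2), of "- D"] by auto
      have "(w \<circ> r) n \<in> U" for n using \<open>\<And>n. w n \<in> - D\<close>[of "r n"] \<phi>_props(2) by auto
      then have "(\<lambda>n. \<phi> ((w \<circ> r) n)) \<longlonglongrightarrow> \<phi> l"
        by (intro continuous_on_tendsto_compose[OF \<phi>_continuous l(2)] always_eventually allI) (use lD \<phi>_props(2) in blast)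
      moreover have "(\<lambda>n. \<phi> ((w \<circ> r) n)) \<longlonglongrightarrow> z"
        using LIMSEQ_subseq_LIMSEQ[OF s_lim l(1)] by (simp add: w(2) o_def)
      ultimately have "\<phi> l = z" using LIMSEQ_unique by blast
      then show ?thesis using lD by blast
    qed
  qed
qed

lemma norm_\<phi>_ge_1_iff: "z \<in> U \<Longrightarrow> 1 \<le> norm (\<phi> z) \<longleftrightarrow> z \<notin> D"
proof
  assume z: "z \<in> U" "1 \<le> norm (\<phi> z)"
  then have "\<phi> z \<in> \<phi> ` (- D)" unfolding \<phi>_compl by (simp add: closed_exterior_def)
  then obtain w where "w \<in> - D" "\<phi> w = \<phi> z" by (metis imageE)
  then show "z \<notin> D" using \<phi>_props(2,4) z(1) by (metis ComplD inj_onD subsetD)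
next
  assume "z \<notin> D"
  then have "\<phi> z \<in> closed_exterior" using \<phi>_compl by blast
  then show "1 \<le> norm (\<phi> z)" by (simp add: closed_exterior_def)
qed

definition \<psi> :: "complex \<Rightarrow> complex" where "\<psi> = inv_into U \<phi>"

definition U' :: "complex set" where "U' = \<phi> ` U"

lemma \<psi>_\<phi>: "z \<in> U \<Longrightarrow> \<psi> (\<phi> z) = z"
  unfolding \<psi>_def by (rule inv_into_f_f[OF \<phi>_props(4)])

lemma \<phi>_\<psi>: "z \<in> U' \<Longrightarrow> \<phi> (\<psi> z) = z" and \<psi>_in_U: "z \<in> U' \<Longrightarrow> \<psi> z \<in> U"
  unfolding U'_def using \<psi>_\<phi> by auto

lemma U'_props: "open U'" "closed_exterior \<subseteq> U'"
proof -
  show "open U'" unfolding U'_def by (rule open_mapping_thm3[OF \<phi>_props(3,1,4)])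
  show "closed_exterior \<subseteq> U'" unfolding U'_def using \<phi>_compl \<phi>_props(2) by blast
qed

lemma \<psi>_props: "\<psi> holomorphic_on U'" "inj_on \<psi> U'" "\<psi> ` U' = U"
  "z \<in> U' \<Longrightarrow> deriv \<phi> (\<psi> z) * deriv \<psi> z = 1"
proof -
  obtain g where g: "g holomorphic_on \<phi> ` U" "\<And>z. z \<in> U \<Longrightarrow> deriv \<phi> z * deriv g (\<phi> z) = 1"
      "\<And>z. z \<in> U \<Longrightarrow> g (\<phi> z) = z"
    using holomorphic_has_inverse[OF \<phi>_props(3,1,4)] by blast
  have eq: "g z = \<psi> z" if "z \<in> U'" for z using that g(3) \<psi>_\<phi> by (auto simp: U'_def)
  then show "\<psi> holomorphic_on U'" using g(1) by (auto simp: U'_def intro: holomorphic_transform)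
  show "inj_on \<psi> U'" by (rule inj_on_inverseI[of _ \<phi>]) (rule \<phi>_\<psi>)
  show "\<psi> ` U' = U" unfolding U'_def using \<psi>_\<phi> by (auto simp: image_iff)
  assume z: "z \<in> U'"
  have "\<forall>\<^sub>F w in nhds z. g w = \<psi> w"
    using eq eventually_nhds_in_open[OF U'_props(1) z] by (auto elim: eventually_mono)
  then have "deriv g z = deriv \<psi> z" by (rule deriv_cong_ev) simp
  then show "deriv \<phi> (\<psi> z) * deriv \<psi> z = 1"
    using g(2)[OF \<psi>_in_U[OF z]] \<phi>_\<psi>[OF z] by simp
qed

lemma \<psi>_notin_D_iff: "z \<in> U' \<Longrightarrow> \<psi> z \<notin> D \<longleftrightarrow> 1 \<le> norm z"
  using norm_\<phi>_ge_1_iff[OF \<psi>_in_U] \<phi>_\<psi> by auto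

lemma \<psi>_closed_exterior: "\<psi> ` closed_exterior = - D"
proof
  show "\<psi> ` closed_exterior \<subseteq> - D"
    using \<psi>_notin_D_iff U'_props(2) by (auto simp: closed_exterior_def)
  show "- D \<subseteq> \<psi> ` closed_exterior"
  proof
    fix z assume z: "z \<in> - D"
    then have "\<phi> z \<in> closed_exterior" "\<psi> (\<phi> z) = z" using \<phi>_compl \<psi>_\<phi> \<phi>_props(2) by blast+
    then show "z \<in> \<psi> ` closed_exterior" by force
  qed
qed

lemma \<psi>_sphere: "\<psi> ` sphere 0 1 \<subseteq> frontier D"
proof clarify
  fix z :: complex assume "z \<in> sphere 0 1"
  then have z: "z \<in> U'" "norm z = 1" using U'_props(2) by (auto simp: closed_exterior_def)
  have "\<psi> z \<notin> D" using \<psi>_notin_D_iff[OF z(1)] z(2) by simp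
  moreover have "\<psi> z \<in> closure D" using norm_\<phi>_exterior[of "\<psi> z"] \<phi>_\<psi>[OF z(1)] z(2) by auto
  ultimately show "\<psi> z \<in> frontier D" by (simp add: frontier_D)
qed

lemma \<psi>_analytic: "\<psi> analytic_on closed_exterior"
  using \<psi>_props(1) U'_props by (auto simp: analytic_on_holomorphic)

text \<open>On the compact part of the complement of \<open>D\<close> inside a given ball \<phi> is
  bounded, so points of large modulus cannot be mapped there by \<psi>.\<close>

lemma \<psi>_at_infinity: "filterlim \<psi> at_infinity at_infinity"
  unfolding filterlim_at_infinity_conv_norm_at_top filterlim_at_top
proof
  fix R :: real
  have "compact (\<phi> ` (cball 0 R \<inter> - D))"
  proof (rule compact_continuous_image)
    show "continuous_on (cball 0 R \<inter> - D) \<phi>" by (rule continuous_on_subset[OF \<phi>_continuous]) (use \<phi>_props(2) in blast)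
    show "compact (cball 0 R \<inter> - D)" using D_props(1) by (intro compact_Int_closed) (auto simp: closed_def)
  qed
  then obtain R' where R': "R' > 0" "\<And>z. z \<in> cball 0 R \<inter> - D \<Longrightarrow> norm (\<phi> z) \<le> R'"
    using bounded_pos[of "\<phi> ` (cball 0 R \<inter> - D)"] compact_imp_bounded by blast
  have "R \<le> norm (\<psi> z)" if z: "max R' 1 + 1 \<le> norm z" for z
  proof (rule ccontr)
    assume "\<not> R \<le> norm (\<psi> z)"
    moreover have zU: "z \<in> closed_exterior" using z by (simp add: closed_exterior_def)
    then have "\<psi> z \<in> - D" using \<psi>_closed_exterior by blast
    ultimately have "norm (\<phi> (\<psi> z)) \<le> R'" by (intro R') auto
    then show False using \<phi>_\<psi> zU U'_props(2) z by auto
  qed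
  then show "\<forall>\<^sub>F z in at_infinity. R \<le> norm (\<psi> z)" unfolding eventually_at_infinity by blast
qed

lemma annulus_subset_U':
  "\<exists>e>0. e < 1 \<and> annulus e \<subseteq> U'"
proof -
  have "near (sphere 0 1) (\<lambda>z. z \<in> U')"
    unfolding near_def using U'_props by (intro exI[of _ U']) (auto simp: closed_exterior_def)
  from near_sphere_imp_annulus[OF this] show ?thesis by blast
qed

text \<open>The image \<open>Z\<close> of |z| > 1 - \<delta> is open and disjoint from the core, so
  it contains no boundary point of the core; what is left is the image of the inner circle. This is
  where the maximum principle will be applied.\<close>

lemma frontier_core:
  assumes d: "0 < \<delta>" "\<delta> < 1" and A: "annulus \<delta> \<subseteq> U'"
  shows "frontier (D - \<psi> ` annulus \<delta>) \<subseteq> \<psi> ` sphere 0 (1 - \<delta>)" "open (D - \<psi> ` annulus \<delta>)"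
proof -
  define O' where "O' = D - \<psi> ` annulus \<delta>"
  have cont: "continuous_on U' \<psi>" using \<psi>_props(1) by (rule holomorphic_on_imp_continuous_on)
  have "compact (\<psi> ` annulus \<delta>)"
    by (rule compact_continuous_image[OF continuous_on_subset[OF cont A] compact_annulus])
  then have oO: "open O'" unfolding O'_def using D_props(1) by (simp add: compact_imp_closed open_Diff)
  then show "open (D - \<psi> ` annulus \<delta>)" by (simp add: O'_def)
  define Z where "Z = \<psi> ` (U' \<inter> {z. 1 - \<delta> < norm z})"
  have oZ: "open Z" unfolding Z_def
  proof (rule open_mapping_thm3)
    show "\<psi> holomorphic_on U' \<inter> {z. 1 - \<delta> < norm z}" using \<psi>_props(1) by (rule holomorphic_on_subset) auto
    show "open (U' \<inter> {z. 1 - \<delta> < norm z})" by (intro open_Int U'_props open_Collect_less continuous_intros)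
    show "inj_on \<psi> (U' \<inter> {z. 1 - \<delta> < norm z})" using \<psi>_props(2) by (rule inj_on_subset) auto
  qed
  have "Z \<inter> O' = {}"
  proof -
    have "\<psi> z \<notin> O'" if z: "z \<in> U'" "1 - \<delta> < norm z" for z
    proof (cases "norm z \<le> 1")
      case True
      then have "z \<in> annulus \<delta>" using z by (simp add: annulus_def)
      then show ?thesis by (simp add: O'_def)
    next
      case False
      then show ?thesis using \<psi>_notin_D_iff[OF z(1)] by (auto simp: O'_def)
    qed
    then show ?thesis unfolding Z_def by blast
  qed
  then have ZO: "Z \<inter> closure O' = {}" using oZ by (simp add: open_Int_closure_eq_empty)
  have "frontier O' = closure O' - O'" using oO by (simp add: frontier_def interior_open)
  moreover have "w \<in> \<psi> ` sphere 0 (1 - \<delta>)" if w: "w \<in> closure O'" "w \<notin> O'" for w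
  proof -
    have wZ: "w \<notin> Z" using w ZO by blast
    have "w \<in> D"
    proof (rule ccontr)
      assume "w \<notin> D"
      then obtain z where "z \<in> closed_exterior" "w = \<psi> z" using \<psi>_closed_exterior by blast
      then have "w \<in> Z" unfolding Z_def using U'_props(2) d by (auto simp: closed_exterior_def)
      then show False using wZ by simp
    qed
    then obtain z where z: "z \<in> annulus \<delta>" "w = \<psi> z" using w(2) by (auto simp: O'_def)
    have "\<not> 1 - \<delta> < norm z" using wZ z A unfolding Z_def by blast
    then show ?thesis using z by (auto simp: annulus_def)
  qed
  ultimately show "frontier (D - \<psi> ` annulus \<delta>) \<subseteq> \<psi> ` sphere 0 (1 - \<delta>)" unfolding O'_def by blast
qed

text \<open>Radial segments have length at most \<open>\<delta>\<close> and \<open>\<psi>\<close> is Lipschitz along them.\<close>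

lemma infdist_\<psi>_annulus:
  assumes e: "0 < e" "e < 1" "annulus e \<subseteq> U'"
  shows "\<exists>L\<ge>0. \<forall>\<delta> z. 0 \<le> \<delta> \<longrightarrow> \<delta> \<le> e \<longrightarrow> z \<in> annulus \<delta> \<longrightarrow> infdist (\<psi> z) (- D) \<le> L * \<delta>"
proof -
  have "compact (deriv \<psi> ` annulus e)"
    using holomorphic_deriv[OF \<psi>_props(1) U'_props(1)] e(3)
    by (intro compact_continuous_image compact_annulus)
      (meson holomorphic_on_imp_continuous_on holomorphic_on_subset)
  then obtain L where L: "L > 0" "\<And>z. z \<in> annulus e \<Longrightarrow> norm (deriv \<psi> z) \<le> L"
    using bounded_pos[of "deriv \<psi> ` annulus e"] compact_imp_bounded by blast
  have "infdist (\<psi> z) (- D) \<le> L * \<delta>" if d: "0 \<le> \<delta>" "\<delta> \<le> e" and z: "z \<in> annulus \<delta>" for \<delta> z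
  proof -
    have nz: "z \<noteq> 0" and nz1: "1 - \<delta> \<le> norm z" "norm z \<le> 1" using z d e by (auto simp: annulus_def)
    have s: "norm (sgn z) = 1" using nz by (simp add: norm_sgn)
    have zs: "z = of_real (norm z) * sgn z" using nz by (simp add: sgn_div_norm scaleR_conv_of_real)
    have seg: "closed_segment z (sgn z) \<subseteq> annulus e"
    proof
      fix x assume "x \<in> closed_segment z (sgn z)"
      then obtain u where u: "0 \<le> u" "u \<le> 1" "x = (1 - u) *\<^sub>R z + u *\<^sub>R sgn z"
        unfolding closed_segment_def by blast
      have "x = of_real ((1 - u) * norm z + u) * sgn z"
        using u(3) zs by (simp add: scaleR_conv_of_real distrib_right mult.assoc)
      then have "norm x = \<bar>(1 - u) * norm z + u\<bar>" using s by (simp only: norm_mult norm_of_real mult_1_right)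
      moreover have "norm z \<le> (1 - u) * norm z + u"
        using u nz1 mult_left_mono[OF nz1(2), of u] by (simp add: algebra_simps)
      moreover have "(1 - u) * norm z + u \<le> 1"
        using u nz1 mult_left_mono[OF nz1(2), of "1 - u"] by simp
      ultimately show "x \<in> annulus e" using nz1 d e unfolding annulus_def by auto
    qed
    have "norm (\<psi> z - \<psi> (sgn z)) \<le> L * norm (z - sgn z)"
    proof (rule field_differentiable_bound[of "closed_segment z (sgn z)"])
      fix x assume x: "x \<in> closed_segment z (sgn z)"
      show "(\<psi> has_field_derivative deriv \<psi> x) (at x within closed_segment z (sgn z))"
        using holomorphic_derivI[OF \<psi>_props(1) U'_props(1), of x] seg x e(3) by blast
      show "norm (deriv \<psi> x) \<le> L" using L(2) seg x by blast
    qed auto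
    also have "\<dots> \<le> L * \<delta>"
      using dist_sgn[OF nz] nz1 L(1) by (intro mult_left_mono) (auto simp: dist_norm)
    finally have "dist (\<psi> z) (\<psi> (sgn z)) \<le> L * \<delta>" by (simp add: dist_norm)
    moreover have "\<psi> (sgn z) \<in> - D"
      using \<psi>_closed_exterior s by (auto simp: closed_exterior_def)
    ultimately show ?thesis using infdist_le2 by blast
  qed
  then show ?thesis using L(1) by (intro exI[of _ L]) auto
qed

end

lemma integral_area_measure:
  fixes f :: "complex \<Rightarrow> complex"
  assumes "f \<in> borel_measurable lborel"
  shows "integral\<^sup>L area_measure f = integral\<^sup>L lborel f / of_real pi"
proof -
  have "area_measure = density lborel (\<lambda>_. ennreal (1 / pi))"
    unfolding area_measure_def by (rule measure_eqI) (auto simp: emeasure_density nn_integral_cmult_indicator)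
  then have "integral\<^sup>L area_measure f = (LINT z|lborel. (1 / pi) *\<^sub>R f z)"
    using integral_density[of f lborel "\<lambda>_. 1 / pi"] assms by simp
  then show ?thesis by (simp add: scaleR_conv_of_real)
qed

section \<open>The weight in exterior coordinates\<close>

locale weighted_exterior = exterior_map D U \<phi> c
  for D U :: "complex set" and \<phi> :: "complex \<Rightarrow> complex" and c :: real +
  fixes \<omega> \<Omega> :: "complex \<Rightarrow> real" and V :: "complex \<Rightarrow> complex" and v :: real
  assumes weight: "admissible_weight D \<omega>" and szego: "szego_function D \<omega> V v"
    and Omega: "\<Omega> = modified_weight \<omega> U \<phi> V"
begin

text \<open>A fixed choice, because the neighbourhood is a parameter of
  \<open>circle_germ\<close>.\<close>

definition G where "G = (SOME G. open G \<and> frontier D \<subseteq> G \<and> (\<forall>z\<in>G. 0 < \<omega> z) \<and> real_analytic_on (\<lambda>z. ln (\<omega> z)) G)"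

lemma G: "open G" "frontier D \<subseteq> G" "\<And>z. z \<in> G \<Longrightarrow> 0 < \<omega> z" "real_analytic_on (\<lambda>z. ln (\<omega> z)) G"
proof -
  have "\<exists>G. open G \<and> frontier D \<subseteq> G \<and> (\<forall>z\<in>G. 0 < \<omega> z) \<and> real_analytic_on (\<lambda>z. ln (\<omega> z)) G"
    using weight unfolding admissible_weight_def by blast
  from someI_ex[OF this] show "open G" "frontier D \<subseteq> G" "\<And>z. z \<in> G \<Longrightarrow> 0 < \<omega> z" "real_analytic_on (\<lambda>z. ln (\<omega> z)) G"
    unfolding G_def by blast+
qed

lemma V_props: "V analytic_on (- D)" "\<And>z. z \<in> frontier D \<Longrightarrow> 2 * Re (V z) = - ln (\<omega> z)"
  using szego unfolding szego_function_def by auto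

lemma V\<psi>_analytic: "(\<lambda>z. V (\<psi> z)) analytic_on closed_exterior"
  using analytic_on_compose[OF \<psi>_analytic, of V] V_props(1) \<psi>_closed_exterior by (simp add: o_def)

text \<open>The logarithm of \<open>\<Omega>\<close>, split into a holomorphic, an antiholomorphic
  and a composed real-analytic summand to match the clauses of \<open>circle_germ\<close>.\<close>

definition \<rho> :: "complex \<Rightarrow> complex" where
  "\<rho> z = (V (\<psi> z) + cnj (V (\<psi> z))) + of_real (ln (\<omega> (\<psi> z)))"

lemma \<Omega>_eq: "\<Omega> z = exp (2 * Re (V (\<psi> z))) * \<omega> (\<psi> z)"
  unfolding Omega modified_weight_def \<psi>_def ..

lemma \<Omega>_circle: "norm z = 1 \<Longrightarrow> \<Omega> z = 1"
proof -
  assume "norm z = 1"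
  then have f: "\<psi> z \<in> frontier D" using \<psi>_sphere by auto
  then have "\<omega> (\<psi> z) > 0" using G(2,3) by blast
  then show ?thesis using V_props(2)[OF f] by (simp add: \<Omega>_eq exp_minus)
qed

sublocale circle_weight \<psi> G \<Omega> \<rho>
proof
  show "open G" by (rule G(1))
  show an: "\<psi> analytic_on sphere 0 1" by (rule closed_exterior_analytic_on_sphere[OF \<psi>_analytic])
  show sub: "\<psi> ` sphere 0 1 \<subseteq> G" using \<psi>_sphere G(2) by blast
  have Va: "(\<lambda>z. V (\<psi> z)) analytic_on sphere 0 1" by (rule closed_exterior_analytic_on_sphere[OF V\<psi>_analytic])
  show "circle_germ \<psi> G \<rho>" unfolding \<rho>_def[abs_def]
    by (intro circle_germ.add circle_germ.hol[OF Va] circle_germ.cnj[OF Va]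
        circle_germ.comp[OF real_analytic_of_real[OF G(4)]])
  have "open (U' \<inter> \<psi> -` G)"
    using continuous_open_preimage[OF holomorphic_on_imp_continuous_on[OF \<psi>_props(1)] U'_props(1) G(1)] .
  moreover have "sphere 0 1 \<subseteq> U' \<inter> \<psi> -` G" using sub U'_props(2) by (auto simp: closed_exterior_def)
  moreover have "complex_of_real (\<Omega> z) = exp (\<rho> z)" if "z \<in> U' \<inter> \<psi> -` G" for z
  proof -
    have pos: "\<omega> (\<psi> z) > 0" using that G(3) by blast
    have V2: "V (\<psi> z) + cnj (V (\<psi> z)) = of_real (2 * Re (V (\<psi> z)))" by (simp add: complex_add_cnj)
    show ?thesis
      unfolding \<rho>_def \<Omega>_eq V2 exp_add exp_of_real exp_ln[OF pos] by (rule of_real_mult)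
  qed
  ultimately show "near (sphere 0 1) (\<lambda>z. complex_of_real (\<Omega> z) = exp (\<rho> z))"
    unfolding near_def by blast
qed

text \<open>Continuity is assumed inside \<open>D\<close>; across the boundary it comes from the
  real-analytic logarithm, and the two open sets cover the closure.\<close>

lemma \<omega>_continuous: "continuous_on (closure D) \<omega>"
proof -
  have c1: "continuous_on G (\<lambda>z. exp (ln (\<omega> z)))"
  proof -
    have "isCont (\<lambda>z. complex_of_real (ln (\<omega> z))) z" if "z \<in> G" for z
      using real_analytic_has_derivative(3)[OF real_analytic_of_real[OF G(4)] that] has_derivative_continuous by blast
    then have "continuous_on G (\<lambda>z. Re (complex_of_real (ln (\<omega> z))))"
      by (intro continuous_on_Re continuous_at_imp_continuous_on) blast
    then show ?thesis by (intro continuous_on_exp) simp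
  qed
  then have c1: "continuous_on G \<omega>" by (rule continuous_on_eq) (use G(3) in simp)
  have c2: "continuous_on D \<omega>" using weight by (simp add: admissible_weight_def)
  have "continuous_on (D \<union> G) \<omega>" by (rule continuous_on_open_Un[OF D_props(1) G(1) c2 c1])
  moreover have "closure D \<subseteq> D \<union> G" using G(2) by (auto simp: frontier_D)
  ultimately show ?thesis by (rule continuous_on_subset)
qed

lemma \<omega>_bounded: "\<exists>K>0. \<forall>z\<in>D. \<bar>\<omega> z\<bar> \<le> K"
proof -
  have "compact (\<omega> ` closure D)"
    using D_props(2) by (intro compact_continuous_image \<omega>_continuous) (simp add: compact_closure)
  then obtain K where "K > 0" "\<And>z. z \<in> closure D \<Longrightarrow> norm (\<omega> z) \<le> K"
    using bounded_pos[of "\<omega> ` closure D"] compact_imp_bounded by blast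
  then show ?thesis using closure_subset[of D] by (intro exI[of _ K]) auto
qed

text \<open>On the circle the weight is 1 and the powers z^M and cnj z^M cancel. The surplus z^m is
  the conjugate of z^(-m), which turns the trace into a pairing with an exterior function.\<close>

lemma integral_kernel_circle:
  assumes "M + m = N"
  shows "integral {0..2*pi} (\<lambda>t. kernel N M f h (cis t)) =
     integral {0..2*pi} (\<lambda>t. f (cis t) * cnj (cis t powi (- int m) * h (cis t)))"
proof (rule Henstock_Kurzweil_Integration.integral_cong)
  fix t :: real
  have 1: "cis t ^ M * cnj (cis t ^ M) = 1" by (simp add: cis_cnj cis_mult flip: power_mult_distrib)
  have 2: "cnj (cis t powi (- int m)) = cis t ^ m" using Complex.DeMoivre[of t m] by (simp add: cis_power_int cis_cnj)
  have "kernel N M f h (cis t) = (cis t ^ M * cnj (cis t ^ M)) * (cis t ^ m * cnj (h (cis t)) * f (cis t))"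
    by (simp add: kernel_def \<Omega>_circle power_add mult_ac flip: assms)
  then show "kernel N M f h (cis t) = f (cis t) * cnj (cis t powi (- int m) * h (cis t))"
    unfolding 1 complex_cnj_mult 2 by (simp add: mult_ac)
qed

end

text \<open>For an analytic trace the Laurent splitting suffices: its exterior part lies in both
  Hardy spaces, so it vanishes, and the remainder is orthogonal to \<open>h\<close>.\<close>

lemma H2_orthogonal:
  assumes u: "circle_analytic u" "u \<in> H2" and h: "h \<in> H2_minus0"
  shows "circle_inner u h = 0"
proof -
  obtain g where g: "g analytic_on sphere 0 1" "\<And>z. norm z = 1 \<Longrightarrow> u z = g z"
    using u(1) unfolding circle_analytic_def by blast
  obtain F where F: "F \<in> H2_minus0" "(\<lambda>z. g z - F z) \<in> H2" "circle_inner (\<lambda>z. g z - F z) h = 0"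
    using Laurent_splitting[OF g(1)] h by metis
  have gH: "g \<in> H2" using u(2) H2_cong[OF g(2)] by simp
  have "(\<lambda>z. g z - (g z - F z)) \<in> H2" by (rule H2_diff[OF gH F(2)])
  then have "circle_eq F (\<lambda>_. 0)" using H2_Int_H2_minus0[OF _ F(1)] by simp
  moreover have L: "g \<in> L2_circle" "F \<in> L2_circle" "h \<in> L2_circle" "(\<lambda>_. 0) \<in> L2_circle"
    using gH F(1) h by (auto simp: H2_def H2_minus0_def intro: continuous_in_L2_circle)
  ultimately have "circle_inner F h = circle_inner (\<lambda>_. 0) h"
    by (intro circle_inner_cong_circle_eq)
  then have "circle_inner g h = 0"
    using F(3) circle_inner_diff[OF L(1,2,3)] by (simp add: circle_inner_def)
  then show ?thesis using circle_inner_cong[of u g h h] g(2) by simp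
qed

lemma integral_eq_circle_inner:
  assumes "continuous_on (sphere 0 1) f" "continuous_on (sphere 0 1) g"
  shows "integral {0..2*pi} (\<lambda>t. f (cis t) * cnj (g (cis t))) = 2 * of_real pi * circle_inner f g"
proof -
  have "continuous_on {0..2*pi} (\<lambda>t. f (cis t) * cnj (g (cis t)))"
    by (intro continuous_intros continuous_on_cis_comp assms)
  from integral_angle_continuous[OF this] show ?thesis by (simp add: circle_inner_def)
qed

lemma polar_integral_diff:
  assumes "continuous_on (annulus \<delta>) G" "continuous_on (annulus \<delta>) H" "\<delta> \<le> 1"
  shows "polar_integral \<delta> (\<lambda>z. G z - H z) = polar_integral \<delta> G - polar_integral \<delta> H"
  using polar_integral_add[OF assms(1) continuous_on_minus[OF assms(2)] assms(3)]
    polar_integral_cmult[of \<delta> "-1" H] by simp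

section \<open>Collars of width tending to zero\<close>

lemma eventually_small_annulus:
  assumes "e > 0" "\<And>\<delta>. 0 < \<delta> \<Longrightarrow> \<delta> \<le> e \<Longrightarrow> P \<delta>"
  shows "\<forall>\<^sub>F \<delta> in at_right (0::real). P \<delta>"
  unfolding eventually_at_right_field using assms by (intro exI[of _ e]) auto

lemma near_sphere_eventually_annulus:
  assumes "near (sphere 0 1) P"
  shows "\<forall>\<^sub>F \<delta> in at_right 0. \<forall>z\<in>annulus \<delta>. P z"
proof -
  obtain e where "e > 0" "\<And>z. z \<in> annulus e \<Longrightarrow> P z" using near_sphere_imp_annulus[OF assms] by blast
  then show ?thesis using annulus_mono by (intro eventually_small_annulus[of e]) auto
qed

lemma ln_over_at_right_0:
  assumes "a > 0"
  shows "filterlim (\<lambda>N. a * ln (real N) / real N) (at_right 0) sequentially"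
  unfolding filterlim_at
proof
  have "(\<lambda>N. ln (real N) / real N) \<longlonglongrightarrow> 0" by (rule lim_ln_over_n)
  from tendsto_mult_left[OF this, of a] show "(\<lambda>N. a * ln (real N) / real N) \<longlonglongrightarrow> 0" by simp
  show "\<forall>\<^sub>F N in sequentially. a * ln (real N) / real N \<in> {0<..} \<and> a * ln (real N) / real N \<noteq> 0"
    using eventually_ge_at_top[of 2] by eventually_elim (use assms in auto)
qed

text \<open>Here (1 - x)^N \<le> e^(-N x), with equality of e^(-N x) and N^(-a). The coefficient of
  the width is thus the number of powers of N gained; the hypothesis keeps the base
  nonnegative.\<close>

lemma one_minus_power_bound:
  assumes "N \<ge> 1" "real a * ln (real N) / real N \<le> 1"
  shows "(1 - real a * ln (real N) / real N) ^ N \<le> 1 / real N ^ a"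
proof -
  define x where "x = real a * ln (real N) / real N"
  have "1 - x \<le> exp (- x)" using exp_ge_add_one_self[of "- x"] by simp
  then have "(1 - x) ^ N \<le> exp (- x) ^ N" using assms(2) by (intro power_mono) (auto simp: x_def)
  also have "\<dots> = exp (- (real a * ln (real N)))" using assms(1) by (simp add: x_def flip: exp_of_nat_mult)
  also have "\<dots> = 1 / real N ^ a" using assms(1) by (simp add: exp_minus exp_of_nat_mult inverse_eq_divide)
  finally show ?thesis by (simp add: x_def)
qed

context circle_weight
begin

lemma op_T_sum:
  assumes "finite I" "\<And>i. i \<in> I \<Longrightarrow> circle_germ \<psi> S (f i)"
  shows "near (sphere 0 1) (\<lambda>z. op_T \<Omega> (\<lambda>z. \<Sum>i\<in>I. k i * f i z) z = (\<Sum>i\<in>I. k i * op_T \<Omega> (f i) z))"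
  using assms
proof (induction I rule: finite_induct)
  case empty
  have "near (sphere 0 1) (\<lambda>z. op_T \<Omega> (\<lambda>z. 0) z = 0 * op_T \<Omega> (\<lambda>z. 0) z + 0 * op_T \<Omega> (\<lambda>z. 0) z)"
    by (rule op_T_linear[OF circle_germ_const circle_germ_const]) (simp add: near_iff)
  then show ?case by simp
next
  case (insert i I)
  have 1: "near (sphere 0 1) (\<lambda>z. op_T \<Omega> (\<lambda>z. k i * f i z + (\<Sum>i\<in>I. k i * f i z)) z =
      k i * op_T \<Omega> (f i) z + 1 * op_T \<Omega> (\<lambda>z. \<Sum>i\<in>I. k i * f i z) z)"
    using insert by (intro op_T_linear circle_germ_sum circle_germ_cmult) (auto simp: near_iff)
  have 2: "near (sphere 0 1) (\<lambda>z. op_T \<Omega> (\<lambda>z. \<Sum>i\<in>I. k i * f i z) z = (\<Sum>i\<in>I. k i * op_T \<Omega> (f i) z))"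
    using insert by simp
  show ?case using 1 2 by (rule near_elim2) (use insert in simp)
qed

lemma op_T_cong:
  assumes "circle_germ \<psi> S f" "near (sphere 0 1) (\<lambda>z. f z = g z)"
  shows "near (sphere 0 1) (\<lambda>z. op_T \<Omega> f z = op_T \<Omega> g z)"
proof -
  have "near (sphere 0 1) (\<lambda>z. op_T \<Omega> g z = 1 * op_T \<Omega> f z + 0 * op_T \<Omega> f z)"
    using assms by (intro op_T_linear) (auto elim: near_mono)
  then show ?thesis by (rule near_mono) simp
qed

text \<open>With a filter on the width, finitely many conditions on the collar combine without
  minima; \<open>C\<close> is fixed before the filter and stays uniform in \<delta>.\<close>

lemma one_step_eventually:
  assumes "circle_germ \<psi> S f"
  shows "\<exists>C\<ge>0. \<forall>\<^sub>F \<delta> in at_right 0. \<forall>h B N M. h analytic_on annulus \<delta> \<longrightarrow> (\<forall>z\<in>annulus \<delta>. norm (h z) \<le> B) \<longrightarrow>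
     norm (polar_integral \<delta> (kernel N M f h)) \<le> C * B / real (N + 1) \<and>
     norm (of_nat N * polar_integral \<delta> (kernel N M f h) + polar_integral \<delta> (kernel N M (op_T \<Omega> f) h)
       - integral {0..2*pi} (\<lambda>t. kernel N M f h (cis t)) / 2) \<le> C * B * (1-\<delta>) ^ N"
proof -
  obtain e C where e: "e > 0" "C \<ge> 0" "\<forall>\<delta> h B N M. 0 < \<delta> \<longrightarrow> \<delta> \<le> e \<longrightarrow> h analytic_on annulus \<delta> \<longrightarrow> (\<forall>z\<in>annulus \<delta>. norm (h z) \<le> B) \<longrightarrow>
     norm (polar_integral \<delta> (kernel N M f h)) \<le> C * B / real (N + 1) \<and>
     norm (of_nat N * polar_integral \<delta> (kernel N M f h) + polar_integral \<delta> (kernel N M (op_T \<Omega> f) h)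
       - integral {0..2*pi} (\<lambda>t. kernel N M f h (cis t)) / 2) \<le> C * B * (1-\<delta>) ^ N"
    using one_step[OF assms] by blast
  show ?thesis
    by (rule exI[of _ C], rule conjI[OF e(2)], rule eventually_small_annulus[OF e(1)]) (use e(3) in blast)
qed

lemma circle_germ_eventually_continuous:
  assumes "circle_germ \<psi> S f"
  shows "\<forall>\<^sub>F \<delta> in at_right 0. continuous_on (annulus \<delta>) f"
  using near_sphere_eventually_annulus[OF circle_germ_isCont[OF assms]]
  by eventually_elim (blast intro: continuous_at_imp_continuous_on)

lemma circle_germ_eventually_bounded:
  assumes "circle_germ \<psi> S f"
  shows "\<exists>K\<ge>0. \<forall>\<^sub>F \<delta> in at_right 0. \<forall>z\<in>annulus \<delta>. norm (f z) \<le> K"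
proof -
  obtain e where e: "e > 0" "continuous_on (annulus e) f" using circle_germ_continuous_annulus[OF assms] by blast
  have "bounded (f ` annulus e)" by (intro compact_imp_bounded compact_continuous_image e compact_annulus)
  then obtain K where K: "K > 0" "\<And>z. z \<in> annulus e \<Longrightarrow> norm (f z) \<le> K"
    using bounded_pos[of "f ` annulus e"] by blast
  then show ?thesis using annulus_mono
    by (intro exI[of _ K] conjI eventually_small_annulus[OF e(1)]) (auto simp: less_imp_le)
qed

lemma \<Omega>_eventually_continuous: "\<forall>\<^sub>F \<delta> in at_right 0. continuous_on (annulus \<delta>) (\<lambda>z. complex_of_real (\<Omega> z))"
proof -
  obtain e where e: "e > 0" "continuous_on (annulus e) (\<lambda>z. complex_of_real (\<Omega> z))"
    using circle_germ_continuous_annulus[OF circle_germ_const[of \<psi> S 0]] by blast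
  show ?thesis
    by (rule eventually_small_annulus[OF e(1)]) (rule continuous_on_subset[OF e(2) annulus_mono])
qed

lemma \<Omega>_eventually_bounded: "\<exists>K\<ge>0. \<forall>\<^sub>F \<delta> in at_right 0. \<forall>z\<in>annulus \<delta>. norm (complex_of_real (\<Omega> z)) \<le> K"
proof -
  obtain e where e: "e > 0" "continuous_on (annulus e) (\<lambda>z. complex_of_real (\<Omega> z))"
    using circle_germ_continuous_annulus[OF circle_germ_const[of \<psi> S 0]] by blast
  have "bounded ((\<lambda>z. complex_of_real (\<Omega> z)) ` annulus e)"
    by (intro compact_imp_bounded compact_continuous_image e compact_annulus)
  then obtain K where K: "K > 0" "\<And>z. z \<in> annulus e \<Longrightarrow> norm (complex_of_real (\<Omega> z)) \<le> K"
    using bounded_pos[of "(\<lambda>z. complex_of_real (\<Omega> z)) ` annulus e"] by blast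
  then show ?thesis using annulus_mono
    by (intro exI[of _ K] conjI eventually_small_annulus[OF e(1)]) (auto simp: less_imp_le)
qed

end

context weighted_exterior
begin

lemma \<psi>_annulus_closure:
  assumes "annulus \<delta> \<subseteq> U'" "0 < \<delta>"
  shows "\<psi> ` annulus \<delta> \<subseteq> closure D" "\<psi> ` {z. 1 - \<delta> < norm z \<and> norm z < 1} \<subseteq> D"
proof -
  show "\<psi> ` annulus \<delta> \<subseteq> closure D"
  proof clarify
    fix z assume z: "z \<in> annulus \<delta>"
    show "\<psi> z \<in> closure D"
    proof (cases "norm z = 1")
      case True
      then show ?thesis using \<psi>_sphere by (auto simp: frontier_D image_subset_iff)
    next
      case False
      then have "\<psi> z \<in> D" using \<psi>_notin_D_iff[of z] z assms by (auto simp: annulus_def)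
      then show ?thesis using closure_subset by blast
    qed
  qed
  show "\<psi> ` {z. 1 - \<delta> < norm z \<and> norm z < 1} \<subseteq> D"
    using \<psi>_notin_D_iff assms by (force simp: annulus_def)
qed

text \<open>The maximum principle carries a bound from the image of the inner circle to the core.
  That image itself belongs to the complement of the open collar and is treated directly.\<close>

lemma poly_core_bound:
  assumes d: "0 < \<delta>" "\<delta> < 1" and A: "annulus \<delta> \<subseteq> U'"
    and bd: "\<And>z. norm z = 1 - \<delta> \<Longrightarrow> norm (poly q (\<psi> z)) \<le> Bd"
    and z: "z \<in> D - \<psi> ` {z. 1 - \<delta> < norm z \<and> norm z < 1}"
  shows "norm (poly q z) \<le> Bd"
proof (cases "z \<in> \<psi> ` annulus \<delta>")
  case True
  then obtain w where w: "w \<in> annulus \<delta>" "z = \<psi> w" by blast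
  have "norm w < 1" using \<psi>_notin_D_iff[of w] w z A by force
  then have "norm w = 1 - \<delta>" using w z by (auto simp: annulus_def)
  then show ?thesis using bd w by simp
next
  case False
  define O' where "O' = D - \<psi> ` annulus \<delta>"
  have zO: "z \<in> O'" using False z by (simp add: O'_def)
  note fr = frontier_core[OF d A, folded O'_def]
  show ?thesis
  proof (rule maximum_modulus_frontier[of "poly q" O'])
    show "poly q holomorphic_on interior O'" by (intro holomorphic_intros)
    show "continuous_on (closure O') (poly q)" by (intro continuous_intros)
    show "bounded O'" using D_props(2) by (rule bounded_subset) (auto simp: O'_def)
    show "norm (poly q x) \<le> Bd" if "x \<in> frontier O'" for x using fr(1) bd that by auto
  qed (rule zO)
qed

text \<open>The total integral is zero, so the collar contribution is the negative of the core
  contribution, at most area times supremum.\<close>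

lemma orthogonality_annulus:
  assumes d: "0 < \<delta>" "\<delta> < 1" and A: "annulus \<delta> \<subseteq> U'"
    and F: "continuous_on (closure D) F" and zero: "(LINT z:D|area_measure. F z) = 0"
    and bd: "\<And>z. z \<in> D - \<psi> ` {z. 1 - \<delta> < norm z \<and> norm z < 1} \<Longrightarrow> norm (F z) \<le> Bd" and Bd: "Bd \<ge> 0"
  shows "norm (polar_integral \<delta> (\<lambda>z. of_real ((norm (deriv \<psi> z))\<^sup>2) * F (\<psi> z))) \<le> measure lborel D * Bd"
proof -
  define E where "E = \<psi> ` {z. 1 - \<delta> < norm z \<and> norm z < 1}"
  define R where "R = D - E"
  have ED: "E \<subseteq> D" unfolding E_def by (rule \<psi>_annulus_closure(2)[OF A d(1)])
  have cov: "set_integrable lborel E F"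
    "(LINT z:E|lborel. F z) = polar_integral \<delta> (\<lambda>z. of_real ((norm (deriv \<psi> z))\<^sup>2) * F (\<psi> z))"
    unfolding E_def
    by (rule polar_change_of_variables[OF d U'_props(1) A \<psi>_props(1,2)
        continuous_on_subset[OF F \<psi>_annulus_closure(1)[OF A d(1)]]])+
  have cc: "compact (closure D)" using D_props(2) by (simp add: compact_closure)
  have cD: "set_integrable lborel (closure D) F"
    unfolding set_integrable_def by (rule borel_integrable_compact[OF cc F])
  have D: "set_integrable lborel D F"
    by (rule set_integrable_subset[OF cD]) (use D_props(1) closure_subset in auto)
  have "open E"
  proof -
    have "open {z::complex. 1 - \<delta> < norm z \<and> norm z < 1}"
      by (intro open_Collect_conj open_Collect_less continuous_intros)
    moreover have "{z. 1 - \<delta> < norm z \<and> norm z < 1} \<subseteq> U'" using A by (auto simp: annulus_def)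
    ultimately show ?thesis unfolding E_def using open_mapping_thm3 \<psi>_props
      by (meson holomorphic_on_subset inj_on_subset)
  qed
  then have Rm: "R \<in> sets borel" unfolding R_def using D_props(1) by auto
  have R: "set_integrable lborel R F"
    by (rule set_integrable_subset[OF D]) (use Rm in \<open>auto simp: R_def\<close>)
  have "(LINT z:D|area_measure. F z) = (LINT z:D|lborel. F z) / of_real pi"
    using D unfolding set_lebesgue_integral_def set_integrable_def
    by (intro integral_area_measure) (rule borel_measurable_integrable)
  then have "(LINT z:D|lborel. F z) = 0" using zero by simp
  moreover have "(LINT z:D|lborel. F z) = (LINT z:E|lborel. F z) + (LINT z:R|lborel. F z)"
  proof -
    have "D = E \<union> R" using ED by (auto simp: R_def)
    then show ?thesis using set_integral_Un[of E R lborel F] cov(1) R by (auto simp: R_def)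
  qed
  ultimately have "norm (LINT z:E|lborel. F z) = norm (LINT z:R|lborel. F z)"
    by (metis add.commute add_eq_0_iff norm_minus_cancel)
  also have "\<dots> \<le> (LINT z:R|lborel. Bd)"
  proof -
    have "emeasure lborel D < \<infinity>" using D_props(2) by (rule emeasure_bounded_finite)
    then have Rf: "emeasure lborel R < \<infinity>" using emeasure_mono[of R D lborel] D_props(1) by (auto simp: R_def)
    have iB: "integrable lborel (\<lambda>z. indicator R z *\<^sub>R Bd)" using Rm Rf by (intro integrable_scaleR_left integrable_real_indicator) auto
    show ?thesis unfolding set_lebesgue_integral_def
      using R[unfolded set_integrable_def] iB bd
      by (intro Bochner_Integration.integral_norm_bound_integral) (auto simp: indicator_def R_def E_def)
  qed
  also have "\<dots> = measure lborel R * Bd"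
    unfolding set_lebesgue_integral_def using Rm by simp
  also have "\<dots> \<le> measure lborel D * Bd"
  proof (intro mult_right_mono Bd)
    show "measure lborel R \<le> measure lborel D"
    proof (rule measure_mono_fmeasurable)
      show "D \<in> fmeasurable lborel"
        using D_props(1) emeasure_bounded_finite[OF D_props(2)] by (auto simp: fmeasurable_def)
    qed (use Rm in \<open>auto simp: R_def\<close>)
  qed
  finally show ?thesis unfolding cov(2) .
qed

end

subsection \<open>The coefficient functions of the expansion\<close>

locale orthogonal_expansion = weighted_exterior D U \<phi> c \<omega> \<Omega> V v
  for D U :: "complex set" and \<phi> :: "complex \<Rightarrow> complex" and c :: real
    and \<omega> \<Omega> :: "complex \<Rightarrow> real" and V :: "complex \<Rightarrow> complex" and v :: real +
  fixes p :: "nat \<Rightarrow> complex poly" and B :: "nat \<Rightarrow> complex \<Rightarrow> complex" and W :: "nat \<Rightarrow> complex set"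
  assumes orth: "\<And>N. monic_orthogonal_poly D \<omega> N (p N)"
    and W: "\<And>j. open (W j)" "\<And>j. - D \<subseteq> W j"
    and B_hol: "\<And>j. B j holomorphic_on W j"
    and B_0: "\<And>z. z \<in> W 0 \<Longrightarrow> B 0 z = 1"
    and B_inf: "\<And>j. j \<ge> 1 \<Longrightarrow> (B j \<longlongrightarrow> 0) at_infinity"
    and expansion: "\<And>(\<kappa>::nat) (A::real). A > 0 \<Longrightarrow>
      \<exists>K. \<forall>\<^sub>F N in sequentially. \<forall>z. infdist z (- D) \<le> A * ln (real N) / real N \<longrightarrow>
        (\<exists>E. norm E \<le> K / real N ^ (\<kappa> + 1) \<and>
          poly (p N) z = of_real (leading_const c v N) * deriv \<phi> z * \<phi> z ^ N * exp (V z)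
            * ((\<Sum>j\<le>\<kappa>. B j z / of_nat N ^ j) + E))"
begin

text \<open>The case j = 0 is set to the constant outright: \<open>B 0\<close> is known only on
  \<open>W 0\<close>, whereas X 0 = 1 is to hold as an equality of total functions.\<close>

definition X :: "nat \<Rightarrow> complex \<Rightarrow> complex" where
  "X j = (if j = 0 then (\<lambda>_. 1) else (\<lambda>z. B j (\<psi> z)))"

lemma X_0: "X 0 = (\<lambda>_. 1)"
  by (simp add: X_def)

lemma X_analytic: "X j analytic_on closed_exterior"
proof (cases "j = 0")
  case False
  have "B j analytic_on - D" unfolding analytic_on_holomorphic using B_hol[of j] W(1)[of j] W(2)[of j] by blast
  then have "(B j \<circ> \<psi>) analytic_on closed_exterior"
    by (intro analytic_on_compose[OF \<psi>_analytic]) (simp add: \<psi>_closed_exterior)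
  then show ?thesis using False by (simp add: X_def o_def)
qed (simp add: X_def)

lemma X_tendsto: "j \<ge> 1 \<Longrightarrow> (X j \<longlongrightarrow> 0) at_infinity"
  using filterlim_compose[OF B_inf \<psi>_at_infinity] by (simp add: X_def)

lemma X_germ: "circle_germ \<psi> G (X j)"
  by (rule circle_germ.hol[OF closed_exterior_analytic_on_sphere[OF X_analytic]])

lemma near_B_eq_X: "near (- D) (\<lambda>z. B j z = X j (\<phi> z))"
proof -
  have "B j z = X j (\<phi> z)" if "z \<in> U \<inter> W j" for z
    using that B_0 \<psi>_\<phi> by (cases "j = 0") (auto simp: X_def)
  moreover have "open (U \<inter> W j)" "- D \<subseteq> U \<inter> W j" using W \<phi>_props(1,2) by auto
  ultimately show ?thesis unfolding near_def by blast
qed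

lemma near_X_eq_B: "near (sphere 0 1) (\<lambda>z. B j (\<psi> z) = X j z)"
proof -
  have "open (U' \<inter> \<psi> -` W j)"
    using continuous_open_preimage[OF holomorphic_on_imp_continuous_on[OF \<psi>_props(1)] U'_props(1) W(1)] .
  moreover have "sphere 0 1 \<subseteq> U' \<inter> \<psi> -` W j"
  proof
    fix z :: complex assume "z \<in> sphere 0 1"
    then have "z \<in> closed_exterior" by (simp add: closed_exterior_def)
    then show "z \<in> U' \<inter> \<psi> -` W j" using U'_props(2) W(2)[of j] \<psi>_closed_exterior by blast
  qed
  moreover have "B j (\<psi> z) = X j z" if "z \<in> U' \<inter> \<psi> -` W j" for z
    using that B_0 by (cases "j = 0") (auto simp: X_def)
  ultimately show ?thesis unfolding near_def by blast
qed

text \<open>On the circle this is X j plus \<Xi> j, so membership in \<open>H2\<close> is precisely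
  the recursive condition of the theorem.\<close>

definition Y :: "nat \<Rightarrow> complex \<Rightarrow> complex" where
  "Y j z = (\<Sum>l\<le>j. (-1) ^ (j - l) * (op_T \<Omega> ^^ (j - l)) (X l) z)"

lemma Y_0: "Y 0 = X 0"
  by (simp add: Y_def fun_eq_iff)

lemma Y_germ: "circle_germ \<psi> G (Y j)"
  unfolding Y_def[abs_def]
  by (intro circle_germ_sum circle_germ_cmult op_T_pow_germ X_germ) auto

text \<open>Split off the term with l = j + 1 and extract one T, with a sign, from the others.
  Linearity of T holds along germs, hence so does this identity.\<close>

lemma Y_Suc: "near (sphere 0 1) (\<lambda>z. X (Suc j) z = Y (Suc j) z + op_T \<Omega> (Y j) z)"
proof -
  have "near (sphere 0 1) (\<lambda>z. op_T \<Omega> (\<lambda>z. \<Sum>l\<in>{..j}. (-1) ^ (j - l) * (op_T \<Omega> ^^ (j - l)) (X l) z) z =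
      (\<Sum>l\<in>{..j}. (-1) ^ (j - l) * op_T \<Omega> ((op_T \<Omega> ^^ (j - l)) (X l)) z))"
    by (rule op_T_sum) (auto intro: op_T_pow_germ X_germ)
  then show ?thesis
  proof (rule near_mono)
    fix z assume *: "op_T \<Omega> (\<lambda>z. \<Sum>l\<in>{..j}. (-1) ^ (j - l) * (op_T \<Omega> ^^ (j - l)) (X l) z) z =
      (\<Sum>l\<in>{..j}. (-1) ^ (j - l) * op_T \<Omega> ((op_T \<Omega> ^^ (j - l)) (X l)) z)"
    have "(\<Sum>l\<le>j. (-1) ^ (Suc j - l) * (op_T \<Omega> ^^ (Suc j - l)) (X l) z) =
        - (\<Sum>l\<le>j. (-1) ^ (j - l) * op_T \<Omega> ((op_T \<Omega> ^^ (j - l)) (X l)) z)"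
      unfolding sum_negf[symmetric] by (intro sum.cong) (auto simp: Suc_diff_le)
    then have "Y (Suc j) z = X (Suc j) z - op_T \<Omega> (Y j) z"
      using * by (simp add: Y_def[abs_def])
    then show "X (Suc j) z = Y (Suc j) z + op_T \<Omega> (Y j) z" by simp
  qed
qed

lemma Y_circle_analytic: "circle_analytic (Y j)"
  by (rule circle_germ_circle_analytic[OF \<psi> Y_germ])

section \<open>The expansion on a shrinking collar\<close>

definition partial_sum :: "nat \<Rightarrow> nat \<Rightarrow> complex \<Rightarrow> complex" where
  "partial_sum \<kappa> N z = (\<Sum>j\<le>\<kappa>. X j z / of_nat N ^ j)"

lemma partial_sum_analytic: "partial_sum \<kappa> N analytic_on closed_exterior"
  unfolding partial_sum_def[abs_def]
proof (rule analytic_on_sum)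
  fix j
  show "(\<lambda>z. X j z / of_nat N ^ j) analytic_on closed_exterior"
    using analytic_on_mult[OF X_analytic[of j] analytic_on_const[of "inverse (of_nat N ^ j)"]]
    by (simp add: divide_inverse)
qed

lemma partial_sum_eventually_bounded:
  "\<exists>K\<ge>0. \<forall>\<^sub>F \<delta> in at_right 0. \<forall>z\<in>annulus \<delta>. \<forall>N\<ge>1. norm (partial_sum \<kappa> N z) \<le> K"
proof -
  have "\<forall>j. \<exists>K\<ge>0. \<forall>\<^sub>F \<delta> in at_right 0. \<forall>z\<in>annulus \<delta>. norm (X j z) \<le> K"
    using circle_germ_eventually_bounded[OF X_germ] by blast
  from choice[OF this] obtain K where K: "\<And>j. K j \<ge> 0"
    "\<And>j. \<forall>\<^sub>F \<delta> in at_right 0. \<forall>z\<in>annulus \<delta>. norm (X j z) \<le> K j" by blast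
  have "\<forall>\<^sub>F \<delta> in at_right 0. \<forall>j\<in>{..\<kappa>}. \<forall>z\<in>annulus \<delta>. norm (X j z) \<le> K j"
    using K(2) by (intro eventually_ball_finite) auto
  then have "\<forall>\<^sub>F \<delta> in at_right 0. \<forall>z\<in>annulus \<delta>. \<forall>N\<ge>1. norm (partial_sum \<kappa> N z) \<le> (\<Sum>j\<le>\<kappa>. K j)"
  proof eventually_elim
    case (elim \<delta>)
    show ?case
    proof (intro ballI allI impI)
      fix z and N :: nat assume z: "z \<in> annulus \<delta>" and N: "1 \<le> N"
      show "norm (partial_sum \<kappa> N z) \<le> (\<Sum>j\<le>\<kappa>. K j)" unfolding partial_sum_def
      proof (rule sum_norm_le)
        fix j assume j: "j \<in> {..\<kappa>}"
        have "norm (X j z / of_nat N ^ j) = norm (X j z) / real N ^ j" by (simp add: norm_divide norm_power)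
        also have "\<dots> \<le> norm (X j z) / 1" using N by (intro divide_left_mono) (auto simp: one_le_power)
        also have "\<dots> \<le> K j" using elim j z by simp
        finally show "norm (X j z / of_nat N ^ j) \<le> K j" .
      qed
    qed
  qed
  then show ?thesis using K(1) by (intro exI[of _ "\<Sum>j\<le>\<kappa>. K j"] conjI sum_nonneg) auto
qed

text \<open>The leading factor of the expansion after the substitution \<psi>, where the power of
  \<phi> has become z^N.\<close>

definition prefactor :: "nat \<Rightarrow> complex \<Rightarrow> complex" where
  "prefactor N z = of_real (leading_const c v N) * deriv \<phi> (\<psi> z) * z ^ N * exp (V (\<psi> z))"

definition quot :: "nat \<Rightarrow> complex \<Rightarrow> complex" where
  "quot N z = poly (p N) (\<psi> z) / prefactor N z"

lemma leading_const_pos: "leading_const c v N > 0"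
  using \<phi>_props(7) by (simp add: leading_const_def)

lemma prefactor_nonzero: "z \<in> U' \<Longrightarrow> z \<noteq> 0 \<Longrightarrow> prefactor N z \<noteq> 0"
  using \<psi>_props(4)[of z] leading_const_pos[of N] by (auto simp: prefactor_def)

text \<open>A collar of width \<delta> is mapped within a constant multiple of \<delta> of the
  complement of \<open>D\<close>, so the expansion applies with a larger constant
  \<open>A\<close>.\<close>

lemma expansion_annulus:
  assumes a: "a > 0"
  shows "\<exists>K\<ge>0. \<forall>\<^sub>F N in sequentially. \<forall>z\<in>annulus (a * ln (real N) / real N).
     norm (quot N z - partial_sum \<kappa> N z) \<le> K / real N ^ (\<kappa> + 1)"
proof -
  obtain e where e: "0 < e" "e < 1" "annulus e \<subseteq> U'" using annulus_subset_U' by blast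
  obtain L where L: "L \<ge> 0" "\<And>\<delta> z. 0 \<le> \<delta> \<Longrightarrow> \<delta> \<le> e \<Longrightarrow> z \<in> annulus \<delta> \<Longrightarrow> infdist (\<psi> z) (- D) \<le> L * \<delta>"
    using infdist_\<psi>_annulus[OF e] by blast
  \<comment> \<open>Using L + 1 keeps \<open>A\<close> positive when L = 0.\<close>
  define A where "A = (L + 1) * a"
  have A: "A > 0" using L a by (simp add: A_def)
  obtain K where K: "\<forall>\<^sub>F N in sequentially. \<forall>z. infdist z (- D) \<le> A * ln (real N) / real N \<longrightarrow>
        (\<exists>E. norm E \<le> K / real N ^ (\<kappa> + 1) \<and>
          poly (p N) z = of_real (leading_const c v N) * deriv \<phi> z * \<phi> z ^ N * exp (V z)
            * ((\<Sum>j\<le>\<kappa>. B j z / of_nat N ^ j) + E))"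
    using expansion[OF A, of \<kappa>] by blast
  have "\<forall>\<^sub>F \<delta> in at_right 0. \<forall>j\<in>{..\<kappa>}. \<forall>z\<in>annulus \<delta>. B j (\<psi> z) = X j z"
    by (intro eventually_ball_finite ballI near_sphere_eventually_annulus near_X_eq_B) auto
  moreover have "\<forall>\<^sub>F \<delta> in at_right 0. 0 < \<delta> \<and> \<delta> \<le> e"
    by (rule eventually_small_annulus[OF e(1)]) auto
  ultimately have "\<forall>\<^sub>F \<delta> in at_right 0. (0 < \<delta> \<and> \<delta> \<le> e) \<and> (\<forall>j\<in>{..\<kappa>}. \<forall>z\<in>annulus \<delta>. B j (\<psi> z) = X j z)"
    by eventually_elim blast
  then have "\<forall>\<^sub>F N in sequentially. (0 < a * ln (real N) / real N \<and> a * ln (real N) / real N \<le> e) \<and>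
      (\<forall>j\<in>{..\<kappa>}. \<forall>z\<in>annulus (a * ln (real N) / real N). B j (\<psi> z) = X j z)"
    using ln_over_at_right_0[OF a] by (rule eventually_compose_filterlim)
  with K have "\<forall>\<^sub>F N in sequentially. \<forall>z\<in>annulus (a * ln (real N) / real N).
     norm (quot N z - partial_sum \<kappa> N z) \<le> \<bar>K\<bar> / real N ^ (\<kappa> + 1)"
  proof eventually_elim
    case (elim N)
    define \<delta> where "\<delta> = a * ln (real N) / real N"
    have d: "0 < \<delta>" "\<delta> \<le> e" and BX: "\<And>j z. j \<le> \<kappa> \<Longrightarrow> z \<in> annulus \<delta> \<Longrightarrow> B j (\<psi> z) = X j z"
      using elim(2) by (auto simp: \<delta>_def)
    show ?case unfolding \<delta>_def[symmetric]
    proof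
      fix z assume z: "z \<in> annulus \<delta>"
      have zU: "z \<in> U'" using z annulus_mono[OF d(2)] e(3) by blast
      have nz: "z \<noteq> 0" using z d e by (auto simp: annulus_def)
      have "infdist (\<psi> z) (- D) \<le> L * \<delta>" using L(2)[of \<delta> z] d z by simp
      also have "\<dots> \<le> (L + 1) * \<delta>" using d by simp
      also have "\<dots> = A * ln (real N) / real N" by (simp add: A_def \<delta>_def)
      finally obtain E where E: "norm E \<le> K / real N ^ (\<kappa> + 1)"
        "poly (p N) (\<psi> z) = of_real (leading_const c v N) * deriv \<phi> (\<psi> z) * \<phi> (\<psi> z) ^ N * exp (V (\<psi> z))
            * ((\<Sum>j\<le>\<kappa>. B j (\<psi> z) / of_nat N ^ j) + E)"
        using elim(1) by blast
      have "(\<Sum>j\<le>\<kappa>. B j (\<psi> z) / of_nat N ^ j) = partial_sum \<kappa> N z"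
        unfolding partial_sum_def by (intro sum.cong) (auto simp: BX z)
      then have "poly (p N) (\<psi> z) = prefactor N z * (partial_sum \<kappa> N z + E)"
        using E(2) \<phi>_\<psi>[OF zU] by (simp add: prefactor_def)
      then have "quot N z = partial_sum \<kappa> N z + E"
        using prefactor_nonzero[OF zU nz, of N] by (simp add: quot_def)
      moreover have "K / real N ^ (\<kappa> + 1) \<le> \<bar>K\<bar> / real N ^ (\<kappa> + 1)" by (intro divide_right_mono) auto
      ultimately show "norm (quot N z - partial_sum \<kappa> N z) \<le> \<bar>K\<bar> / real N ^ (\<kappa> + 1)"
        using E(1) by simp
    qed
  qed
  then show ?thesis by (intro exI[of _ "\<bar>K\<bar>"]) auto
qed

text \<open>Since (ln x) / x decreases beyond e, the collar belonging to N is contained in the one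
  belonging to N - m. The factor 2^(\<kappa>+1) pays for expressing the error in terms of N.\<close>

lemma expansion_annulus_shifted:
  assumes a: "a > 0"
  shows "\<exists>K\<ge>0. \<forall>\<^sub>F N in sequentially. \<forall>z\<in>annulus (a * ln (real N) / real N).
     norm (quot (N - m) z - partial_sum \<kappa> (N - m) z) \<le> K / real N ^ (\<kappa> + 1)"
proof -
  obtain K where K: "K \<ge> 0" "\<forall>\<^sub>F N in sequentially. \<forall>z\<in>annulus (a * ln (real N) / real N).
     norm (quot N z - partial_sum \<kappa> N z) \<le> K / real N ^ (\<kappa> + 1)"
    using expansion_annulus[OF a, of \<kappa>] by blast
  have "filterlim (\<lambda>N. N - m) sequentially sequentially"
    by (rule filterlim_minus_const_nat_at_top)
  from eventually_compose_filterlim[OF K(2) this]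
  have "\<forall>\<^sub>F N in sequentially. \<forall>z\<in>annulus (a * ln (real (N - m)) / real (N - m)).
     norm (quot (N - m) z - partial_sum \<kappa> (N - m) z) \<le> K / real (N - m) ^ (\<kappa> + 1)" .
  moreover have "\<forall>\<^sub>F N in sequentially. N \<ge> 2 * m + 6" by (rule eventually_ge_at_top)
  ultimately have "\<forall>\<^sub>F N in sequentially. \<forall>z\<in>annulus (a * ln (real N) / real N).
     norm (quot (N - m) z - partial_sum \<kappa> (N - m) z) \<le> (K * 2 ^ (\<kappa> + 1)) / real N ^ (\<kappa> + 1)"
  proof eventually_elim
    case (elim N)
    define M where "M = N - m"
    \<comment> \<open>The threshold 2 m + 6 guarantees both M > e, for the monotonicity, and N \<le>
      2 M.\<close>
    have M: "M \<ge> 3" "M \<le> N" "real N \<le> 2 * real M" using elim(2) by (auto simp: M_def)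
    have "exp 1 \<le> real M" using e_less_272 M(1) by linarith
    then have "ln (real N) / real N \<le> ln (real M) / real M" using M by (intro ln_x_over_x_mono) auto
    then have "a * (ln (real N) / real N) \<le> a * (ln (real M) / real M)" using a by (intro mult_left_mono) auto
    then have sub: "annulus (a * ln (real N) / real N) \<subseteq> annulus (a * ln (real M) / real M)"
      by (intro annulus_mono) simp
    have "K / real M ^ (\<kappa> + 1) \<le> (K * 2 ^ (\<kappa> + 1)) / real N ^ (\<kappa> + 1)"
    proof -
      have "real N ^ (\<kappa> + 1) \<le> (2 * real M) ^ (\<kappa> + 1)" using M by (intro power_mono) auto
      then have "K * real N ^ (\<kappa> + 1) \<le> K * (2 ^ (\<kappa> + 1) * real M ^ (\<kappa> + 1))"
        unfolding power_mult_distrib using K(1) by (rule mult_left_mono)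
      then show ?thesis using M by (simp add: field_simps)
    qed
    then show ?case using elim(1) sub unfolding M_def[symmetric] by (meson order_trans subsetD)
  qed
  then show ?thesis using K(1) by (intro exI[of _ "K * 2 ^ (\<kappa> + 1)"]) auto
qed

lemma weight_eventually_bounded:
  "\<exists>K\<ge>0. \<forall>\<^sub>F \<delta> in at_right 0. annulus \<delta> \<subseteq> U' \<and> (\<forall>z\<in>annulus \<delta>. norm (deriv \<phi> (\<psi> z) * exp (V (\<psi> z))) \<le> K)"
proof -
  obtain e1 where e1: "e1 > 0" "e1 < 1" "annulus e1 \<subseteq> U'" using annulus_subset_U' by blast
  have an: "(\<lambda>z. deriv \<phi> (\<psi> z) * exp (V (\<psi> z))) analytic_on closed_exterior"
  proof (intro analytic_on_mult)
    have "deriv \<phi> holomorphic_on U" by (rule holomorphic_deriv[OF \<phi>_props(3,1)])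
    then have "deriv \<phi> analytic_on U" using \<phi>_props(1) by (simp add: analytic_on_open)
    then have "deriv \<phi> analytic_on - D" using \<phi>_props(2) analytic_on_subset by blast
    then have "(deriv \<phi> \<circ> \<psi>) analytic_on closed_exterior"
      by (intro analytic_on_compose[OF \<psi>_analytic]) (simp add: \<psi>_closed_exterior)
    then show "(\<lambda>z. deriv \<phi> (\<psi> z)) analytic_on closed_exterior" by (simp add: o_def)
    have "exp analytic_on (UNIV :: complex set)" by (simp add: analytic_on_open holomorphic_on_exp)
    then have "exp analytic_on T" for T :: "complex set" by (rule analytic_on_subset) simp
    then have "(exp \<circ> (\<lambda>z. V (\<psi> z))) analytic_on closed_exterior"
      by (rule analytic_on_compose[OF V\<psi>_analytic])
    then show "(\<lambda>z. exp (V (\<psi> z))) analytic_on closed_exterior" by (simp add: o_def)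
  qed
  obtain K where K: "K \<ge> 0" "\<forall>\<^sub>F \<delta> in at_right 0. \<forall>z\<in>annulus \<delta>. norm (deriv \<phi> (\<psi> z) * exp (V (\<psi> z))) \<le> K"
    using circle_germ_eventually_bounded[OF circle_germ.hol[OF closed_exterior_analytic_on_sphere[OF an]]] by blast
  have "\<forall>\<^sub>F \<delta> in at_right 0. annulus \<delta> \<subseteq> U'"
    by (rule eventually_small_annulus[OF e1(1)]) (use annulus_mono e1(3) in blast)
  with K(2) have "\<forall>\<^sub>F \<delta> in at_right 0. annulus \<delta> \<subseteq> U' \<and> (\<forall>z\<in>annulus \<delta>. norm (deriv \<phi> (\<psi> z) * exp (V (\<psi> z))) \<le> K)"
    by eventually_elim blast
  then show ?thesis using K(1) by blast
qed

text \<open>The Jacobian |\<psi>'|^2 cancels the two factors \<phi>', and the exponentials of V and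
  of its conjugate combine with \<omega> to \<open>\<Omega>\<close>.\<close>

lemma pullback_kernel:
  assumes z: "z \<in> U'" "z \<noteq> 0"
  shows "of_real ((norm (deriv \<psi> z))\<^sup>2) * (poly (p N) (\<psi> z) * cnj (poly (p M) (\<psi> z)) * of_real (\<omega> (\<psi> z))) =
    of_real (leading_const c v N * leading_const c v M) * kernel N M (quot N) (quot M) z"
proof -
  define a where "a = deriv \<phi> (\<psi> z)"
  define b where "b = deriv \<psi> z"
  define E where "E = exp (V (\<psi> z))"
  have ab: "a * b = 1" unfolding a_def b_def by (rule \<psi>_props(4)[OF z(1)])
  have q: "poly (p n) (\<psi> z) = of_real (leading_const c v n) * a * z ^ n * E * quot n z" for n
    using prefactor_nonzero[OF z, of n] by (simp add: quot_def prefactor_def a_def E_def)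
  have E2: "E * cnj E = of_real (exp (2 * Re (V (\<psi> z))))"
  proof -
    have "E * cnj E = of_real ((norm E)\<^sup>2)" by (rule complex_norm_square[symmetric])
    also have "(norm E)\<^sup>2 = exp (2 * Re (V (\<psi> z)))" by (simp add: E_def exp_double)
    finally show ?thesis .
  qed
  have b2: "of_real ((norm b)\<^sup>2) = b * cnj b" by (rule complex_norm_square)
  have "of_real ((norm b)\<^sup>2) * (poly (p N) (\<psi> z) * cnj (poly (p M) (\<psi> z)) * of_real (\<omega> (\<psi> z))) =
     of_real (leading_const c v N * leading_const c v M) * ((a * b) * cnj (a * b)) *
      (z ^ N * cnj (z ^ M * quot M z) * (quot N z * ((E * cnj E) * of_real (\<omega> (\<psi> z)))))"
    unfolding q b2 by (simp add: mult_ac)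
  also have "\<dots> = of_real (leading_const c v N * leading_const c v M) * kernel N M (quot N) (quot M) z"
    unfolding ab E2 kernel_def \<Omega>_eq by simp
  finally show ?thesis by (simp add: b_def)
qed

text \<open>Two errors of the same order occur. The core contributes (1 - \<delta>)^N, made small by
  the width; replacing the exact quotients by partial sums costs N^(-\<kappa>-1) pointwise and gains
  1/N upon integration. The leading constants are common factors and divide out.\<close>

lemma orthogonality_quot:
  assumes m: "m \<ge> 1"
  shows "\<exists>C\<ge>0. \<forall>\<^sub>F N in sequentially.
    norm (polar_integral (real (\<kappa> + 2) * ln (real N) / real N)
      (kernel N (N - m) (partial_sum \<kappa> N) (partial_sum \<kappa> (N - m)))) \<le> C / real N ^ (\<kappa> + 2)"
proof -
  define a where "a = real (\<kappa> + 2)"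
  have a: "a > 0" by (simp add: a_def)
  obtain K1 where K1: "K1 \<ge> 0" "\<forall>\<^sub>F N in sequentially. \<forall>z\<in>annulus (a * ln (real N) / real N).
     norm (quot N z - partial_sum \<kappa> N z) \<le> K1 / real N ^ (\<kappa> + 1)" using expansion_annulus[OF a] by blast
  obtain K2 where K2: "K2 \<ge> 0" "\<forall>\<^sub>F N in sequentially. \<forall>z\<in>annulus (a * ln (real N) / real N).
     norm (quot (N - m) z - partial_sum \<kappa> (N - m) z) \<le> K2 / real N ^ (\<kappa> + 1)" using expansion_annulus_shifted[OF a] by blast
  obtain Sb where Sb: "Sb \<ge> 0" "\<forall>\<^sub>F \<delta> in at_right 0. \<forall>z\<in>annulus \<delta>. \<forall>N\<ge>1. norm (partial_sum \<kappa> N z) \<le> Sb"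
    using partial_sum_eventually_bounded by blast
  obtain H where H: "H \<ge> 0" "\<forall>\<^sub>F \<delta> in at_right 0. annulus \<delta> \<subseteq> U' \<and> (\<forall>z\<in>annulus \<delta>. norm (deriv \<phi> (\<psi> z) * exp (V (\<psi> z))) \<le> H)"
    using weight_eventually_bounded by blast
  obtain Ob where Ob: "Ob \<ge> 0" "\<forall>\<^sub>F \<delta> in at_right 0. \<forall>z\<in>annulus \<delta>. norm (complex_of_real (\<Omega> z)) \<le> Ob"
    using \<Omega>_eventually_bounded by blast
  obtain Kw where Kw: "Kw > 0" "\<And>z. z \<in> D \<Longrightarrow> \<bar>\<omega> z\<bar> \<le> Kw" using \<omega>_bounded by blast
  define Q where "Q = Sb + K1 + K2"
  have Q: "Q \<ge> 0" using Sb K1 K2 by (simp add: Q_def)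
  \<comment> \<open>\<open>C1\<close> accounts for the core and \<open>C2\<close> for replacing
    quotients by partial sums.\<close>
  define C1 where "C1 = measure lborel D * (Kw * (H * Q)\<^sup>2)"
  define C2 where "C2 = 2 * pi * (Ob * (K1 * Q + Sb * K2))"
  have "\<forall>\<^sub>F \<delta> in at_right 0. (0 < \<delta> \<and> \<delta> \<le> 1/2) \<and>
     (\<forall>z\<in>annulus \<delta>. \<forall>N\<ge>1. norm (partial_sum \<kappa> N z) \<le> Sb) \<and> annulus \<delta> \<subseteq> U' \<and>
     (\<forall>z\<in>annulus \<delta>. norm (deriv \<phi> (\<psi> z) * exp (V (\<psi> z))) \<le> H) \<and> (\<forall>z\<in>annulus \<delta>. norm (complex_of_real (\<Omega> z)) \<le> Ob) \<and>
     continuous_on (annulus \<delta>) (\<lambda>z. complex_of_real (\<Omega> z)) \<and> (\<forall>j\<in>{..\<kappa>}. continuous_on (annulus \<delta>) (X j)) \<and>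
     continuous_on (annulus \<delta>) (\<lambda>z. V (\<psi> z))"
    (is "eventually ?P _")
  proof -
    have 1: "\<forall>\<^sub>F \<delta> in at_right (0::real). 0 < \<delta> \<and> \<delta> \<le> 1/2" by (rule eventually_small_annulus[of "1/2"]) auto
    have 2: "\<forall>\<^sub>F \<delta> in at_right 0. \<forall>j\<in>{..\<kappa>}. continuous_on (annulus \<delta>) (X j)"
      using circle_germ_eventually_continuous[OF X_germ] by (intro eventually_ball_finite) auto
    have 3: "\<forall>\<^sub>F \<delta> in at_right 0. continuous_on (annulus \<delta>) (\<lambda>z. V (\<psi> z))"
      by (intro circle_germ_eventually_continuous circle_germ.hol closed_exterior_analytic_on_sphere V\<psi>_analytic)
    from 1 2 3 Sb(2) H(2) Ob(2) \<Omega>_eventually_continuous show ?thesis by eventually_elim blast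
  qed
  from eventually_compose_filterlim[OF this ln_over_at_right_0[OF a]]
  have "\<forall>\<^sub>F N in sequentially. ?P (a * ln (real N) / real N)" .
  moreover have "\<forall>\<^sub>F N in sequentially. N \<ge> m + 1" by (rule eventually_ge_at_top)
  ultimately have "\<forall>\<^sub>F N in sequentially. norm (polar_integral (a * ln (real N) / real N)
      (kernel N (N - m) (partial_sum \<kappa> N) (partial_sum \<kappa> (N - m)))) \<le> (C1 + C2) / real N ^ (\<kappa> + 2)"
    using K1(2) K2(2)
  proof eventually_elim
    case (elim N)
    define \<delta> where "\<delta> = a * ln (real N) / real N"
    define M where "M = N - m"
    note el = elim[folded \<delta>_def M_def]
    have N: "N \<ge> 1" "M \<ge> 1" "M < N" using elim(2) m by (auto simp: M_def)
    have d: "0 < \<delta>" "\<delta> < 1" "\<delta> \<le> 1" using el(1) by auto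
    have sS: "\<And>z n. z \<in> annulus \<delta> \<Longrightarrow> n \<ge> 1 \<Longrightarrow> norm (partial_sum \<kappa> n z) \<le> Sb" and AU: "annulus \<delta> \<subseteq> U'"
      and sH: "\<And>z. z \<in> annulus \<delta> \<Longrightarrow> norm (deriv \<phi> (\<psi> z) * exp (V (\<psi> z))) \<le> H"
      and sO: "\<And>z. z \<in> annulus \<delta> \<Longrightarrow> norm (complex_of_real (\<Omega> z)) \<le> Ob"
      and cO: "continuous_on (annulus \<delta>) (\<lambda>z. complex_of_real (\<Omega> z))"
      and cX: "\<And>j. j \<le> \<kappa> \<Longrightarrow> continuous_on (annulus \<delta>) (X j)" and cV: "continuous_on (annulus \<delta>) (\<lambda>z. V (\<psi> z))"
      using el(1) by blast+
    have cS: "continuous_on (annulus \<delta>) (partial_sum \<kappa> n)" if "n \<ge> 1" for n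
      unfolding partial_sum_def[abs_def] using that cX by (intro continuous_intros) auto
    have nz: "z \<noteq> 0" if "z \<in> annulus \<delta>" for z using that d by (auto simp: annulus_def)
    have Npos: "real N ^ (\<kappa> + 1) \<ge> 1" using N by (simp add: one_le_power del: power_Suc)
    have dN: "norm (quot N z - partial_sum \<kappa> N z) \<le> K1 / real N ^ (\<kappa> + 1)"
      and dM: "norm (quot M z - partial_sum \<kappa> M z) \<le> K2 / real N ^ (\<kappa> + 1)" if "z \<in> annulus \<delta>" for z
      using el(3,4) that by blast+
    have le1: "K / real N ^ (\<kappa> + 1) \<le> K" if "K \<ge> 0" for K
      by (rule order_trans[OF divide_left_mono[OF Npos that]]) (use Npos in \<open>linarith, simp\<close>)
    have qN: "norm (quot N z) \<le> Q" and qM: "norm (quot M z) \<le> Q" if z: "z \<in> annulus \<delta>" for z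
      using norm_triangle_sub[of "quot N z" "partial_sum \<kappa> N z"] norm_triangle_sub[of "quot M z" "partial_sum \<kappa> M z"]
        dN[OF z] dM[OF z] le1[OF K1(1)] le1[OF K2(1)] sS[OF z N(1)] sS[OF z N(2)] K1(1) K2(1) unfolding Q_def by linarith+
    have c\<psi>: "continuous_on (annulus \<delta>) \<psi>"
      using \<psi>_props(1) AU by (meson holomorphic_on_imp_continuous_on holomorphic_on_subset)
    have cq: "continuous_on (annulus \<delta>) (quot n)" for n
    proof -
      have "continuous_on (annulus \<delta>) (\<lambda>z. deriv \<phi> (\<psi> z))"
        by (rule continuous_on_compose2[OF holomorphic_on_imp_continuous_on[OF holomorphic_deriv[OF \<phi>_props(3,1)]] c\<psi>])
          (use AU \<psi>_in_U in blast)
      then have pf: "continuous_on (annulus \<delta>) (prefactor n)"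
        unfolding prefactor_def[abs_def] by (intro continuous_intros cV)
      have "continuous_on (annulus \<delta>) (\<lambda>z. poly (p n) (\<psi> z))" by (intro continuous_intros c\<psi>)
      from continuous_on_divide[OF this pf] show ?thesis unfolding quot_def[abs_def]
        using prefactor_nonzero AU nz by blast
    qed
    define CN where "CN = leading_const c v N"
    define CM where "CM = leading_const c v M"
    have CNM: "CN > 0" "CM > 0" using leading_const_pos by (auto simp: CN_def CM_def)
    define F where "F z = poly (p N) z * cnj (poly (p M) z) * of_real (\<omega> z)" for z
    have Fc: "continuous_on (closure D) F" unfolding F_def by (intro continuous_intros \<omega>_continuous)
    have zero: "(LINT z:D|area_measure. F z) = 0"
      using orth[of N] orth[of M] N(3) unfolding monic_orthogonal_poly_def F_def by simp
    \<comment> \<open>On the inner circle the prefactor supplies (1 - \<delta>)^n; the maximum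
      principle extends the bound to the core.\<close>
    have pb: "norm (poly (p n) z) \<le> leading_const c v n * H * (1 - \<delta>) ^ n * Q"
      if qn: "\<And>z. z \<in> annulus \<delta> \<Longrightarrow> norm (quot n z) \<le> Q" and z: "z \<in> D - \<psi> ` {z. 1 - \<delta> < norm z \<and> norm z < 1}" for n z
    proof (rule poly_core_bound[OF d(1,2) AU _ z])
      fix w :: complex assume w: "norm w = 1 - \<delta>"
      then have wA: "w \<in> annulus \<delta>" using d by (simp add: annulus_def)
      have "poly (p n) (\<psi> w) = prefactor n w * quot n w"
        using prefactor_nonzero[of w n] wA AU nz[OF wA] by (auto simp: quot_def)
      then have "norm (poly (p n) (\<psi> w)) = leading_const c v n * norm (deriv \<phi> (\<psi> w) * exp (V (\<psi> w))) * (1 - \<delta>) ^ n * norm (quot n w)"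
        using leading_const_pos[of n] w by (simp add: prefactor_def norm_mult norm_power mult_ac)
      also have "\<dots> \<le> leading_const c v n * H * (1 - \<delta>) ^ n * Q"
        by (intro mult_mono mult_nonneg_nonneg qn[OF wA] sH[OF wA] order_refl)
          (use leading_const_pos[of n] d H(1) in auto)
      finally show "norm (poly (p n) (\<psi> w)) \<le> leading_const c v n * H * (1 - \<delta>) ^ n * Q" .
    qed
    define Bd where "Bd = CN * CM * (Kw * (H * Q)\<^sup>2 * (1 - \<delta>) ^ N)"
    have Bd: "Bd \<ge> 0" unfolding Bd_def using CNM Kw(1) d by (intro mult_nonneg_nonneg) auto
    have Fb: "norm (F z) \<le> Bd" if z: "z \<in> D - \<psi> ` {z. 1 - \<delta> < norm z \<and> norm z < 1}" for z
    proof -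
      have "norm (F z) = norm (poly (p N) z) * norm (poly (p M) z) * \<bar>\<omega> z\<bar>" by (simp add: F_def norm_mult)
      \<comment> \<open>The decay of one factor is enough, so the power belonging to M is estimated
        by 1.\<close>
      also have "\<dots> \<le> (CN * H * (1 - \<delta>) ^ N * Q) * (CM * H * 1 * Q) * Kw"
      proof (intro mult_mono mult_nonneg_nonneg)
        show "norm (poly (p N) z) \<le> CN * H * (1 - \<delta>) ^ N * Q" using pb[OF qN z] by (simp add: CN_def)
        have "norm (poly (p M) z) \<le> CM * H * (1 - \<delta>) ^ M * Q" using pb[OF qM z] by (simp add: CM_def)
        also have "\<dots> \<le> CM * H * 1 * Q"
          using d CNM H(1) Q by (intro mult_right_mono mult_left_mono power_le_one) auto
        finally show "norm (poly (p M) z) \<le> CM * H * 1 * Q" .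
        show "\<bar>\<omega> z\<bar> \<le> Kw" using Kw(2) z by blast
      qed (use d CNM H(1) Q in auto)
      also have "\<dots> = Bd" by (simp add: Bd_def power2_eq_square mult_ac)
      finally show ?thesis .
    qed
    have "norm (polar_integral \<delta> (\<lambda>z. of_real ((norm (deriv \<psi> z))\<^sup>2) * F (\<psi> z))) \<le> measure lborel D * Bd"
      by (rule orthogonality_annulus[OF d(1,2) AU Fc zero Fb Bd])
    also have "polar_integral \<delta> (\<lambda>z. of_real ((norm (deriv \<psi> z))\<^sup>2) * F (\<psi> z)) =
        polar_integral \<delta> (\<lambda>z. of_real (CN * CM) * kernel N M (quot N) (quot M) z)"
    proof (rule polar_integral_cong[OF d(3)])
      fix z assume "z \<in> annulus \<delta>"
      then show "of_real ((norm (deriv \<psi> z))\<^sup>2) * F (\<psi> z) = of_real (CN * CM) * kernel N M (quot N) (quot M) z"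
        unfolding F_def CN_def CM_def using AU nz by (intro pullback_kernel) auto
    qed
    also have "norm \<dots> = CN * CM * norm (polar_integral \<delta> (kernel N M (quot N) (quot M)))"
      unfolding polar_integral_cmult norm_mult norm_of_real using CNM by simp
    also have "measure lborel D * Bd = CN * CM * (C1 * (1 - \<delta>) ^ N)"
      by (simp add: Bd_def C1_def mult_ac)
    finally have 1: "norm (polar_integral \<delta> (kernel N M (quot N) (quot M))) \<le> C1 * (1 - \<delta>) ^ N"
      by (rule mult_left_le_imp_le) (use CNM in simp)
    have C1: "C1 \<ge> 0" unfolding C1_def using Kw by (intro mult_nonneg_nonneg) auto
    have "(1 - \<delta>) ^ N \<le> 1 / real N ^ (\<kappa> + 2)"
      unfolding \<delta>_def a_def by (rule one_minus_power_bound[OF N(1)]) (use d(3) in \<open>simp only: \<delta>_def a_def\<close>)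
    from mult_left_mono[OF this C1] have 2: "norm (polar_integral \<delta> (kernel N M (quot N) (quot M))) \<le> C1 / real N ^ (\<kappa> + 2)"
      using 1 by simp
    define Kc where "Kc = Ob * (K1 * Q + Sb * K2) / real N ^ (\<kappa> + 1)"
    have Kc: "Kc \<ge> 0" unfolding Kc_def using Ob K1 K2 Sb Q by auto
    have ck: "continuous_on (annulus \<delta>) (kernel N M (quot N) (quot M))"
      "continuous_on (annulus \<delta>) (kernel N M (partial_sum \<kappa> N) (partial_sum \<kappa> M))"
      by (intro continuous_on_kernel cq cS cO N)+
    have diff: "norm (kernel N M (quot N) (quot M) z - kernel N M (partial_sum \<kappa> N) (partial_sum \<kappa> M) z) \<le> Kc * norm z ^ N"
      if z: "z \<in> annulus \<delta>" for z
    proof -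
      define f f' h h' where "f = quot N z" and "f' = partial_sum \<kappa> N z" and "h = quot M z" and "h' = partial_sum \<kappa> M z"
      \<comment> \<open>The difference of products is written so that each summand contains one
        small factor and one bounded factor.\<close>
      have "kernel N M (quot N) (quot M) z - kernel N M (partial_sum \<kappa> N) (partial_sum \<kappa> M) z =
         z ^ N * (cnj (z ^ M) * (of_real (\<Omega> z) * ((f - f') * cnj h + f' * cnj (h - h'))))"
        by (simp add: kernel_def f_def f'_def h_def h'_def algebra_simps)
      also have "norm \<dots> = norm z ^ N * (norm z ^ M * (norm (complex_of_real (\<Omega> z)) * norm ((f - f') * cnj h + f' * cnj (h - h'))))"
        by (simp only: norm_mult norm_power complex_mod_cnj)
      also have "\<dots> \<le> norm z ^ N * (1 * (Ob * (K1 / real N ^ (\<kappa> + 1) * Q + Sb * (K2 / real N ^ (\<kappa> + 1)))))"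
      proof (intro mult_left_mono mult_mono)
        show "norm z ^ M \<le> 1" using z by (intro power_le_one) (auto simp: annulus_def)
        have "norm ((f - f') * cnj h) \<le> K1 / real N ^ (\<kappa> + 1) * Q"
          unfolding norm_mult complex_mod_cnj f_def f'_def h_def
          by (intro mult_mono dN[OF z] qM[OF z]) (use K1(1) in auto)
        moreover have "norm (f' * cnj (h - h')) \<le> Sb * (K2 / real N ^ (\<kappa> + 1))"
          unfolding norm_mult complex_mod_cnj f'_def h_def h'_def
          by (intro mult_mono dM[OF z] sS[OF z N(1)]) (use Sb(1) in auto)
        ultimately show "norm ((f - f') * cnj h + f' * cnj (h - h')) \<le> K1 / real N ^ (\<kappa> + 1) * Q + Sb * (K2 / real N ^ (\<kappa> + 1))"
          by (rule order_trans[OF norm_triangle_ineq add_mono])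
      qed (use sO[OF z] Ob(1) in auto)
      also have "\<dots> = Kc * norm z ^ N" by (simp add: Kc_def algebra_simps add_divide_distrib)
      finally show ?thesis .
    qed
    have "norm (polar_integral \<delta> (\<lambda>z. kernel N M (quot N) (quot M) z - kernel N M (partial_sum \<kappa> N) (partial_sum \<kappa> M) z)) \<le> 2 * pi * Kc / real (N + 1)"
      by (rule polar_integral_bound[OF continuous_on_diff[OF ck] less_imp_le[OF d(1)] d(3) Kc diff])
    also have "\<dots> \<le> 2 * pi * Kc / real N" using Kc N by (intro divide_left_mono) auto
    also have "\<dots> = C2 / real N ^ (\<kappa> + 2)" by (simp add: Kc_def C2_def mult_ac)
    finally have 3: "norm (polar_integral \<delta> (kernel N M (quot N) (quot M)) -
        polar_integral \<delta> (kernel N M (partial_sum \<kappa> N) (partial_sum \<kappa> M))) \<le> C2 / real N ^ (\<kappa> + 2)"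
      by (simp only: polar_integral_diff[OF ck d(3)])
    have "norm (polar_integral \<delta> (kernel N M (partial_sum \<kappa> N) (partial_sum \<kappa> M))) \<le> C1 / real N ^ (\<kappa> + 2) + C2 / real N ^ (\<kappa> + 2)"
      using norm_triangle_sub[of "polar_integral \<delta> (kernel N M (partial_sum \<kappa> N) (partial_sum \<kappa> M))" "polar_integral \<delta> (kernel N M (quot N) (quot M))"]
        2 3 by (simp only: norm_minus_commute)
    then show ?case by (simp only: \<delta>_def[symmetric] M_def[symmetric] add_divide_distrib)
  qed
  moreover have "C1 + C2 \<ge> 0" unfolding C1_def C2_def using Kw Ob K1 K2 Sb Q
    by (intro add_nonneg_nonneg mult_nonneg_nonneg) auto
  ultimately show ?thesis unfolding a_def by blast
qed

end

section \<open>Vanishing of the negative Fourier coefficients\<close>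

lemma eq_0_if_norm_le_over_nat:
  fixes x :: "'a::real_normed_vector"
  assumes "\<forall>\<^sub>F N in sequentially. norm x \<le> C / real N"
  shows "x = 0"
proof -
  have "(\<lambda>N. C / real N) \<longlonglongrightarrow> 0" using tendsto_mult_left[OF lim_1_over_n, of C] by simp
  then have "norm x \<le> 0" by (rule tendsto_lowerbound[OF _ assms]) simp
  then show ?thesis by simp
qed

context orthogonal_expansion
begin

text \<open>Inserting \<open>X (Suc l) = Y (Suc l) + T (Y l)\<close> pairs the terms into
  combinations N Y + T Y, exactly those that \<open>one_step\<close> evaluates as traces; only
  \<open>Y \<kappa>\<close> remains unpaired.\<close>

lemma partial_sum_decomp:
  assumes "\<And>l. l < \<kappa> \<Longrightarrow> X (Suc l) z = Y (Suc l) z + op_T \<Omega> (Y l) z" "N \<ge> 1"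
  shows "partial_sum \<kappa> N z =
    (\<Sum>l<\<kappa>. (1 / of_nat N ^ Suc l) * (of_nat N * Y l z + op_T \<Omega> (Y l) z)) + (1 / of_nat N ^ \<kappa>) * Y \<kappa> z"
  using assms(1)
proof (induction \<kappa>)
  case 0
  show ?case by (simp add: partial_sum_def Y_0)
next
  case (Suc \<kappa>)
  have N: "(of_nat N :: complex) \<noteq> 0" using assms(2) by simp
  have "partial_sum (Suc \<kappa>) N z = partial_sum \<kappa> N z + X (Suc \<kappa>) z / of_nat N ^ Suc \<kappa>"
    by (simp add: partial_sum_def)
  also have "partial_sum \<kappa> N z =
    (\<Sum>l<\<kappa>. (1 / of_nat N ^ Suc l) * (of_nat N * Y l z + op_T \<Omega> (Y l) z)) + (1 / of_nat N ^ \<kappa>) * Y \<kappa> z"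
    using Suc.prems by (intro Suc.IH) auto
  also have "X (Suc \<kappa>) z = Y (Suc \<kappa>) z + op_T \<Omega> (Y \<kappa>) z" using Suc.prems by simp
  also have "(1 / of_nat N ^ \<kappa>) * Y \<kappa> z = (1 / of_nat N ^ Suc \<kappa>) * (of_nat N * Y \<kappa> z)"
    using N by simp
  finally show ?case by (simp add: algebra_simps add_divide_distrib)
qed

text \<open>On the circle the test function equals the constant 1 up to O(1/M), so the limit of the
  pairings sees a single power of z.\<close>

lemma partial_sum_minus_1_bound:
  "\<exists>K\<ge>0. \<forall>z M. norm z = 1 \<longrightarrow> M \<ge> 1 \<longrightarrow> norm (partial_sum \<kappa> M z - 1) \<le> K / real M"
proof -
  have "\<exists>K\<ge>0. \<forall>z. norm z = 1 \<longrightarrow> norm (X j z) \<le> K" for j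
  proof -
    have "bounded (X j ` sphere 0 1)"
      by (intro compact_imp_bounded compact_continuous_image analytic_on_imp_continuous_on
          closed_exterior_analytic_on_sphere X_analytic compact_sphere)
    then obtain K where "K > 0" "\<And>z. z \<in> sphere 0 1 \<Longrightarrow> norm (X j z) \<le> K"
      using bounded_pos[of "X j ` sphere 0 1"] by blast
    then show ?thesis by (intro exI[of _ K]) auto
  qed
  then have "\<forall>j. \<exists>K\<ge>0. \<forall>z. norm z = 1 \<longrightarrow> norm (X j z) \<le> K" by blast
  from choice[OF this] obtain K where K: "\<And>j. K j \<ge> 0" "\<And>j z. norm z = 1 \<Longrightarrow> norm (X j z) \<le> K j" by blast
  have "norm (partial_sum \<kappa> M z - 1) \<le> (\<Sum>j\<in>{1..\<kappa>}. K j) / real M" if z: "norm z = 1" and M: "M \<ge> 1" for z M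
  proof -
    have "{..\<kappa>} = insert 0 {1..\<kappa>}" by auto
    then have "partial_sum \<kappa> M z - 1 = (\<Sum>j\<in>{1..\<kappa>}. X j z / of_nat M ^ j)"
      by (simp add: partial_sum_def X_0)
    also have "norm \<dots> \<le> (\<Sum>j\<in>{1..\<kappa>}. K j / real M)"
    proof (rule sum_norm_le)
      fix j assume j: "j \<in> {1..\<kappa>}"
      have "real M ^ 1 \<le> real M ^ j" using M j by (intro power_increasing) auto
      then have "norm (X j z) / real M ^ j \<le> K j / real M"
        using K(1)[of j] K(2)[OF z, of j] M by (intro frac_le) auto
      then show "norm (X j z / of_nat M ^ j) \<le> K j / real M" by (simp add: norm_divide norm_power)
    qed
    finally show ?thesis by (simp add: sum_divide_distrib)
  qed
  then show ?thesis using K(1) by (intro exI[of _ "\<Sum>j\<in>{1..\<kappa>}. K j"] conjI sum_nonneg) auto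
qed

text \<open>The partial sum tends to 1 at infinity; the factor z^(-m) with m \<ge> 1 provides the
  required vanishing there.\<close>

lemma partial_sum_in_H2_minus0:
  assumes "m \<ge> 1"
  shows "(\<lambda>z. z powi (- int m) * partial_sum \<kappa> M z) \<in> H2_minus0"
proof -
  have eq: "z powi (- int m) = inverse (z ^ m)" for z :: complex by (simp add: power_int_minus)
  show ?thesis unfolding eq
  proof (rule exterior_in_H2_minus0)
    show "(\<lambda>z. inverse (z ^ m) * partial_sum \<kappa> M z) analytic_on closed_exterior"
      by (intro analytic_on_mult partial_sum_analytic analytic_on_inverse analytic_on_power analytic_on_ident)
        (auto simp: closed_exterior_def)
    have "((\<lambda>z. X j z) \<longlongrightarrow> (if j = 0 then 1 else 0)) at_infinity" for j
      using X_tendsto[of j] by (cases "j = 0") (auto simp: X_0)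
    then have 1: "(partial_sum \<kappa> M \<longlongrightarrow> (\<Sum>j\<le>\<kappa>. (if j = 0 then 1 else 0) * inverse (of_nat M ^ j))) at_infinity"
      unfolding partial_sum_def[abs_def] divide_inverse by (intro tendsto_intros)
    have "filterlim (\<lambda>z::complex. z ^ m) at_infinity at_infinity"
      using assms by (intro filterlim_power_at_infinity filterlim_ident) auto
    then have 2: "((\<lambda>z::complex. inverse (z ^ m)) \<longlongrightarrow> 0) at_infinity"
      by (rule filterlim_compose[OF tendsto_inverse_0])
    show "((\<lambda>z. inverse (z ^ m) * partial_sum \<kappa> M z) \<longlongrightarrow> 0) at_infinity"
      using tendsto_mult[OF 2 1] by simp
  qed
qed

text \<open>Orthogonality of \<open>p N\<close> to \<open>p (N - m)\<close>, expanded to order \<open>\<kappa>\<close>, forces the Fourier coefficient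
  of \<open>Y \<kappa>\<close> at \<open>- m\<close> to vanish once those of the lower \<open>Y l\<close> do.\<close>

lemma Y_in_H2: "Y \<kappa> \<in> H2"
proof (induction \<kappa> rule: less_induct)
  case (less \<kappa>)
  have contY: "continuous_on (sphere 0 1) (Y l)" for l by (rule circle_analytic_continuous[OF Y_circle_analytic])
  have YL: "Y \<kappa> \<in> L2_circle" by (rule continuous_in_L2_circle[OF contY])
  have "fourier_coeff (Y \<kappa>) n = 0" if n: "n < 0" for n
  proof -
    define m where "m = nat (- n)"
    have m: "m \<ge> 1" "n = - int m" using n by (auto simp: m_def)
    define \<delta> where "\<delta> N = real (\<kappa> + 2) * ln (real N) / real N" for N
    obtain C4 where C4: "C4 \<ge> 0" "\<forall>\<^sub>F N in sequentially. norm (polar_integral (\<delta> N)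
      (kernel N (N - m) (partial_sum \<kappa> N) (partial_sum \<kappa> (N - m)))) \<le> C4 / real N ^ (\<kappa> + 2)"
      using orthogonality_quot[OF m(1), of \<kappa>] unfolding \<delta>_def by blast
    obtain Sb where Sb: "Sb \<ge> 0" "\<forall>\<^sub>F \<delta> in at_right 0. \<forall>z\<in>annulus \<delta>. \<forall>N\<ge>1. norm (partial_sum \<kappa> N z) \<le> Sb"
      using partial_sum_eventually_bounded by blast
    define step where "step f C \<delta> \<longleftrightarrow> (\<forall>h B N M. h analytic_on annulus \<delta> \<longrightarrow> (\<forall>z\<in>annulus \<delta>. norm (h z) \<le> B) \<longrightarrow>
     norm (polar_integral \<delta> (kernel N M f h)) \<le> C * B / real (N + 1) \<and>
     norm (of_nat N * polar_integral \<delta> (kernel N M f h) + polar_integral \<delta> (kernel N M (op_T \<Omega> f) h)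
       - integral {0..2*pi} (\<lambda>t. kernel N M f h (cis t)) / 2) \<le> C * B * (1-\<delta>) ^ N)" for f C \<delta>
    have "\<forall>l. \<exists>C\<ge>0. \<forall>\<^sub>F \<delta> in at_right 0. step (Y l) C \<delta>"
      unfolding step_def using one_step_eventually[OF Y_germ] by blast
    from choice[OF this] obtain C where C: "\<And>l. C l \<ge> 0" "\<And>l. \<forall>\<^sub>F \<delta> in at_right 0. step (Y l) (C l) \<delta>" by blast
    obtain C' where C': "C' \<ge> 0" "\<forall>\<^sub>F \<delta> in at_right 0. step (op_T \<Omega> (Y \<kappa>)) C' \<delta>"
      unfolding step_def using one_step_eventually[OF op_T_germ(1)[OF Y_germ]] by blast
    obtain K8 where K8: "K8 \<ge> 0" "\<And>z M. norm z = 1 \<Longrightarrow> M \<ge> 1 \<Longrightarrow> norm (partial_sum \<kappa> M z - 1) \<le> K8 / real M"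
      using partial_sum_minus_1_bound by blast
    \<comment> \<open>\<open>C5\<close> bounds the \<open>Y \<kappa>\<close> term after the brackets
      are removed, \<open>C6\<close> its trace, and \<open>C7\<close> is the mean modulus of
      \<open>Y \<kappa>\<close> used against the deviation of the test function from a pure
      power.\<close>
    define C5 where "C5 = C4 + (\<Sum>l<\<kappa>. C l * Sb)"
    define C6 where "C6 = C5 + C' * Sb + C \<kappa> * Sb"
    define C7 where "C7 = (LINT t|angle_measure. norm (Y \<kappa> (cis t))) / (2 * pi)"
    have C7: "C7 \<ge> 0" unfolding C7_def by simp
    have "\<forall>\<^sub>F \<delta> in at_right 0. (0 < \<delta> \<and> \<delta> \<le> 1/2) \<and> (\<forall>z\<in>annulus \<delta>. \<forall>N\<ge>1. norm (partial_sum \<kappa> N z) \<le> Sb) \<and>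
       (\<forall>l\<in>{..\<kappa>}. step (Y l) (C l) \<delta>) \<and> step (op_T \<Omega> (Y \<kappa>)) C' \<delta> \<and>
       (\<forall>l\<in>{..<\<kappa>}. \<forall>z\<in>annulus \<delta>. X (Suc l) z = Y (Suc l) z + op_T \<Omega> (Y l) z) \<and>
       (\<forall>l\<in>{..\<kappa>}. continuous_on (annulus \<delta>) (Y l)) \<and> (\<forall>l\<in>{..\<kappa>}. continuous_on (annulus \<delta>) (op_T \<Omega> (Y l))) \<and>
       continuous_on (annulus \<delta>) (\<lambda>z. complex_of_real (\<Omega> z)) \<and> (\<forall>j\<in>{..\<kappa>}. \<forall>z\<in>annulus \<delta>. X j analytic_on {z})"
      (is "eventually ?P _")
    proof -
      have 1: "\<forall>\<^sub>F \<delta> in at_right (0::real). 0 < \<delta> \<and> \<delta> \<le> 1/2" by (rule eventually_small_annulus[of "1/2"]) auto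
      have 2: "\<forall>\<^sub>F \<delta> in at_right 0. \<forall>l\<in>{..\<kappa>}. step (Y l) (C l) \<delta>"
        using C(2) by (intro eventually_ball_finite) auto
      have 3: "\<forall>\<^sub>F \<delta> in at_right 0. \<forall>l\<in>{..<\<kappa>}. \<forall>z\<in>annulus \<delta>. X (Suc l) z = Y (Suc l) z + op_T \<Omega> (Y l) z"
        by (intro eventually_ball_finite ballI near_sphere_eventually_annulus Y_Suc) auto
      have 4: "\<forall>\<^sub>F \<delta> in at_right 0. \<forall>l\<in>{..\<kappa>}. continuous_on (annulus \<delta>) (Y l)"
        by (intro eventually_ball_finite ballI circle_germ_eventually_continuous Y_germ) auto
      have 5: "\<forall>\<^sub>F \<delta> in at_right 0. \<forall>l\<in>{..\<kappa>}. continuous_on (annulus \<delta>) (op_T \<Omega> (Y l))"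
        by (intro eventually_ball_finite ballI circle_germ_eventually_continuous op_T_germ(1) Y_germ) auto
      have "near (sphere 0 1) (\<lambda>z. X j analytic_on {z})" for j
      proof -
        obtain T where "open T" "sphere 0 1 \<subseteq> T" "X j holomorphic_on T"
          using closed_exterior_analytic_on_sphere[OF X_analytic[of j]] by (auto simp: analytic_on_holomorphic)
        then show ?thesis unfolding near_def by (intro exI[of _ T]) (auto simp: analytic_at)
      qed
      then have 6: "\<forall>\<^sub>F \<delta> in at_right 0. \<forall>j\<in>{..\<kappa>}. \<forall>z\<in>annulus \<delta>. X j analytic_on {z}"
        by (intro eventually_ball_finite ballI near_sphere_eventually_annulus) auto
      from 1 Sb(2) 2 C'(2) 3 4 5 \<Omega>_eventually_continuous 6 show ?thesis by eventually_elim blast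
    qed
    moreover have "filterlim \<delta> (at_right 0) sequentially"
      unfolding \<delta>_def[abs_def] by (rule ln_over_at_right_0) simp
    ultimately have "\<forall>\<^sub>F N in sequentially. ?P (\<delta> N)" by (rule eventually_compose_filterlim)
    moreover have "\<forall>\<^sub>F N in sequentially. N \<ge> 2 * m + 1" by (rule eventually_ge_at_top)
    ultimately have "\<forall>\<^sub>F N in sequentially. norm (fourier_coeff (Y \<kappa>) n) \<le> (C6 + C7 * (2 * K8)) / real N"
      using C4(2)
    proof eventually_elim
      case (elim N)
      define d where "d = \<delta> N"
      define M where "M = N - m"
      define h where "h = partial_sum \<kappa> M"
      \<comment> \<open>From N \<ge> 2 m + 1 follow M \<ge> 1 and N \<le> 2 M, so bounds in 1/M
        become bounds in 1/N.\<close>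
      have N: "N \<ge> 1" "M \<ge> 1" "M + m = N" "real N \<le> 2 * real M" using elim(2) m by (auto simp: M_def)
      note el = elim(1)[folded d_def]
      have d: "0 < d" "d \<le> 1" using el by auto
      have hb: "\<forall>z\<in>annulus d. norm (h z) \<le> Sb" using el N(2) unfolding h_def by blast
      have ha: "h analytic_on annulus d"
      proof -
        have "X j analytic_on annulus d" if "j \<le> \<kappa>" for j
          using el that by (subst analytic_on_analytic_at) auto
        then have "(\<lambda>z. X j z * inverse (of_nat M ^ j)) analytic_on annulus d" if "j \<le> \<kappa>" for j
          using that by (intro analytic_on_mult analytic_on_const)
        then show ?thesis unfolding h_def partial_sum_def[abs_def] divide_inverse
          by (intro analytic_on_sum) auto
      qed
      have cY: "\<And>l. l \<le> \<kappa> \<Longrightarrow> continuous_on (annulus d) (Y l)" "\<And>l. l \<le> \<kappa> \<Longrightarrow> continuous_on (annulus d) (op_T \<Omega> (Y l))"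
        and cO: "continuous_on (annulus d) (\<lambda>z. complex_of_real (\<Omega> z))" using el by blast+
      have ch: "continuous_on (annulus d) h" using ha by (rule analytic_on_imp_continuous_on)
      define I where "I l = polar_integral d (kernel N M (Y l) h)" for l
      define I' where "I' l = polar_integral d (kernel N M (op_T \<Omega> (Y l)) h)" for l
      define J where "J l = integral {0..2*pi} (\<lambda>t. kernel N M (Y l) h (cis t)) / 2" for l
      define g where "g z = z powi (- int m) * h z" for z
      have gH: "g \<in> H2_minus0" unfolding g_def[abs_def] h_def by (rule partial_sum_in_H2_minus0[OF m(1)])
      have hs: "continuous_on (sphere 0 1) h" unfolding h_def
        by (rule analytic_on_imp_continuous_on[OF closed_exterior_analytic_on_sphere[OF partial_sum_analytic]])
      have gs: "continuous_on (sphere 0 1) g" unfolding g_def[abs_def]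
        by (intro continuous_on_mult continuous_on_sphere_powi hs)
      have J: "J l = of_real pi * circle_inner (Y l) g" for l
        unfolding J_def integral_kernel_circle[OF N(3)]
        using integral_eq_circle_inner[OF contY[of l] gs] by (simp add: g_def)
      \<comment> \<open>By the induction hypothesis the lower \<open>Y l\<close> are orthogonal to
        the whole exterior test function, not just to its leading power.\<close>
      have J0: "J l = 0" if "l < \<kappa>" for l
        unfolding J using H2_orthogonal[OF Y_circle_analytic less.IH[OF that] gH] by simp
      have \<epsilon>: "(1 - d) ^ N \<le> 1 / real N ^ (\<kappa> + 2)"
        unfolding d_def \<delta>_def by (rule one_minus_power_bound[OF N(1)]) (use d(2) in \<open>simp only: d_def \<delta>_def\<close>)
      have st: "norm (of_nat N * I l + I' l - J l) \<le> C l * Sb / real N ^ (\<kappa> + 2)" if "l \<le> \<kappa>" for l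
      proof -
        have "step (Y l) (C l) d" using el that by blast
        then have "norm (of_nat N * I l + I' l - J l) \<le> C l * Sb * (1 - d) ^ N"
          unfolding step_def I_def I'_def J_def using ha hb by blast
        also have "\<dots> \<le> C l * Sb * (1 / real N ^ (\<kappa> + 2))" using C(1) Sb(1) by (intro mult_left_mono \<epsilon>) auto
        finally show ?thesis by simp
      qed
      have I'b: "norm (I' \<kappa>) \<le> C' * Sb / real N"
      proof -
        have "step (op_T \<Omega> (Y \<kappa>)) C' d" using el by blast
        then have "norm (I' \<kappa>) \<le> C' * Sb / real (N + 1)" unfolding step_def I'_def using ha hb by blast
        also have "\<dots> \<le> C' * Sb / real N" using C' Sb(1) N by (intro divide_left_mono) auto
        finally show ?thesis .
      qed
      have PI: "polar_integral d (kernel N M (partial_sum \<kappa> N) h) =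
         (\<Sum>l<\<kappa>. (1 / of_nat N ^ Suc l) * (of_nat N * I l + I' l)) + (1 / of_nat N ^ \<kappa>) * I \<kappa>"
      proof -
        define k where "k z = z ^ N * cnj (z ^ M * h z) * of_real (\<Omega> z)" for z
        have k: "kernel N M f h z = k z * f z" for f z by (simp add: kernel_def k_def mult_ac)
        have "polar_integral d (kernel N M (partial_sum \<kappa> N) h) =
          polar_integral d (\<lambda>z. (\<Sum>l<\<kappa>. (1 / of_nat N ^ Suc l) * (of_nat N * kernel N M (Y l) h z + kernel N M (op_T \<Omega> (Y l)) h z))
             + (1 / of_nat N ^ \<kappa>) * kernel N M (Y \<kappa>) h z)"
        proof (rule polar_integral_cong[OF d(2)])
          fix z assume z: "z \<in> annulus d"
          have "partial_sum \<kappa> N z = (\<Sum>l<\<kappa>. (1 / of_nat N ^ Suc l) * (of_nat N * Y l z + op_T \<Omega> (Y l) z)) + (1 / of_nat N ^ \<kappa>) * Y \<kappa> z"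
            by (rule partial_sum_decomp[OF _ N(1)]) (use el z in blast)
          then show "kernel N M (partial_sum \<kappa> N) h z = (\<Sum>l<\<kappa>. (1 / of_nat N ^ Suc l) * (of_nat N * kernel N M (Y l) h z + kernel N M (op_T \<Omega> (Y l)) h z))
             + (1 / of_nat N ^ \<kappa>) * kernel N M (Y \<kappa>) h z"
            unfolding k by (simp add: distrib_left sum_distrib_left mult_ac del: power_Suc)
        qed
        also have "\<dots> = (\<Sum>l<\<kappa>. polar_integral d (\<lambda>z. (1 / of_nat N ^ Suc l) * (of_nat N * kernel N M (Y l) h z + kernel N M (op_T \<Omega> (Y l)) h z)))
           + polar_integral d (\<lambda>z. (1 / of_nat N ^ \<kappa>) * kernel N M (Y \<kappa>) h z)"
        proof -
          have cT: "continuous_on (annulus d) (\<lambda>z. (1 / of_nat N ^ Suc l) * (of_nat N * kernel N M (Y l) h z + kernel N M (op_T \<Omega> (Y l)) h z))"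
            if "l \<in> {..<\<kappa>}" for l
            by (intro continuous_on_mult continuous_on_add continuous_on_const continuous_on_kernel cY cO ch) (use that in auto)
          have cR: "continuous_on (annulus d) (\<lambda>z. (1 / of_nat N ^ \<kappa>) * kernel N M (Y \<kappa>) h z)"
            by (intro continuous_on_mult continuous_on_const continuous_on_kernel cY cO ch) simp
          have "continuous_on (annulus d) (\<lambda>z. \<Sum>l<\<kappa>. (1 / of_nat N ^ Suc l) * (of_nat N * kernel N M (Y l) h z + kernel N M (op_T \<Omega> (Y l)) h z))"
            by (rule continuous_on_sum) (rule cT)
          from polar_integral_add[OF this cR d(2)] show ?thesis
            using polar_integral_sum[OF finite_lessThan cT d(2)] by (simp only:)
        qed
        also have "\<dots> = (\<Sum>l<\<kappa>. (1 / of_nat N ^ Suc l) * (of_nat N * I l + I' l)) + (1 / of_nat N ^ \<kappa>) * I \<kappa>"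
        proof -
          have "polar_integral d (\<lambda>z. (1 / of_nat N ^ Suc l) * (of_nat N * kernel N M (Y l) h z + kernel N M (op_T \<Omega> (Y l)) h z)) =
             (1 / of_nat N ^ Suc l) * (of_nat N * I l + I' l)" if l: "l \<in> {..<\<kappa>}" for l
          proof -
            have ck: "continuous_on (annulus d) (\<lambda>z. of_nat N * kernel N M (Y l) h z)" "continuous_on (annulus d) (kernel N M (op_T \<Omega> (Y l)) h)"
              by (intro continuous_on_mult continuous_on_const continuous_on_kernel cY cO ch, use l in simp)+
            show ?thesis unfolding polar_integral_cmult polar_integral_add[OF ck d(2)] I_def I'_def ..
          qed
          then have "(\<Sum>l<\<kappa>. polar_integral d (\<lambda>z. (1 / of_nat N ^ Suc l) * (of_nat N * kernel N M (Y l) h z + kernel N M (op_T \<Omega> (Y l)) h z))) =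
             (\<Sum>l<\<kappa>. (1 / of_nat N ^ Suc l) * (of_nat N * I l + I' l))" by (intro sum.cong refl)
          moreover have "polar_integral d (\<lambda>z. (1 / of_nat N ^ \<kappa>) * kernel N M (Y \<kappa>) h z) = (1 / of_nat N ^ \<kappa>) * I \<kappa>"
            unfolding I_def by (rule polar_integral_cmult)
          ultimately show ?thesis by (simp only:)
        qed
        finally show ?thesis .
      qed
      have Nk: "real N ^ k > 0" "norm (1 / of_nat N ^ k :: complex) = 1 / real N ^ k" "1 / real N ^ k \<le> 1" for k
        using N(1) by (auto simp: norm_divide norm_power one_le_power)
      \<comment> \<open>All brackets with l < \<kappa> reduce to their small Green remainders
        because the traces vanish; the unpaired term then inherits the bound from
        orthogonality.\<close>
      have "norm ((1 / of_nat N ^ \<kappa>) * I \<kappa>) \<le> C5 / real N ^ (\<kappa> + 2)"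
      proof -
        have "(1 / of_nat N ^ \<kappa>) * I \<kappa> = polar_integral d (kernel N M (partial_sum \<kappa> N) h)
           - (\<Sum>l<\<kappa>. (1 / of_nat N ^ Suc l) * (of_nat N * I l + I' l))" by (simp only: PI add_diff_cancel_left')
        then have "norm ((1 / of_nat N ^ \<kappa>) * I \<kappa>) \<le> norm (polar_integral d (kernel N M (partial_sum \<kappa> N) h))
           + norm (\<Sum>l<\<kappa>. (1 / of_nat N ^ Suc l) * (of_nat N * I l + I' l))" by (simp only: norm_triangle_ineq4)
        also have "\<dots> \<le> C4 / real N ^ (\<kappa> + 2) + (\<Sum>l<\<kappa>. C l * Sb / real N ^ (\<kappa> + 2))"
        proof (intro add_mono sum_norm_le)
          show "norm (polar_integral d (kernel N M (partial_sum \<kappa> N) h)) \<le> C4 / real N ^ (\<kappa> + 2)"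
            using elim(3) by (simp only: d_def M_def h_def)
          fix l assume l: "l \<in> {..<\<kappa>}"
          have "norm (of_nat N * I l + I' l) \<le> C l * Sb / real N ^ (\<kappa> + 2)" using st[of l] J0[of l] l by simp
          then have "norm (1 / of_nat N ^ Suc l :: complex) * norm (of_nat N * I l + I' l) \<le> 1 * (C l * Sb / real N ^ (\<kappa> + 2))"
            using Nk(2,3)[of "Suc l"] by (intro mult_mono) (auto simp del: power_Suc)
          then show "norm ((1 / of_nat N ^ Suc l) * (of_nat N * I l + I' l)) \<le> C l * Sb / real N ^ (\<kappa> + 2)"
            by (simp only: norm_mult mult_1)
        qed
        also have "\<dots> = C5 / real N ^ (\<kappa> + 2)" by (simp add: C5_def add_divide_distrib sum_divide_distrib)
        finally show ?thesis .
      qed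
      then have "norm (I \<kappa>) / real N ^ \<kappa> \<le> (C5 / (real N * real N)) / real N ^ \<kappa>"
        unfolding norm_mult Nk(2) by (simp add: mult_ac)
      then have "norm (I \<kappa>) \<le> C5 / (real N * real N)" using Nk(1)[of \<kappa>] by (simp only: divide_le_cancel)
      then have NI: "real N * norm (I \<kappa>) \<le> C5 / real N" using N(1) by (simp add: field_simps)
      \<comment> \<open>A second use of the Green formula: the integral of \<open>Y \<kappa>\<close>
        is O(1/N^2) and survives multiplication by N, the integral with T is O(1/N) by the radial
        gain, and the remainder is smaller still.\<close>
      have "norm (J \<kappa>) \<le> C6 / real N"
      proof -
        have "C \<kappa> * Sb / real N ^ (\<kappa> + 2) \<le> C \<kappa> * Sb / real N"
        proof (rule divide_left_mono)
          have "real N ^ 1 \<le> real N ^ (\<kappa> + 2)" using N(1) by (intro power_increasing) auto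
          then show "real N \<le> real N ^ (\<kappa> + 2)" by simp
        qed (use N(1) C(1) Sb(1) in auto)
        moreover have "norm (J \<kappa>) \<le> norm (of_nat N * I \<kappa>) + norm (I' \<kappa>) + norm (of_nat N * I \<kappa> + I' \<kappa> - J \<kappa>)"
          using norm_triangle_ineq4[of "of_nat N * I \<kappa> + I' \<kappa>" "of_nat N * I \<kappa> + I' \<kappa> - J \<kappa>"]
            norm_triangle_ineq[of "of_nat N * I \<kappa>" "I' \<kappa>"] by simp
        ultimately show ?thesis using st[of \<kappa>] I'b NI by (simp add: norm_mult C6_def add_divide_distrib)
      qed
      then have "pi * norm (circle_inner (Y \<kappa>) g) \<le> C6 / real N" unfolding J by (simp add: norm_mult)
      moreover have "1 * norm (circle_inner (Y \<kappa>) g) \<le> pi * norm (circle_inner (Y \<kappa>) g)"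
        using pi_gt3 by (intro mult_right_mono) auto
      ultimately have b1: "norm (circle_inner (Y \<kappa>) g) \<le> C6 / real N" by simp
      \<comment> \<open>The deviation of the test function from z^(-m); without it the pairing is
        the Fourier coefficient itself.\<close>
      define r where "r z = z powi (- int m) * (h z - 1)" for z
      have rs: "continuous_on (sphere 0 1) r" unfolding r_def[abs_def]
        by (intro continuous_on_mult continuous_on_sphere_powi continuous_on_diff hs continuous_on_const)
      have rL: "r \<in> L2_circle" by (rule continuous_in_L2_circle[OF rs])
      have "g = (\<lambda>z. z powi (- int m) + r z)" by (simp add: g_def r_def fun_eq_iff algebra_simps)
      then have "circle_inner (Y \<kappa>) g = fourier_coeff (Y \<kappa>) n + circle_inner (Y \<kappa>) r"
        using circle_inner_add_right[OF powi_in_L2_circle rL YL, of "- int m"] by (simp only: fourier_coeff_def m(2))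
      moreover have "norm (circle_inner (Y \<kappa>) r) \<le> C7 * (2 * K8 / real N)" unfolding C7_def
      proof (rule circle_inner_bound[OF YL rL])
        fix z :: complex assume z: "norm z = 1"
        have "norm (r z) = norm (h z - 1)" using z by (simp add: r_def norm_mult norm_power_int)
        also have "\<dots> \<le> K8 / real M" unfolding h_def by (rule K8(2)[OF z N(2)])
        also have "\<dots> \<le> 2 * K8 / real N"
          using mult_left_mono[OF N(4) K8(1)] N(1,2) by (simp add: field_simps)
        finally show "norm (r z) \<le> 2 * K8 / real N" .
      qed
      ultimately have "norm (fourier_coeff (Y \<kappa>) n) \<le> C6 / real N + C7 * (2 * K8 / real N)"
        using b1 norm_triangle_ineq4[of "circle_inner (Y \<kappa>) g" "circle_inner (Y \<kappa>) r"] by simp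
      then show ?case by (simp add: add_divide_distrib)
    qed
    then show ?thesis by (rule eq_0_if_norm_le_over_nat)
  qed
  then show ?case using YL by (simp add: H2_def)
qed

section \<open>The recursion and its closed form\<close>

lemma X_H2_minus0: "j \<ge> 1 \<Longrightarrow> X j \<in> H2_minus0"
  by (rule exterior_in_H2_minus0[OF X_analytic X_tendsto])

lemma X_plus_Xi_H2: "(\<lambda>z. Xi \<Omega> X j z + X j z) \<in> H2"
proof -
  have "{..j} = insert j {..<j}" by auto
  then have "Xi \<Omega> X j z + X j z = Y j z" if "norm z = 1" for z
    using that by (simp add: Xi_def Y_def op_R_def)
  then show ?thesis using Y_in_H2[of j] H2_cong[of "\<lambda>z. Xi \<Omega> X j z + X j z" "Y j"] by simp
qed

text \<open>On the circle T (Y j) minus X (j+1) is -Y (j+1), an element of \<open>H2\<close>, so X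
  (j+1) is the exterior part of T (Y j).\<close>

lemma X_eq_op_Q_Y: "near closed_exterior (\<lambda>z. X (Suc j) z = op_Q (op_T \<Omega> (Y j)) z)"
proof (rule op_Q_unique)
  show "circle_analytic (op_T \<Omega> (Y j))" by (rule circle_germ_circle_analytic[OF \<psi> op_T_germ(1)[OF Y_germ]])
  show "X (Suc j) analytic_on closed_exterior" by (rule X_analytic)
  show "(X (Suc j) \<longlongrightarrow> 0) at_infinity" by (rule X_tendsto) simp
  have eq: "op_T \<Omega> (Y j) z - X (Suc j) z = (-1) * Y (Suc j) z" if "norm z = 1" for z
    using nearD[OF Y_Suc[of j], of z] that by simp
  show "(\<lambda>z. op_T \<Omega> (Y j) z - X (Suc j) z) \<in> H2"
    by (rule H2_cong[THEN iffD2, OF eq]) (assumption, rule H2_cmult[OF Y_in_H2])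
qed

text \<open>Inductively (Q - I) T (Y j) = X (j+1) - T (Y j) = Y (j+1). The equality is carried on a
  neighbourhood of the circle because the next application of T differentiates; inside Q the circle
  values suffice.\<close>

lemma op_QIT_pow: "near (sphere 0 1) (\<lambda>z. (op_QIT \<Omega> ^^ j) (X 0) z = Y j z)"
proof (induction j)
  case 0
  show ?case by (simp add: Y_0 near_iff)
next
  case (Suc j)
  define Z where "Z = (op_QIT \<Omega> ^^ j) (X 0)"
  have ZY: "near (sphere 0 1) (\<lambda>z. Y j z = Z z)" using Suc unfolding Z_def by (rule near_mono) simp
  have T: "near (sphere 0 1) (\<lambda>z. op_T \<Omega> (Y j) z = op_T \<Omega> Z z)" by (rule op_T_cong[OF Y_germ ZY])
  have Q: "op_Q (op_T \<Omega> (Y j)) = op_Q (op_T \<Omega> Z)"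
    using nearD[OF T] by (intro op_Q_cong) auto
  have "near (sphere 0 1) (\<lambda>z. X (Suc j) z = op_Q (op_T \<Omega> Z) z)"
    using X_eq_op_Q_Y[of j] unfolding Q by (rule near_closed_exterior_sphere)
  then have "near (sphere 0 1) (\<lambda>z. op_Q (op_T \<Omega> Z) z = Y (Suc j) z + op_T \<Omega> (Y j) z)"
    using Y_Suc[of j] by (rule near_elim2) simp
  then have "near (sphere 0 1) (\<lambda>z. op_QIT \<Omega> Z z = Y (Suc j) z)"
    using T by (rule near_elim2) (simp add: op_QIT_def)
  then show ?case by (simp add: Z_def)
qed

lemma op_T_QIT_pow:
  "near (sphere 0 1) (\<lambda>z. op_T \<Omega> ((op_QIT \<Omega> ^^ j) (X 0)) z = op_T \<Omega> (Y j) z)"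
proof -
  have "near (sphere 0 1) (\<lambda>z. op_T \<Omega> (Y j) z = op_T \<Omega> ((op_QIT \<Omega> ^^ j) (X 0)) z)"
    by (rule op_T_cong[OF Y_germ near_mono[OF op_QIT_pow[of j]]]) simp
  then show ?thesis by (rule near_mono) simp
qed

lemma X_eq_op_Q: "j \<ge> 1 \<Longrightarrow> near closed_exterior (\<lambda>z. X j z = op_Q (op_T \<Omega> ((op_QIT \<Omega> ^^ (j - 1)) (X 0))) z)"
proof -
  assume "j \<ge> 1"
  then obtain i where j: "j = Suc i" by (cases j) auto
  have "op_Q (op_T \<Omega> ((op_QIT \<Omega> ^^ i) (X 0))) = op_Q (op_T \<Omega> (Y i))"
    using nearD[OF op_T_QIT_pow[of i]] by (intro op_Q_cong) auto
  then show ?thesis using X_eq_op_Q_Y[of i] by (simp add: j)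
qed

text \<open>The operator \<open>op_Q\<close> is defined by choice, so instead of using linearity the
  weighted sum \<open>F\<close> of the X (j+1) is identified through uniqueness of the
  splitting.\<close>

lemma partial_sum_eq_op_Q:
  assumes N: "N \<ge> 1"
  shows "near closed_exterior (\<lambda>z. (\<Sum>j\<le>\<kappa>. X j z / of_nat N ^ j) = X 0 z + 1 / of_nat N *
     op_Q (op_T \<Omega> (\<lambda>w. \<Sum>j<\<kappa>. (op_QIT \<Omega> ^^ j) (X 0) w / of_nat N ^ j)) z)"
proof -
  define f where "f = (\<lambda>w. \<Sum>j<\<kappa>. (op_QIT \<Omega> ^^ j) (X 0) w / of_nat N ^ j)"
  define f' where "f' = (\<lambda>w. \<Sum>j\<in>{..<\<kappa>}. inverse (of_nat N ^ j) * Y j w)"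
  have f'g: "circle_germ \<psi> G f'" unfolding f'_def by (intro circle_germ_sum circle_germ_cmult Y_germ) auto
  have "near (sphere 0 1) (\<lambda>z. \<forall>j\<in>{..<\<kappa>}. (op_QIT \<Omega> ^^ j) (X 0) z = Y j z)"
    using op_QIT_pow unfolding near_iff by (auto intro!: eventually_ball_finite)
  then have "near (sphere 0 1) (\<lambda>z. f' z = f z)"
    by (rule near_mono) (simp add: f_def f'_def divide_inverse mult.commute)
  then have T1: "near (sphere 0 1) (\<lambda>z. op_T \<Omega> f' z = op_T \<Omega> f z)" by (rule op_T_cong[OF f'g])
  have T2: "near (sphere 0 1) (\<lambda>z. op_T \<Omega> f' z = (\<Sum>j\<in>{..<\<kappa>}. inverse (of_nat N ^ j) * op_T \<Omega> (Y j) z))"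
    unfolding f'_def by (rule op_T_sum) (auto intro: Y_germ)
  \<comment> \<open>The index is shifted by one: the factor 1/N in front of Q supplies the missing
    power.\<close>
  define F where "F = (\<lambda>z. \<Sum>j\<in>{..<\<kappa>}. inverse (of_nat N ^ j) * X (Suc j) z)"
  have "near closed_exterior (\<lambda>z. F z = op_Q (op_T \<Omega> f') z)"
  proof (rule op_Q_unique)
    show "circle_analytic (op_T \<Omega> f')" by (rule circle_germ_circle_analytic[OF \<psi> op_T_germ(1)[OF f'g]])
    show "F analytic_on closed_exterior" unfolding F_def
      by (intro analytic_on_sum analytic_on_mult analytic_on_const X_analytic)
    have "(F \<longlongrightarrow> (\<Sum>j\<in>{..<\<kappa>}. inverse (of_nat N ^ j) * 0)) at_infinity" unfolding F_def
      by (intro tendsto_intros X_tendsto) simp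
    then show "(F \<longlongrightarrow> 0) at_infinity" by simp
    have eq: "op_T \<Omega> f' z - F z = (\<Sum>j\<in>{..<\<kappa>}. (- inverse (of_nat N ^ j)) * Y (Suc j) z)" if "norm z = 1" for z
    proof -
      have "op_T \<Omega> f' z - F z = (\<Sum>j\<in>{..<\<kappa>}. inverse (of_nat N ^ j) * op_T \<Omega> (Y j) z - inverse (of_nat N ^ j) * X (Suc j) z)"
        using nearD[OF T2, of z] that by (simp add: F_def sum_subtractf)
      also have "\<dots> = (\<Sum>j\<in>{..<\<kappa>}. (- inverse (of_nat N ^ j)) * Y (Suc j) z)"
        using nearD[OF Y_Suc, of z] that by (intro sum.cong) (auto simp: algebra_simps)
      finally show ?thesis .
    qed
    have "(\<lambda>z. \<Sum>j\<in>{..<\<kappa>}. (- inverse (of_nat N ^ j)) * Y (Suc j) z) \<in> H2"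
      by (rule H2_sum) (simp, rule H2_cmult[OF Y_in_H2])
    then show "(\<lambda>z. op_T \<Omega> f' z - F z) \<in> H2"
      by (rule H2_cong[THEN iffD2, OF eq, rotated])
  qed
  moreover have "op_Q (op_T \<Omega> f') = op_Q (op_T \<Omega> f)" using nearD[OF T1] by (intro op_Q_cong) auto
  ultimately have "near closed_exterior (\<lambda>z. F z = op_Q (op_T \<Omega> f) z)" by simp
  then show ?thesis unfolding f_def[symmetric]
  proof (rule near_mono)
    fix z assume F: "F z = op_Q (op_T \<Omega> f) z"
    have "(\<Sum>j\<le>\<kappa>. X j z / of_nat N ^ j) = X 0 z + (\<Sum>j<\<kappa>. X (Suc j) z / of_nat N ^ Suc j)"
      by (simp add: sum.atMost_shift del: power_Suc)
    also have "(\<Sum>j<\<kappa>. X (Suc j) z / of_nat N ^ Suc j) = 1 / of_nat N * F z"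
      unfolding F_def sum_distrib_left by (intro sum.cong) (auto simp: divide_inverse mult_ac)
    finally show "(\<Sum>j\<le>\<kappa>. X j z / of_nat N ^ j) = X 0 z + 1 / of_nat N * op_Q (op_T \<Omega> f) z"
      by (simp add: F)
  qed
qed

text \<open>The difference of two solutions lies in both Hardy spaces.\<close>

lemma X_unique:
  assumes j: "j \<ge> 1" and Z: "Z \<in> H2_minus0" "Z = (\<lambda>z. - Xi \<Omega> X j z + h z)" "h \<in> H2"
  shows "circle_eq Z (X j)"
proof -
  have "(\<lambda>z. h z - (Xi \<Omega> X j z + X j z)) \<in> H2" by (rule H2_diff[OF Z(3) X_plus_Xi_H2])
  then have "(\<lambda>z. Z z - X j z) \<in> H2" by (simp add: Z(2) algebra_simps)
  moreover have "(\<lambda>z. Z z - X j z) \<in> H2_minus0" by (rule H2_minus0_diff[OF Z(1) X_H2_minus0[OF j]])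
  ultimately have "circle_eq (\<lambda>z. Z z - X j z) (\<lambda>_. 0)" by (rule H2_Int_H2_minus0)
  then show ?thesis by (simp add: circle_eq_def)
qed

end

theorem theorem1p3p1:
  fixes D U :: "complex set"
    and \<omega> \<Omega> :: "complex \<Rightarrow> real"
    and \<phi> V :: "complex \<Rightarrow> complex"
    and c v :: real
    and p :: "nat \<Rightarrow> complex poly"
    and B :: "nat \<Rightarrow> complex \<Rightarrow> complex"
    and W :: "nat \<Rightarrow> complex set"
  assumes dom: "analytic_jordan_domain D"
    and weight: "admissible_weight D \<omega>"
    and conf: "exterior_conformal_map D U \<phi> c"
    and szego: "szego_function D \<omega> V v"
    and orth: "\<And>N. monic_orthogonal_poly D \<omega> N (p N)"
    and Omega: "\<Omega> = modified_weight \<omega> U \<phi> V"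
    and W: "\<And>j. open (W j)" "\<And>j. connected (W j)" "\<And>j. - D \<subseteq> W j"
    and B_hol: "\<And>j. B j holomorphic_on W j"
    and B_bdd: "\<And>j. bounded (B j ` W j)"
    and B_0: "\<And>z. z \<in> W 0 \<Longrightarrow> B 0 z = 1"
    and B_inf: "\<And>j. j \<ge> 1 \<Longrightarrow> (B j \<longlongrightarrow> 0) at_infinity"
    and expansion: "\<And>(\<kappa>::nat) (A::real). A > 0 \<Longrightarrow>
      \<exists>K. \<forall>\<^sub>F N in sequentially. \<forall>z. infdist z (- D) \<le> A * ln (real N) / real N \<longrightarrow>
        (\<exists>E. norm E \<le> K / real N ^ (\<kappa> + 1) \<and>
          poly (p N) z = of_real (leading_const c v N) * deriv \<phi> z * \<phi> z ^ N * exp (V z)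
            * ((\<Sum>j\<le>\<kappa>. B j z / of_nat N ^ j) + E))"
  shows "\<exists>X :: nat \<Rightarrow> complex \<Rightarrow> complex.
      X 0 = (\<lambda>_. 1) \<and>
      (\<forall>j. X j analytic_on closed_exterior) \<and>
      (\<forall>j\<ge>1. (X j \<longlongrightarrow> 0) at_infinity) \<and>
      (\<forall>j. near (- D) (\<lambda>z. B j z = X j (\<phi> z))) \<and>
      (\<forall>j\<ge>1. X j \<in> H2_minus0 \<inter> {\<lambda>z. - Xi \<Omega> X j z + h z | h. h \<in> H2}) \<and>
      (\<forall>j\<ge>1. \<forall>Y \<in> H2_minus0 \<inter> {\<lambda>z. - Xi \<Omega> X j z + h z | h. h \<in> H2}. circle_eq Y (X j)) \<and>
      (\<forall>j\<ge>1. near closed_exterior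
         (\<lambda>z. X j z = op_Q (op_T \<Omega> ((op_QIT \<Omega> ^^ (j - 1)) (X 0))) z)) \<and>
      (\<forall>\<kappa>. \<forall>N\<ge>1. near closed_exterior
         (\<lambda>z. (\<Sum>j\<le>\<kappa>. X j z / of_nat N ^ j) =
           X 0 z + 1 / of_nat N *
             op_Q (op_T \<Omega> (\<lambda>w. \<Sum>j<\<kappa>. (op_QIT \<Omega> ^^ j) (X 0) w / of_nat N ^ j)) z))"
proof -
  interpret orthogonal_expansion D U \<phi> c \<omega> \<Omega> V v p B W
    by unfold_locales (fact dom conf weight szego Omega orth W B_hol B_0 B_inf expansion)+
  show ?thesis
  proof (intro exI[of _ X] conjI allI impI ballI)
    show "X 0 = (\<lambda>_. 1)" by (rule X_0)
    show "X j analytic_on closed_exterior" for j by (rule X_analytic)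
    show "(X j \<longlongrightarrow> 0) at_infinity" if "1 \<le> j" for j by (rule X_tendsto[OF that])
    show "near (- D) (\<lambda>z. B j z = X j (\<phi> z))" for j by (rule near_B_eq_X)
    show "X j \<in> H2_minus0 \<inter> {\<lambda>z. - Xi \<Omega> X j z + h z | h. h \<in> H2}" if "1 \<le> j" for j
    proof
      show "X j \<in> H2_minus0" by (rule X_H2_minus0[OF that])
      show "X j \<in> {\<lambda>z. - Xi \<Omega> X j z + h z | h. h \<in> H2}"
        using X_plus_Xi_H2[of j] by (intro CollectI exI[of _ "\<lambda>z. Xi \<Omega> X j z + X j z"]) simp
    qed
    show "circle_eq Z (X j)" if "1 \<le> j" "Z \<in> H2_minus0 \<inter> {\<lambda>z. - Xi \<Omega> X j z + h z | h. h \<in> H2}" for j Z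
      using that(2) X_unique[OF that(1)] by blast
    show "near closed_exterior (\<lambda>z. X j z = op_Q (op_T \<Omega> ((op_QIT \<Omega> ^^ (j - 1)) (X 0))) z)" if "1 \<le> j" for j
      by (rule X_eq_op_Q[OF that])
    show "near closed_exterior (\<lambda>z. (\<Sum>j\<le>\<kappa>. X j z / of_nat N ^ j) = X 0 z + 1 / of_nat N *
        op_Q (op_T \<Omega> (\<lambda>w. \<Sum>j<\<kappa>. (op_QIT \<Omega> ^^ j) (X 0) w / of_nat N ^ j)) z)" if "1 \<le> N" for \<kappa> N
      by (rule partial_sum_eq_op_Q[OF that])
  qed
qed

end
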